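(* Fix $\ell\in\{0,1,2\}$ and let $\{c_{jk}\}_{j\ge0,\,k=1,2,3}$ be scalars satisfying $$|c_{j1}|\ \text{and}\ |c_{j3}|=O\big((j!)^r\big)\ \text{for some } r<\log5/\log2,\qquad |c_{j2}|=O(R^j)\ \text{for some } R<\lambda_2 .$$ Then the power series $$\sum_{k=1}^3\sum_{j=0}^\infty c_{jk}P^{(\ell)}_{jk}(x)$$ converges uniformly and absolutely on $SG$ to a function $u\in\mathrm{dom}(\Delta^\infty)$, and it may be differentiated term by term: for every $n\ge 0$, $$\Delta^nu(x)=\sum_{k=1}^3\sum_{j=n}^\infty c_{jk}P^{(\ell)}_{(j-n)k}(x).$$ Moreover, for all $j\ge0$, $$c_{j1}=\Delta^ju(q_\ell),\qquad c_{j2}=\partial_n\Delta^ju(q_\ell),\qquad c_{j3}=\partial_T\Delta^ju(q_\ell).$$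
   Context: Let $q_0,q_1,q_2$ be the vertices of an equilateral triangle in the plane (indices mod 3), $F_i(x)=\frac12(x+q_i)$, and let $SG$ (Sierpinski gasket) be the unique nonempty compact set with $SG=\bigcup_{i=0}^2F_i(SG)$. For a word $w=(w_1,\dots,w_m)\in\{0,1,2\}^m$, $|w|=m$, put $F_w=F_{w_1}\circ\cdots\circ F_{w_m}$. $V_0=\{q_0,q_1,q_2\}$, $V_m=\bigcup_iF_i(V_{m-1})$, $V_*=\bigcup_mV_m$; for distinct $x,y\in V_m$, $x\sim_my$ means $x,y$ lie in a common set $F_w(SG)$ with $|w|=m$. Laplacian: $u\in\mathrm{dom}\,\Delta$ with $\Delta u=f$ means that $u,f$ are continuous on $SG$ and $\frac32 5^m\sum_{y\sim_mx}(u(y)-u(x))\to f(x)$ as $m\to\infty$, uniformly for $x\in V_*\setminus V_0$. Powers $\Delta^n$ and $\mathrm{dom}(\Delta^n)$ are defined iteratively; $\mathrm{dom}(\Delta^\infty)=\bigcap_n\mathrm{dom}(\Delta^n)$. Normal derivative: $\partial_nu(q_j)=\lim_{m\to\infty}(5/3)^m\big(2u(q_j)-u(F_j^mq_{j+1})-u(F_j^mq_{j-1})\big)$. Tangential derivative: $\partial_Tu(q_j)=\lim_{m\to\infty}5^m\big(u(F_j^mq_{j+1})-u(F_j^mq_{j-1})\big)$. $\mathcal H_j$ is the $(3j+3)$-dimensional space of solutions of $\Delta^{j+1}u=0$ on $SG$. The monomial $P^{(\ell)}_{jk}$ ($k=1,2,3$, $j\ge0$) is the unique function in $\mathcal H_j$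 such that for all $0\le m\le j$: $\Delta^mP^{(\ell)}_{jk}(q_\ell)=\delta_{mj}\delta_{k1}$, $\partial_n\Delta^mP^{(\ell)}_{jk}(q_\ell)=\delta_{mj}\delta_{k2}$, $\partial_T\Delta^mP^{(\ell)}_{jk}(q_\ell)=\delta_{mj}\delta_{k3}$. A Neumann eigenvalue is a $\lambda$ for which there is a nonzero $u\in\mathrm{dom}\,\Delta$ with $-\Delta u=\lambda u$ and $\partial_nu(q_i)=0$ for $i=0,1,2$. $\lambda_2\approx135.572126995788$ denotes the second nonzero Neumann eigenvalue (distinct eigenvalues in increasing order, not counting multiplicity). *)

theory Defs
  imports "HOL-Analysis.Analysis" "HOL-Library.Landau_Symbols"
begin

text \<open>
  The vertices are indexed by the three-element type \<open>3\<close>, whose arithmetic is modulo 3, so that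
  \<open>j + 1\<close> and \<open>j - 1\<close> are the cyclic successor and predecessor of \<open>j\<close>.
  Functions on the gasket are total functions on the plane; only their values on the gasket matter.
\<close>

definition equilateral :: "(3 \<Rightarrow> real^2) \<Rightarrow> bool" where
  "equilateral q \<longleftrightarrow> (\<exists>d>0. \<forall>i j. i \<noteq> j \<longrightarrow> dist (q i) (q j) = d)"

definition F :: "(3 \<Rightarrow> real^2) \<Rightarrow> 3 \<Rightarrow> real^2 \<Rightarrow> real^2" where
  "F q i x = (1/2) *\<^sub>R (x + q i)"

primrec F_word :: "(3 \<Rightarrow> real^2) \<Rightarrow> 3 list \<Rightarrow> real^2 \<Rightarrow> real^2" where
  "F_word q [] = id"
| "F_word q (i # w) = F q i \<circ> F_word q w"

definition SG :: "(3 \<Rightarrow> real^2) \<Rightarrow> (real^2) set" where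
  "SG q = (THE K. K \<noteq> {} \<and> compact K \<and> K = (\<Union>i. F q i ` K))"

primrec V :: "(3 \<Rightarrow> real^2) \<Rightarrow> nat \<Rightarrow> (real^2) set" where
  "V q 0 = range q"
| "V q (Suc m) = (\<Union>i. F q i ` V q m)"

definition neighbours :: "(3 \<Rightarrow> real^2) \<Rightarrow> nat \<Rightarrow> real^2 \<Rightarrow> (real^2) set" where
  "neighbours q m x = {y. x \<in> V q m \<and> y \<in> V q m \<and> x \<noteq> y \<and>
     (\<exists>w. length w = m \<and> x \<in> F_word q w ` SG q \<and> y \<in> F_word q w ` SG q)}"

text \<open>
  The level-\<open>m\<close> difference operator only makes sense at points of \<open>V q m\<close>; hence the limit
  is uniform over those \<open>x\<close> that are already present at level \<open>m\<close>.
\<close>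

definition has_laplacian ::
  "(3 \<Rightarrow> real^2) \<Rightarrow> (real^2 \<Rightarrow> 'a::real_normed_vector) \<Rightarrow> (real^2 \<Rightarrow> 'a) \<Rightarrow> bool" where
  "has_laplacian q u f \<longleftrightarrow> continuous_on (SG q) u \<and> continuous_on (SG q) f \<and>
     (\<forall>\<epsilon>>0. \<exists>M. \<forall>m\<ge>M. \<forall>x \<in> V q m - V q 0.
        dist ((3/2 * 5^m) *\<^sub>R (\<Sum>y\<in>neighbours q m x. u y - u x)) (f x) < \<epsilon>)"

text \<open>
  The Laplacian determines \<open>f\<close> only on the gasket; extending it by \<open>0\<close> makes it a function
  of \<open>u\<close>. It is meaningful only for \<open>u\<close> in the domain.
\<close>

definition laplacian ::
  "(3 \<Rightarrow> real^2) \<Rightarrow> (real^2 \<Rightarrow> 'a::real_normed_vector) \<Rightarrow> (real^2 \<Rightarrow> 'a)" where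
  "laplacian q u = (THE f. has_laplacian q u f \<and> (\<forall>x. x \<notin> SG q \<longrightarrow> f x = 0))"

primrec dom_laplacian_power ::
  "(3 \<Rightarrow> real^2) \<Rightarrow> nat \<Rightarrow> (real^2 \<Rightarrow> 'a::real_normed_vector) set" where
  "dom_laplacian_power q 0 = {u. continuous_on (SG q) u}"
| "dom_laplacian_power q (Suc n) =
     {u. (\<exists>f. has_laplacian q u f) \<and> laplacian q u \<in> dom_laplacian_power q n}"

definition dom_laplacian_infinity ::
  "(3 \<Rightarrow> real^2) \<Rightarrow> (real^2 \<Rightarrow> 'a::real_normed_vector) set" where
  "dom_laplacian_infinity q = (\<Inter>n. dom_laplacian_power q n)"

definition has_normal_derivative ::
  "(3 \<Rightarrow> real^2) \<Rightarrow> (real^2 \<Rightarrow> 'a::real_normed_vector) \<Rightarrow> 3 \<Rightarrow> 'a \<Rightarrow> bool" where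
  "has_normal_derivative q u j d \<longleftrightarrow>
     (\<lambda>m. (5/3)^m *\<^sub>R (2 *\<^sub>R u (q j) - u ((F q j ^^ m) (q (j + 1))) - u ((F q j ^^ m) (q (j - 1)))))
       \<longlonglongrightarrow> d"

definition has_tangential_derivative ::
  "(3 \<Rightarrow> real^2) \<Rightarrow> (real^2 \<Rightarrow> 'a::real_normed_vector) \<Rightarrow> 3 \<Rightarrow> 'a \<Rightarrow> bool" where
  "has_tangential_derivative q u j d \<longleftrightarrow>
     (\<lambda>m. 5^m *\<^sub>R (u ((F q j ^^ m) (q (j + 1))) - u ((F q j ^^ m) (q (j - 1))))) \<longlonglongrightarrow> d"

definition multiharmonic :: "(3 \<Rightarrow> real^2) \<Rightarrow> nat \<Rightarrow> (real^2 \<Rightarrow> real) set" where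
  "multiharmonic q j = {u \<in> dom_laplacian_power q (Suc j).
     \<forall>x\<in>SG q. (laplacian q ^^ Suc j) u x = 0}"

text \<open>The index \<open>k\<close> ranges over 1, 2, 3; vanishing off the gasket makes the description unique.\<close>

definition monomial :: "(3 \<Rightarrow> real^2) \<Rightarrow> 3 \<Rightarrow> nat \<Rightarrow> nat \<Rightarrow> real^2 \<Rightarrow> real" where
  "monomial q l j k = (THE P. P \<in> multiharmonic q j \<and> (\<forall>x. x \<notin> SG q \<longrightarrow> P x = 0) \<and>
     (\<forall>m\<le>j. (laplacian q ^^ m) P (q l) = of_bool (m = j \<and> k = 1) \<and>
            has_normal_derivative q ((laplacian q ^^ m) P) l (of_bool (m = j \<and> k = 2)) \<and>
            has_tangential_derivative q ((laplacian q ^^ m) P) l (of_bool (m = j \<and> k = 3))))"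

definition neumann_eigenvalue :: "(3 \<Rightarrow> real^2) \<Rightarrow> real \<Rightarrow> bool" where
  "neumann_eigenvalue q \<mu> \<longleftrightarrow> (\<exists>u :: real^2 \<Rightarrow> real. (\<exists>x\<in>SG q. u x \<noteq> 0) \<and>
     has_laplacian q u (\<lambda>x. - \<mu> * u x) \<and> (\<forall>i. has_normal_derivative q u i 0))"

definition lambda1 :: "(3 \<Rightarrow> real^2) \<Rightarrow> real" where
  "lambda1 q = (LEAST \<mu>. neumann_eigenvalue q \<mu> \<and> \<mu> \<noteq> 0)"

definition lambda2 :: "(3 \<Rightarrow> real^2) \<Rightarrow> real" where
  "lambda2 q = (LEAST \<mu>. neumann_eigenvalue q \<mu> \<and> \<mu> \<noteq> 0 \<and> \<mu> > lambda1 q)"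

end

theory Submission
  imports Defs "HOL-Complex_Analysis.Complex_Analysis"
begin

text \<open>
  Spectral decimation gives an entire function \<open>dec\<close> with \<open>dec (5 t) = dec t (5 + dec t)\<close> such that, for the
  solutions of \<open>\<Delta> u = t u\<close>, the graph Laplacian on level \<open>m\<close> acts as multiplication by \<open>dec (t / 5 ^ m)\<close>.
  The even eigenfunction \<open>cosine i\<close> centred at the vertex \<open>q i\<close> is entire in \<open>t\<close>, and its restrictions to the
  cells of level one are combinations, with coefficients linear in \<open>dec (t / 5)\<close>, of the three functions
  \<open>cosine j\<close> at \<open>t / 5\<close>. The monomials are the Taylor coefficients in \<open>t\<close> of \<open>cosine l\<close>, of an
  eigenfunction \<open>sine l\<close> with unit normal derivative and of an odd eigenfunction \<open>tang l\<close>. The functional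
  equation of \<open>dec\<close> bounds the coefficients of the two entire families by \<open>K 2 ^ n (n!) powr (- log 2 5)\<close>.
  The family \<open>sine l\<close> is meromorphic; its first pole \<open>t = - 25 decroot\<close>, where \<open>dec (t / 25) = - 3\<close>, is
  the negative of a Neumann eigenvalue, and so is \<open>- 5 decroot\<close>; hence its radius of convergence is at
  least \<open>lambda2\<close>. Term-by-term differentiation holds because the level-\<open>m\<close> identity is exact for
  formal power series, with an error that is uniformly \<open>O(5 ^ -m)\<close>.
\<close>

section \<open>Geometry of the gasket\<close>

lemma third_index:
  fixes i k :: 3
  assumes "i \<noteq> k"
  shows "- i - k \<noteq> i" "- i - k \<noteq> k" "- i - (- i - k) = k" "UNIV = {i, k, - i - k}"
proof -
  have *: "\<forall>i k::3. i \<noteq> k \<longrightarrow> - i - k \<noteq> i \<and> - i - k \<noteq> k \<and> (\<forall>j. j = i \<or> j = k \<or> j = - i - k)"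
    unfolding forall_3 by simp
  show "- i - k \<noteq> i" "- i - k \<noteq> k" "UNIV = {i, k, - i - k}" using * assms by blast+
qed simp

lemma succ_pred_index:
  fixes i :: 3
  shows "i + 1 \<noteq> i" "i - 1 \<noteq> i" "i + 1 \<noteq> i - 1" "- i - (i + 1) = i - 1" "- i - (i - 1) = i + 1"
    "- (i + 1) - i = i - 1" "- (i - 1) - i = i + 1"
    "- (i + 1) - (i - 1) = i" "- (i - 1) - (i + 1) = i" "UNIV = {i, i + 1, i - 1}"
proof -
  have *: "\<forall>i::3. i + 1 \<noteq> i \<and> i - 1 \<noteq> i \<and> i + 1 \<noteq> i - 1 \<and> - i - (i + 1) = i - 1 \<and> - i - (i - 1) = i + 1 \<and>
      - (i + 1) - i = i - 1 \<and> - (i - 1) - i = i + 1 \<and>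
      - (i + 1) - (i - 1) = i \<and> - (i - 1) - (i + 1) = i \<and> (\<forall>j. j = i \<or> j = i + 1 \<or> j = i - 1)"
    unfolding forall_3 by simp
  show "i + 1 \<noteq> i" "i - 1 \<noteq> i" "i + 1 \<noteq> i - 1" "- i - (i + 1) = i - 1" "- i - (i - 1) = i + 1"
    "- (i + 1) - i = i - 1" "- (i - 1) - i = i + 1"
    "- (i + 1) - (i - 1) = i" "- (i - 1) - (i + 1) = i" "UNIV = {i, i + 1, i - 1}"
    using * by blast+
qed

locale gasket =
  fixes q :: "3 \<Rightarrow> real^2"
  assumes equilateral: "equilateral q"
begin

definition centre :: "real^2" where
  "centre = (1/3) *\<^sub>R (q 1 + q 2 + q 3)"

text \<open>Barycentric coordinates: the squared distance of a vertex from the centre is a third of the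
  squared side length.\<close>

definition bary :: "3 \<Rightarrow> real^2 \<Rightarrow> real" where
  "bary i x = 1/3 + 2 / (dist (q 1) (q 2))\<^sup>2 * ((x - centre) \<bullet> (q i - centre))"

lemma bary_vertex: "bary i (q j) = (if i = j then 1 else 0)"
proof -
  obtain d where d: "d > 0" "\<And>i j. i \<noteq> j \<Longrightarrow> dist (q i) (q j) = d"
    using equilateral unfolding equilateral_def by blast
  define e where "e i = q i - centre" for i
  have e3: "e 3 = - e 1 - e 2"
    unfolding e_def centre_def by (simp add: vec_eq_iff algebra_simps)
  define A where "A = e 1 \<bullet> e 1"
  define A' where "A' = e 2 \<bullet> e 2"
  define B where "B = e 1 \<bullet> e 2"
  have dd: "(e i - e j) \<bullet> (e i - e j) = d\<^sup>2" if "i \<noteq> j" for i j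
    using d(2)[OF that] unfolding e_def by (simp add: dist_norm power2_norm_eq_inner[symmetric])
  have ex: "(x - y) \<bullet> (x - y) = x \<bullet> x - 2 * (x \<bullet> y) + y \<bullet> y" for x y :: "real^2"
    by (simp add: inner_diff_left inner_diff_right inner_commute)
  have e13: "e 1 \<bullet> e 3 = - A - B" "e 3 \<bullet> e 1 = - A - B" and e23: "e 2 \<bullet> e 3 = - B - A'" "e 3 \<bullet> e 2 = - B - A'"
    and e33: "e 3 \<bullet> e 3 = A + 2 * B + A'" and e12: "e 1 \<bullet> e 2 = B" "e 2 \<bullet> e 1 = B"
    and e11: "e 1 \<bullet> e 1 = A" "e 2 \<bullet> e 2 = A'"
    unfolding A_def A'_def B_def e3
    by (simp_all add: inner_diff_left inner_diff_right inner_commute)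
  have "A - 2 * B + A' = d\<^sup>2"
    using dd[of 1 2] unfolding ex e11 e12 by simp
  moreover have "4 * A + 4 * B + A' = d\<^sup>2"
    using dd[of 1 3] unfolding ex e11 e13 e33 by simp
  moreover have "A + 4 * B + 4 * A' = d\<^sup>2"
    using dd[of 2 3] unfolding ex e11 e23 e33 by simp
  ultimately have AB: "A = d\<^sup>2 / 3" "A' = d\<^sup>2 / 3" "B = - d\<^sup>2 / 6" by linarith+
  have "e i \<bullet> e j = (if i = j then d\<^sup>2/3 else - d\<^sup>2/6)"
  proof -
    have "\<forall>i j. e i \<bullet> e j = (if i = j then d\<^sup>2/3 else - d\<^sup>2/6)"
      unfolding forall_3 by (simp add: e11 e12 e13 e23 e33 AB)
    then show ?thesis by blast
  qed
  moreover have "dist (q 1) (q 2) = d" using d(2)[of 1 2] by simp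
  ultimately show ?thesis
    unfolding bary_def e_def[symmetric] using d(1) by (auto simp: inner_commute field_simps)
qed

lemma bary_sum: "bary i x + bary (i + 1) x + bary (i - 1) x = 1"
proof -
  have "(q 1 - centre) + (q 2 - centre) + (q 3 - centre) = 0"
    unfolding centre_def by (simp add: vec_eq_iff algebra_simps)
  then have "(x - centre) \<bullet> (q 1 - centre) + (x - centre) \<bullet> (q 2 - centre) + (x - centre) \<bullet> (q 3 - centre) = 0"
    by (metis inner_add_right inner_zero_right)
  then have "2 / (dist (q 1) (q 2))\<^sup>2 * ((x - centre) \<bullet> (q 1 - centre) + (x - centre) \<bullet> (q 2 - centre) +
      (x - centre) \<bullet> (q 3 - centre)) = 0" by simp
  then have "bary 1 x + bary 2 x + bary 3 x = 1"
    unfolding bary_def distrib_left by linarith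
  moreover have "\<forall>i. bary i x + bary (i + 1) x + bary (i - 1) x = bary 1 x + bary 2 x + bary 3 x"
  proof -
    have "(1::3) + 1 = 2" "(1::3) - 1 = 3" "(2::3) + 1 = 3" "(2::3) - 1 = 1" "(3::3) + 1 = 1" "(3::3) - 1 = 2"
      by simp_all
    then show ?thesis unfolding forall_3 by (simp only: add_ac simp_thms)
  qed
  ultimately show ?thesis by simp
qed

lemma bary_F: "bary i (F q k x) = (bary i x + (if i = k then 1 else 0)) / 2"
proof -
  have "F q k x - centre = (1/2) *\<^sub>R (x - centre) + (1/2) *\<^sub>R (q k - centre)"
    unfolding F_def by (simp add: vec_eq_iff algebra_simps)
  then have "(F q k x - centre) \<bullet> (q i - centre) =
      ((x - centre) \<bullet> (q i - centre) + (q k - centre) \<bullet> (q i - centre)) / 2"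
    by (simp only: inner_add_left inner_scaleR_left) simp
  then have "bary i (F q k x) = (bary i x + bary i (q k)) / 2"
    unfolding bary_def by (simp only: distrib_left times_divide_eq_right) (simp add: field_simps)
  then show ?thesis by (simp add: bary_vertex)
qed

lemma continuous_on_bary: "continuous_on S (bary i)"
  unfolding bary_def by (intro continuous_intros)

lemma inj_q: "q i = q j \<Longrightarrow> i = j"
  by (metis bary_vertex zero_neq_one)

lemma F_inj: "F q k x = F q k y \<longleftrightarrow> x = y"
  unfolding F_def by simp

lemma F_fix: "F q k (q k) = q k"
  unfolding F_def by (simp add: scaleR_2[symmetric])

lemma F_swap: "F q i (q j) = F q j (q i)"
  unfolding F_def by (simp add: add.commute)

lemma continuous_on_F: "continuous_on S (F q k)"
  unfolding F_def by (intro continuous_intros)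

lemma dist_F: "dist (F q k x) (F q k y) = dist x y / 2"
proof -
  have "F q k x - F q k y = (1/2) *\<^sub>R (x - y)" unfolding F_def by (simp add: scaleR_diff_right scaleR_add_right)
  then show ?thesis by (simp add: dist_norm)
qed

lemma F_funpow: "(F q k ^^ n) x = q k + (1/2)^n *\<^sub>R (x - q k)"
proof (induction n)
  case (Suc n)
  have "(F q k ^^ Suc n) x = F q k (q k + (1/2)^n *\<^sub>R (x - q k))" by (simp add: Suc)
  also have "\<dots> = q k + (1/2)^Suc n *\<^sub>R (x - q k)" unfolding F_def by (simp add: vec_eq_iff algebra_simps)
  finally show ?case .
qed simp

lemma F_funpow_tendsto: "(\<lambda>n. (F q k ^^ n) x) \<longlonglongrightarrow> q k"
proof -
  have "(\<lambda>n. q k + (1/2)^n *\<^sub>R (x - q k)) \<longlonglongrightarrow> q k + 0 *\<^sub>R (x - q k)"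
    by (intro tendsto_intros LIMSEQ_realpow_zero) auto
  then show ?thesis by (simp add: F_funpow)
qed

lemma vertex_in_V: "q i \<in> V q m"
proof (induction m)
  case (Suc m)
  then show ?case using F_fix[of i] by (metis UN_I UNIV_I V.simps(2) imageI)
qed simp

lemma V_mono: "V q m \<subseteq> V q (Suc m)"
proof (induction m)
  case 0
  then show ?case using vertex_in_V[of _ "Suc 0"] by auto
next
  case (Suc m)
  then have "(\<Union>i. F q i ` V q m) \<subseteq> (\<Union>i. F q i ` V q (Suc m))" by (intro UN_mono image_mono) auto
  then show ?case by (simp only: V.simps(2))
qed

lemma V_mono': "m \<le> n \<Longrightarrow> V q m \<subseteq> V q n"
  by (rule lift_Suc_mono_le[of "V q", OF V_mono])

lemma finite_V: "finite (V q m)"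
  by (induction m) auto

definition Vstar :: "(real^2) set" where "Vstar = (\<Union>m. V q m)"

lemma F_Vstar: "x \<in> Vstar \<Longrightarrow> F q k x \<in> Vstar"
  unfolding Vstar_def using V.simps(2)[of q] by fastforce

lemma attractor_closure:
  "closure Vstar \<noteq> {} \<and> compact (closure Vstar) \<and> closure Vstar = (\<Union>i. F q i ` closure Vstar)"
proof (intro conjI)
  show "closure Vstar \<noteq> {}" using vertex_in_V unfolding Vstar_def by (auto simp: closure_eq_empty)
  define B where "B = (\<Sum>i\<in>UNIV. norm (q i))"
  have Bq: "norm (q i) \<le> B" for i unfolding B_def by (rule member_le_sum) auto
  have "norm x \<le> B" if "x \<in> V q m" for x m
    using that
  proof (induction m arbitrary: x)
    case 0 then show ?case using Bq by auto
  next
    case (Suc m)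
    then obtain k y where "y \<in> V q m" "x = F q k y" by auto
    then show ?case using Suc.IH[of y] Bq[of k] norm_triangle_ineq[of y "q k"] unfolding F_def by simp
  qed
  then have "bounded Vstar" unfolding Vstar_def bounded_iff by auto
  then show c: "compact (closure Vstar)" by (simp add: compact_closure)
  show "closure Vstar = (\<Union>i. F q i ` closure Vstar)"
  proof
    have "closed (\<Union>i. F q i ` closure Vstar)"
      using c by (intro closed_UN ballI compact_imp_closed compact_continuous_image continuous_on_F) auto
    moreover have "Vstar \<subseteq> (\<Union>i. F q i ` closure Vstar)"
    proof
      fix x assume "x \<in> Vstar"
      then obtain m where "x \<in> V q (Suc m)" unfolding Vstar_def using V_mono by blast
      then obtain k y where "y \<in> V q m" "x = F q k y" by auto
      then show "x \<in> (\<Union>i. F q i ` closure Vstar)" unfolding Vstar_def using closure_subset by fastforce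
    qed
    ultimately show "closure Vstar \<subseteq> (\<Union>i. F q i ` closure Vstar)" by (rule closure_minimal[rotated])
    show "(\<Union>i. F q i ` closure Vstar) \<subseteq> closure Vstar"
    proof (intro UN_least)
      fix i
      show "F q i ` closure Vstar \<subseteq> closure Vstar"
        by (rule image_closure_subset[OF continuous_on_F]) (use F_Vstar closure_subset in auto)
    qed
  qed
qed

lemma attractor_unique:
  assumes K: "K \<noteq> {}" "compact K" "K = (\<Union>i. F q i ` K)"
  shows "K = closure Vstar"
proof
  have FK: "F q k x \<in> K" if "x \<in> K" for k x using K(3) that by blast
  have qK: "q k \<in> K" for k
  proof -
    obtain x where "x \<in> K" using K(1) by blast
    then have "(F q k ^^ n) x \<in> K" for n by (induction n) (auto simp: FK)
    then show ?thesis using F_funpow_tendsto[of k x] compact_imp_closed[OF K(2)]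
      by (metis closed_sequentially)
  qed
  have "V q m \<subseteq> K" for m
    by (induction m) (use qK FK in auto)
  then show "closure Vstar \<subseteq> K"
    unfolding Vstar_def by (intro closure_minimal compact_imp_closed K(2)) auto
  obtain D where D: "\<And>x. x \<in> K \<Longrightarrow> dist x (q 0) \<le> D"
    using compact_imp_bounded[OF K(2)] by (metis bounded_any_center dist_commute)
  have ap: "\<exists>y\<in>V q n. dist x y \<le> D / 2^n" if "x \<in> K" for x n
    using that
  proof (induction n arbitrary: x)
    case 0
    then show ?case using D by auto
  next
    case (Suc n)
    then obtain k x' where x': "x' \<in> K" "x = F q k x'" using K(3) by blast
    then obtain y where "y \<in> V q n" "dist x' y \<le> D / 2^n" using Suc.IH by blast
    then show ?case using x' by (intro bexI[of _ "F q k y"]) (auto simp: dist_F)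
  qed
  show "K \<subseteq> closure Vstar"
  proof
    fix x assume x: "x \<in> K"
    show "x \<in> closure Vstar"
      unfolding closure_approachable
    proof (intro allI impI)
      fix e :: real assume "e > 0"
      have "(\<lambda>n. D / 2^n) \<longlonglongrightarrow> 0" by real_asymp
      then have "\<forall>\<^sub>F n in sequentially. D / 2^n < e" using \<open>e > 0\<close> by (rule order_tendstoD(2))
      then obtain n where "D / 2^n < e" using eventually_happens' sequentially_bot by blast
      moreover obtain y where "y \<in> V q n" "dist x y \<le> D / 2^n" using ap[OF x] by blast
      ultimately show "\<exists>y\<in>Vstar. dist y x < e" unfolding Vstar_def by (auto simp: dist_commute intro!: bexI[of _ y])
    qed
  qed
qed

lemma SG_eq: "SG q = closure Vstar"
  unfolding SG_def
proof (rule the_equality)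
  show "closure Vstar \<noteq> {} \<and> compact (closure Vstar) \<and> closure Vstar = (\<Union>i. F q i ` closure Vstar)"
    by (rule attractor_closure)
  fix K :: "(real^2) set"
  assume K: "K \<noteq> {} \<and> compact K \<and> K = (\<Union>i. F q i ` K)"
  show "K = closure Vstar"
    by (rule attractor_unique[OF conjunct1[OF K] conjunct1[OF conjunct2[OF K]] conjunct2[OF conjunct2[OF K]]])
qed

lemma SG_compact: "compact (SG q)" and SG_F: "SG q = (\<Union>i. F q i ` SG q)"
  unfolding SG_eq
  by (rule attractor_closure[THEN conjunct2, THEN conjunct1])
     (rule attractor_closure[THEN conjunct2, THEN conjunct2])

lemma F_SG: "x \<in> SG q \<Longrightarrow> F q k x \<in> SG q"
  using SG_F by blast

lemma SG_cases: assumes "x \<in> SG q" obtains k y where "y \<in> SG q" "x = F q k y"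
  using SG_F assms by blast

lemma V_SG: "V q m \<subseteq> SG q"
  unfolding SG_eq Vstar_def using closure_subset by fastforce

lemma vertex_SG: "q i \<in> SG q"
  using V_SG[of 0] by auto

lemma bary_SG: assumes "x \<in> SG q" shows "bary i x \<ge> 0"
proof -
  have "V q m \<subseteq> {x. bary i x \<ge> 0}" for m
    by (induction m) (auto simp: bary_vertex bary_F)
  then have "closure Vstar \<subseteq> {x. bary i x \<ge> 0}"
    unfolding Vstar_def by (intro closure_minimal closed_Collect_le continuous_on_bary continuous_on_const) auto
  then show ?thesis using assms unfolding SG_eq by blast
qed

lemma bary_SG_le: assumes "x \<in> SG q" shows "bary i x \<le> 1"
  using bary_sum[of i x] bary_SG[OF assms, of "i + 1"] bary_SG[OF assms, of "i - 1"] by linarith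

lemma SG_bary_rep: assumes "x \<in> SG q" shows "x = (\<Sum>i\<in>UNIV. bary i x *\<^sub>R q i)"
proof -
  let ?r = "\<lambda>x. \<Sum>i\<in>UNIV. bary i x *\<^sub>R q i"
  have "V q m \<subseteq> {x. x = ?r x}" for m
  proof (induction m)
    case 0
    have "\<forall>j. q j = ?r (q j)" unfolding forall_3 by (simp add: sum_3 bary_vertex)
    then show ?case by auto
  next
    case (Suc m)
    have "F q k x = ?r (F q k x)" if "x = ?r x" for k x
    proof -
      have "?r (F q k x) = (1/2) *\<^sub>R ?r x + (1/2) *\<^sub>R (\<Sum>i\<in>UNIV. if i = k then q i else 0)"
        unfolding scaleR_sum_right sum.distrib[symmetric] bary_F
        by (intro sum.cong) (auto simp: scaleR_left_distrib add_divide_distrib)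
      then show ?thesis using that unfolding F_def by (simp add: scaleR_add_right)
    qed
    then show ?case using Suc by auto
  qed
  then have "closure Vstar \<subseteq> {x. x = ?r x}"
    unfolding Vstar_def by (intro closure_minimal closed_Collect_eq continuous_intros continuous_on_bary) auto
  then show ?thesis using assms unfolding SG_eq by blast
qed

lemma SG_bary_eqI:
  assumes "x \<in> SG q" "y \<in> SG q" "\<And>i. bary i x = bary i y"
  shows "x = y"
proof -
  have "x = (\<Sum>i\<in>UNIV. bary i x *\<^sub>R q i)" by (rule SG_bary_rep[OF assms(1)])
  also have "\<dots> = (\<Sum>i\<in>UNIV. bary i y *\<^sub>R q i)" by (simp only: assms(3))
  also have "\<dots> = y" by (rule SG_bary_rep[OF assms(2), symmetric])
  finally show ?thesis .
qed

lemma SG_eq_vertexI: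
  assumes "x \<in> SG q" "bary i x \<ge> 1"
  shows "x = q i"
proof (rule SG_bary_eqI[OF assms(1) vertex_SG])
  fix j
  have "bary i x = 1" "bary (i+1) x = 0" "bary (i-1) x = 0"
    using bary_sum[of i x] bary_SG[OF assms(1), of "i + 1"] bary_SG[OF assms(1), of "i - 1"] assms(2) by linarith+
  moreover have "j = i \<or> j = i + 1 \<or> j = i - 1" using succ_pred_index(10)[of i] by blast
  ultimately show "bary j x = bary j (q i)" using succ_pred_index[of i] by (auto simp: bary_vertex)
qed

lemma junction:
  assumes "x \<in> SG q" "y \<in> SG q" "F q i x = F q j y" "i \<noteq> j"
  shows "x = q j" "y = q i"
proof -
  have "bary i (F q i x) = bary i (F q j y)" "bary j (F q i x) = bary j (F q j y)" using assms by simp_all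
  then have "bary i y = bary i x + 1" "bary j x = bary j y + 1" using assms(4) by (simp_all add: bary_F)
  then show "x = q j" "y = q i"
    using SG_eq_vertexI[OF assms(1), of j] SG_eq_vertexI[OF assms(2), of i] bary_SG[OF assms(1), of i] bary_SG[OF assms(2), of j]
    by auto
qed

lemma F_eq_vertex:
  assumes "x \<in> SG q" "F q i x = q j"
  shows "i = j" "x = q j"
proof -
  have "bary j (F q i x) = 1" using assms by (simp add: bary_vertex)
  then show "i = j" using bary_SG_le[OF assms(1), of j] by (auto simp: bary_F split: if_splits)
  then show "x = q j" using assms F_fix F_inj by metis
qed

lemma F_V_iff: assumes "x \<in> SG q" shows "F q k x \<in> V q (Suc m) \<longleftrightarrow> x \<in> V q m"
proof
  assume "F q k x \<in> V q (Suc m)"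
  then obtain j y where y: "y \<in> V q m" "F q k x = F q j y" by auto
  show "x \<in> V q m"
  proof (cases "j = k")
    case True then show ?thesis using y F_inj by auto
  next
    case False
    then show ?thesis using junction(1)[OF assms _ y(2)] V_SG y(1) vertex_in_V by blast
  qed
qed auto

lemma F_word_SG: "x \<in> SG q \<Longrightarrow> F_word q w x \<in> SG q"
  by (induction w) (auto simp: F_SG)

lemma neighbours_0: "neighbours q 0 (q j) = {q (j + 1), q (j - 1)}"
proof -
  have "neighbours q 0 (q j) = q ` UNIV - {q j}"
    unfolding neighbours_def using vertex_SG by auto
  also have "\<dots> = {q (j + 1), q (j - 1)}"
  proof -
    have "q (j + 1) \<noteq> q j" "q (j - 1) \<noteq> q j" using succ_pred_index(1,2)[of j] inj_q by blast+
    then show ?thesis unfolding succ_pred_index(10)[of j] image_insert image_empty by (simp add: insert_Diff_if)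
  qed
  finally show ?thesis .
qed

lemma neighbours_subset: "neighbours q m x \<subseteq> V q m"
  unfolding neighbours_def by auto

lemma finite_neighbours: "finite (neighbours q m x)"
  by (rule finite_subset[OF neighbours_subset finite_V])

lemma neighbours_Suc:
  "neighbours q (Suc m) y = (\<Union>k. \<Union>x\<in>{x\<in>SG q. F q k x = y}. F q k ` neighbours q m x)"
proof (intro set_eqI iffI)
  fix z assume "z \<in> neighbours q (Suc m) y"
  then obtain w where w: "y \<in> V q (Suc m)" "z \<in> V q (Suc m)" "y \<noteq> z" "length w = Suc m"
    "y \<in> F_word q w ` SG q" "z \<in> F_word q w ` SG q"
    unfolding neighbours_def by blast
  obtain k w' where k: "w = k # w'" "length w' = m" using w(4) by (cases w) auto
  obtain y' z' where yz: "y' \<in> F_word q w' ` SG q" "y = F q k y'" "z' \<in> F_word q w' ` SG q" "z = F q k z'"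
    using w(5,6) unfolding k by auto
  have "y' \<in> SG q" "z' \<in> SG q" using yz F_word_SG by auto
  moreover from this have "y' \<in> V q m" "z' \<in> V q m" using w yz F_V_iff by auto
  moreover have "y' \<noteq> z'" using w yz by auto
  ultimately have "z' \<in> neighbours q m y'" unfolding neighbours_def using yz k by blast
  then show "z \<in> (\<Union>k. \<Union>x\<in>{x\<in>SG q. F q k x = y}. F q k ` neighbours q m x)"
    using yz \<open>y' \<in> SG q\<close> by blast
next
  fix z assume "z \<in> (\<Union>k. \<Union>x\<in>{x\<in>SG q. F q k x = y}. F q k ` neighbours q m x)"
  then obtain k x z' where z': "F q k x = y" "z = F q k z'" "z' \<in> neighbours q m x" by blast
  then obtain w where w: "x \<in> V q m" "z' \<in> V q m" "x \<noteq> z'" "length w = m" "x \<in> F_word q w ` SG q" "z' \<in> F_word q w ` SG q"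
    unfolding neighbours_def by blast
  have "y \<in> V q (Suc m)" "z \<in> V q (Suc m)" "y \<noteq> z" using w z' F_inj by auto
  moreover have "F_word q (k # w) ` SG q = F q k ` F_word q w ` SG q" by (simp add: image_comp)
  then have "y \<in> F_word q (k # w) ` SG q" "z \<in> F_word q (k # w) ` SG q"
    using imageI[OF w(5), of "F q k"] imageI[OF w(6), of "F q k"] z'(1,2) by simp_all
  ultimately show "z \<in> neighbours q (Suc m) y" unfolding neighbours_def using w(4)
    by (simp del: F_word.simps V.simps add: exI[of _ "k # w"])
qed

lemma neighbours_vertex: "neighbours q m (q j) = {(F q j ^^ m) (q (j + 1)), (F q j ^^ m) (q (j - 1))}"
proof (induction m)
  case 0 show ?case by (simp add: neighbours_0)
next
  case (Suc m)
  have *: "{x\<in>SG q. F q k x = q j} = (if k = j then {q j} else {})" for k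
    using F_eq_vertex F_fix vertex_SG by auto
  have "neighbours q (Suc m) (q j) = F q j ` neighbours q m (q j)"
    unfolding neighbours_Suc * by (auto split: if_splits)
  then show ?case unfolding Suc by simp
qed

lemma neighbours_interior:
  assumes "x \<in> SG q" "x \<notin> V q 0"
  shows "neighbours q (Suc m) (F q k x) = F q k ` neighbours q m x"
proof -
  have *: "{y\<in>SG q. F q j y = F q k x} = (if j = k then {x} else {})" for j
  proof (cases "j = k")
    case False
    then have "x = q j" if "y \<in> SG q" "F q j y = F q k x" for y
      using junction(1)[OF assms(1) that(1) that(2)[symmetric]] by auto
    then show ?thesis using assms(2) False by auto
  qed (use assms F_inj in auto)
  show ?thesis unfolding neighbours_Suc * by (auto split: if_splits)
qed

lemma neighbours_junction:
  assumes "i \<noteq> j"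
  shows "neighbours q (Suc m) (F q i (q j)) = F q i ` neighbours q m (q j) \<union> F q j ` neighbours q m (q i)"
    and "F q i ` neighbours q m (q j) \<inter> F q j ` neighbours q m (q i) = {}"
proof -
  have *: "{y\<in>SG q. F q k y = F q i (q j)} = (if k = i then {q j} else if k = j then {q i} else {})" for k
  proof -
    have "k = i \<or> k = j" if "y \<in> SG q" "F q k y = F q i (q j)" for y
    proof (rule ccontr)
      assume n: "\<not> (k = i \<or> k = j)"
      then have "q j = q k" using junction(2)[OF that(1) vertex_SG that(2)] by auto
      then show False using n inj_q by metis
    qed
    moreover have "{y\<in>SG q. F q i y = F q i (q j)} = {q j}" "{y\<in>SG q. F q j y = F q i (q j)} = {q i}"
      by (simp_all only: F_swap[of i j] F_inj, simp only: F_swap[of j i] F_inj) (use vertex_SG in auto)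
    ultimately show ?thesis using assms by auto
  qed
  show "neighbours q (Suc m) (F q i (q j)) = F q i ` neighbours q m (q j) \<union> F q j ` neighbours q m (q i)"
    unfolding neighbours_Suc * using assms by (auto split: if_splits)
  show "F q i ` neighbours q m (q j) \<inter> F q j ` neighbours q m (q i) = {}"
  proof (rule ccontr)
    assume "\<not> ?thesis"
    then obtain z z' where z: "z \<in> neighbours q m (q j)" "z' \<in> neighbours q m (q i)" "F q i z = F q j z'" by blast
    have "z \<in> SG q" "z' \<in> SG q" using z neighbours_subset V_SG by blast+
    then have "z = q j" using junction(1) z assms by blast
    then show False using z unfolding neighbours_def by blast
  qed
qed

lemma V_Suc_cases:
  assumes "x \<in> V q (Suc m) - V q 0"
  obtains (interior) k y where "y \<in> V q m - V q 0" "x = F q k y"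
  | (junction) i j where "i \<noteq> j" "x = F q i (q j)"
proof -
  obtain k y where y: "y \<in> V q m" "x = F q k y" using assms by auto
  show ?thesis
  proof (cases "y \<in> V q 0")
    case True
    then obtain j where "y = q j" by auto
    moreover have "k \<noteq> j" using assms y \<open>y = q j\<close> F_fix vertex_in_V by force
    ultimately show ?thesis using that(2) y by blast
  next
    case False then show ?thesis using that(1) y by blast
  qed
qed

lemma Vstar_dense: "SG q \<subseteq> closure (Vstar - V q 0)"
proof -
  have "q j \<in> closure (Vstar - V q 0)" for j
  proof -
    have "(F q j ^^ n) (F q j (q (j+1))) \<in> Vstar - V q 0" for n
    proof (induction n)
      case 0
      have "F q j (q (j+1)) \<in> Vstar" using F_Vstar vertex_in_V[of "j+1" 0] unfolding Vstar_def by blast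
      moreover have "F q j (q (j+1)) \<noteq> q i" for i
        using F_eq_vertex[OF vertex_SG] inj_q succ_pred_index(1) by metis
      ultimately show ?case by auto
    next
      case (Suc n)
      then have "(F q j ^^ n) (F q j (q (j+1))) \<in> SG q" unfolding SG_eq using closure_subset by auto
      then have "F q j ((F q j ^^ n) (F q j (q (j+1)))) \<noteq> q i" for i
        using F_eq_vertex[of "(F q j ^^ n) (F q j (q (j+1)))" j i] Suc by auto
      then show ?case using Suc F_Vstar by auto
    qed
    then show ?thesis unfolding closure_sequential using F_funpow_tendsto[of j "F q j (q (j+1))"]
      by (intro exI[of _ "\<lambda>n. (F q j ^^ n) (F q j (q (j+1)))"] conjI allI)
  qed
  then have "V q 0 \<subseteq> closure (Vstar - V q 0)" by auto
  moreover have "Vstar - V q 0 \<subseteq> closure (Vstar - V q 0)" by (rule closure_subset)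
  ultimately have "Vstar \<subseteq> closure (Vstar - V q 0)" by blast
  then show ?thesis unfolding SG_eq by (rule closure_minimal) simp
qed

end

section \<open>The decimation function\<close>

definition dil :: "'a::comm_ring_1 \<Rightarrow> 'a fps \<Rightarrow> 'a fps" where
  "dil c f = Abs_fps (\<lambda>n. c ^ n * fps_nth f n)"

lemma dil_nth: "fps_nth (dil c f) n = c ^ n * fps_nth f n"
  unfolding dil_def by simp

lemma dil_add: "dil c (f + g) = dil c f + dil c g"
  and dil_diff: "dil c (f - g) = dil c f - dil c g"
  and dil_uminus: "dil c (- f) = - dil c f"
  and dil_dil: "dil c (dil b f) = dil (c * b) f"
  and dil_0: "dil c 0 = 0" and dil_1: "dil c 1 = 1" and dil_one: "dil 1 f = f"
  by (rule fps_ext; simp add: dil_nth algebra_simps power_mult_distrib)+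

lemma dil_mult: "dil c (f * g) = dil c f * dil c g"
proof (rule fps_ext)
  fix n
  have "c ^ n * (fps_nth f i * fps_nth g (n - i)) = c ^ i * fps_nth f i * (c ^ (n - i) * fps_nth g (n - i))"
    if "i \<le> n" for i
  proof -
    have "c ^ n = c ^ i * c ^ (n - i)" using that by (simp flip: power_add)
    then show ?thesis by (simp add: algebra_simps)
  qed
  then show "fps_nth (dil c (f * g)) n = fps_nth (dil c f * dil c g) n"
    by (simp add: dil_nth fps_mult_nth sum_distrib_left)
qed

lemma dil_of_nat: "dil c (of_nat n) = of_nat n"
  by (induction n) (simp_all add: dil_0 dil_1 dil_add)

lemma dil_numeral: "dil c (numeral n) = numeral n"
  using dil_of_nat[of c "numeral n"] by simp

lemma dil_const: "dil c (fps_const k) = fps_const k"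
  by (rule fps_ext) (simp add: dil_nth)

lemma dil_sum: "dil c (\<Sum>x\<in>A. f x) = (\<Sum>x\<in>A. dil c (f x))"
  by (induction A rule: infinite_finite_induct) (simp_all add: dil_0 dil_add)

lemmas dil_simps = dil_add dil_diff dil_uminus dil_mult dil_numeral dil_const dil_1 dil_0 dil_sum

lemma eval_dil: "eval_fps (dil c f) z = eval_fps f (c * z)"
  unfolding eval_fps_def dil_nth by (simp add: power_mult_distrib mult_ac)

abbreviation entire_fps :: "'a::{banach, real_normed_div_algebra} fps \<Rightarrow> bool" where
  "entire_fps f \<equiv> fps_conv_radius f = \<infinity>"

lemma entire_add: "entire_fps f \<Longrightarrow> entire_fps g \<Longrightarrow> entire_fps (f + g)"
  using fps_conv_radius_add[of f g] by (simp add: top_ereal_def[symmetric] top_unique)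

lemma entire_diff: "entire_fps f \<Longrightarrow> entire_fps g \<Longrightarrow> entire_fps (f - g)"
  using fps_conv_radius_diff[of f g] by (simp add: top_ereal_def[symmetric] top_unique)

lemma entire_mult:
  fixes f :: "'a::{banach, real_normed_field} fps"
  shows "entire_fps f \<Longrightarrow> entire_fps g \<Longrightarrow> entire_fps (f * g)"
  using fps_conv_radius_mult[of f g] by (simp add: top_ereal_def[symmetric] top_unique)

lemma entire_dil:
  fixes f :: "'a::{banach, real_normed_field} fps"
  assumes "entire_fps f" shows "entire_fps (dil c f)"
  unfolding fps_conv_radius_def
proof (rule conv_radius_inftyI'')
  fix z
  have "summable (\<lambda>n. fps_nth f n * (c * z) ^ n)" by (rule summable_fps) (simp add: assms)
  then show "summable (\<lambda>n. fps_nth (dil c f) n * z ^ n)" by (simp add: dil_nth power_mult_distrib mult_ac)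
qed

lemma radius_dil_fifth:
  fixes f :: "'a::{banach, real_normed_field} fps"
  assumes "ereal r \<le> fps_conv_radius f"
  shows "ereal (5 * r) \<le> fps_conv_radius (dil (1/5) f)"
  unfolding fps_conv_radius_def
proof (rule conv_radius_geI_ex')
  fix r' :: real assume r': "0 < r'" "ereal r' < ereal (5 * r)"
  have "ereal (norm (of_real (r' / 5) :: 'a)) < ereal r" using r' by (simp add: norm_divide)
  also note assms
  finally have "summable (\<lambda>n. fps_nth f n * (of_real (r' / 5) :: 'a) ^ n)" by (rule summable_fps)
  then show "summable (\<lambda>n. fps_nth (dil (1/5) f) n * (of_real r' :: 'a) ^ n)"
    by (simp add: dil_nth power_divide)
qed

lemma eval_entire:
  fixes f g :: "'a::{banach, real_normed_field} fps"
  assumes "entire_fps f" "entire_fps g"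
  shows "eval_fps (f + g) z = eval_fps f z + eval_fps g z"
    and "eval_fps (f - g) z = eval_fps f z - eval_fps g z"
    and "eval_fps (f * g) z = eval_fps f z * eval_fps g z"
  using assms by (simp_all add: eval_fps_add eval_fps_diff eval_fps_mult)

lemma entire_of_bound:
  fixes f :: "'a::{banach, real_normed_field} fps"
  assumes "\<And>n. norm (fps_nth f n) \<le> C * K ^ n / fact n"
  shows "entire_fps f"
  unfolding fps_conv_radius_def
proof (rule conv_radius_inftyI'')
  fix z :: 'a
  have "summable (\<lambda>n. C * ((K * norm z) ^ n /\<^sub>R fact n))"
    by (intro summable_mult summable_exp_generic)
  moreover have "norm (fps_nth f n * z ^ n) \<le> C * ((K * norm z) ^ n /\<^sub>R fact n)" for n
    using mult_right_mono[OF assms[of n], of "norm z ^ n"]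
    by (simp add: norm_mult norm_power power_mult_distrib field_simps)
  ultimately show "summable (\<lambda>n. fps_nth f n * z ^ n)"
    by (rule summable_comparison_test'[where N = 0])
qed

lemma sum_powr_le_powr_sum:
  fixes x :: "'i \<Rightarrow> real"
  assumes "finite A" "\<And>i. i \<in> A \<Longrightarrow> x i \<ge> 0" "p \<ge> 1"
  shows "(\<Sum>i\<in>A. x i powr p) \<le> (\<Sum>i\<in>A. x i) powr p"
proof -
  let ?X = "\<Sum>i\<in>A. x i"
  have X: "?X \<ge> 0" using assms by (simp add: sum_nonneg)
  have "x i powr p \<le> x i * ?X powr (p - 1)" if "i \<in> A" for i
  proof (cases "x i = 0")
    case False
    then have pos: "x i > 0" using assms(2)[OF that] by simp
    have "x i powr p = x i * x i powr (p - 1)" using pos by (simp add: powr_diff)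
    also have "\<dots> \<le> x i * ?X powr (p - 1)"
      using pos assms that by (intro mult_left_mono powr_mono2 member_le_sum) auto
    finally show ?thesis .
  qed (use assms in auto)
  then have "(\<Sum>i\<in>A. x i powr p) \<le> ?X * ?X powr (p - 1)"
    by (simp add: sum_mono sum_distrib_right)
  also have "\<dots> = ?X powr p" using X by (cases "?X = 0") (simp_all add: powr_diff)
  finally show ?thesis .
qed

definition recfact :: "nat \<Rightarrow> real" where "recfact n = fact n powr (- log 2 5)"

lemma recfact_pos: "recfact n > 0" unfolding recfact_def by simp

lemma recfact_0: "recfact 0 = 1" and recfact_1: "recfact (Suc 0) = 1" unfolding recfact_def by simp_all

lemma log25: "log 2 (5::real) \<ge> 1" by simp

lemma recfact_le: "recfact n \<le> 1 / fact n"
proof -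
  have "recfact n \<le> fact n powr (-1)" unfolding recfact_def by (intro powr_mono) (use log25 in auto)
  then show ?thesis by (simp add: powr_minus_divide)
qed

lemma recfact_le_1: "recfact n \<le> 1"
  using recfact_le[of n] by (rule order_trans) (simp add: fact_ge_1)

lemma recfact_decr: "recfact (Suc n) \<le> recfact n"
  unfolding recfact_def by (intro powr_mono2') (use log25 fact_mono[of n "Suc n", where ?'a = real] in auto)

lemma recfact_binomial:
  assumes "i \<le> n"
  shows "recfact i * recfact (n - i) = recfact n * real (n choose i) powr log 2 5"
proof -
  have "real (n choose i) * (fact i * fact (n - i)) = fact n"
    using binomial_fact_lemma[OF assms] by (metis mult.commute of_nat_fact of_nat_mult)
  then have "fact n powr log 2 5 = real (n choose i) powr log 2 5 * (fact i powr log 2 5 * fact (n - i) powr log 2 5)"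
    by (metis (no_types, lifting) fact_ge_zero mult_nonneg_nonneg of_nat_0_le_iff powr_mult)
  then show ?thesis unfolding recfact_def using assms by (simp add: powr_minus field_simps)
qed

text \<open>This is where the exponent \<open>log 2 5\<close> enters: the binomial coefficients of order \<open>n\<close> add up
  to \<open>2 ^ n\<close>.\<close>

lemma recfact_conv: "(\<Sum>i\<le>n. recfact i * recfact (n - i)) \<le> 5 ^ n * recfact n"
proof -
  have "(\<Sum>i\<le>n. recfact i * recfact (n - i)) = recfact n * (\<Sum>i\<le>n. real (n choose i) powr log 2 5)"
    by (simp add: recfact_binomial sum_distrib_left)
  also have "\<dots> \<le> recfact n * (\<Sum>i\<le>n. real (n choose i)) powr log 2 5"
    using recfact_pos[of n] log25 by (intro mult_left_mono sum_powr_le_powr_sum) auto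
  also have "(\<Sum>i\<le>n. real (n choose i)) = 2 ^ n"
    by (metis choose_row_sum of_nat_numeral of_nat_power of_nat_sum)
  also have "((2::real) ^ n) powr log 2 5 = 5 ^ n"
  proof -
    have "((2::real) ^ n) powr log 2 5 = (2 powr real n) powr log 2 5" by (simp add: powr_realpow)
    also have "\<dots> = (2 powr log 2 5) powr real n" unfolding powr_powr by (simp only: mult.commute)
    also have "\<dots> = 5 ^ n" by (simp add: powr_realpow)
    finally show ?thesis .
  qed
  finally show ?thesis by (simp add: mult.commute)
qed

fun dcoef :: "nat \<Rightarrow> real" where
  "dcoef n = (if n = 0 then 0 else if n = 1 then 2/3
     else (\<Sum>l\<in>{1..<n}. dcoef l * dcoef (n - l)) / (5 ^ n - 5))"

declare dcoef.simps [simp del]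

lemma dcoef_0: "dcoef 0 = 0" and dcoef_1: "dcoef (Suc 0) = 2/3" "dcoef 1 = 2/3"
  by (simp_all add: dcoef.simps[of 0] dcoef.simps[of "Suc 0"])

lemma five_power: "n \<ge> 2 \<Longrightarrow> (5::real) ^ n \<ge> 25"
  using power_increasing[of 2 n "5::real"] by simp

lemma dcoef_bound: "0 \<le> dcoef n \<and> dcoef n \<le> 2/3 * recfact n"
proof (induction n rule: less_induct)
  case (less n)
  show ?case
  proof (cases "n \<le> 1")
    case True
    then show ?thesis using recfact_pos[of 0] by (cases n) (auto simp: dcoef_0 dcoef_1 recfact_1)
  next
    case False
    then have p5: "(5::real) ^ n \<ge> 25" using five_power by simp
    have eq: "dcoef n = (\<Sum>l\<in>{1..<n}. dcoef l * dcoef (n - l)) / (5 ^ n - 5)"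
      using False by (simp add: dcoef.simps[of n])
    have "(\<Sum>l\<in>{1..<n}. dcoef l * dcoef (n - l)) \<le> (\<Sum>l\<in>{1..<n}. (2/3 * recfact l) * (2/3 * recfact (n - l)))"
      using less by (intro sum_mono mult_mono) (auto intro!: mult_nonneg_nonneg less_imp_le[OF recfact_pos])
    also have "\<dots> = 4/9 * (\<Sum>l\<in>{1..<n}. recfact l * recfact (n - l))"
      by (simp add: sum_distrib_left mult_ac)
    also have "\<dots> \<le> 4/9 * (\<Sum>l\<le>n. recfact l * recfact (n - l))"
      by (intro mult_left_mono sum_mono2) (auto intro!: mult_nonneg_nonneg less_imp_le[OF recfact_pos])
    also have "\<dots> \<le> 4/9 * (5 ^ n * recfact n)" using recfact_conv[of n] by simp
    also have "\<dots> \<le> 2/3 * recfact n * (5 ^ n - 5)"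
    proof -
      have "4/9 * (5::real) ^ n \<le> 2/3 * (5 ^ n - 5)" using p5 by simp
      then have "4/9 * (5::real) ^ n * recfact n \<le> 2/3 * (5 ^ n - 5) * recfact n"
        using recfact_pos[of n] by (intro mult_right_mono) auto
      then show ?thesis by (simp add: mult_ac)
    qed
    finally have "dcoef n \<le> 2/3 * recfact n" unfolding eq using p5 by (simp add: divide_le_eq)
    moreover have "dcoef n \<ge> 0" unfolding eq
      using less p5 by (intro divide_nonneg_nonneg sum_nonneg mult_nonneg_nonneg) auto
    ultimately show ?thesis by simp
  qed
qed

definition dec :: "'a::{banach, real_normed_field} fps" where
  "dec = Abs_fps (\<lambda>n. of_real (dcoef n))"

lemma dec_nth: "fps_nth dec n = of_real (dcoef n)"
  unfolding dec_def by simp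

lemma entire_dec: "entire_fps dec"
proof (rule entire_of_bound)
  fix n
  have "dcoef n \<le> 2/3 * (1 / fact n)" using dcoef_bound[of n] recfact_le[of n] by linarith
  then show "norm (fps_nth (dec :: 'a fps) n) \<le> 2/3 * 1 ^ n / fact n"
    using dcoef_bound[of n] by (simp add: dec_nth)
qed

text \<open>Spectral decimation: this relates the discrete eigenvalues on consecutive levels.\<close>

lemma dec_eq: "dec = dil (1/5) dec * (5 + dil (1/5) dec)"
proof -
  have "dil 5 dec = dec * (5 + dec :: 'a fps)"
  proof (rule fps_ext)
    fix n
    show "fps_nth (dil 5 dec) n = fps_nth (dec * (5 + dec :: 'a fps)) n"
    proof (cases "n \<le> 1")
      case True
      then consider "n = 0" | "n = 1" by linarith
      then show ?thesis by cases (simp_all add: dil_nth dec_nth distrib_left fps_mult_nth dcoef_0 dcoef_1 mult.commute[of _ 5] numeral_fps_const)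
    next
      case False
      have "(\<Sum>i=0..n. dcoef i * dcoef (n - i)) = (\<Sum>i=1..<n. dcoef i * dcoef (n - i))"
      proof (rule sum.mono_neutral_right)
        show "\<forall>i\<in>{0..n} - {1..<n}. dcoef i * dcoef (n - i) = 0"
        proof
          fix i assume "i \<in> {0..n} - {1..<n}"
          then have "i = 0 \<or> i = n" by auto
          then show "dcoef i * dcoef (n - i) = 0" by (auto simp: dcoef_0)
        qed
      qed auto
      also have "\<dots> = dcoef n * (5 ^ n - 5)"
        using False five_power[of n] by (simp add: dcoef.simps[of n])
      finally have "5 * dcoef n + (\<Sum>i=0..n. dcoef i * dcoef (n - i)) = 5 ^ n * dcoef n"
        by (simp add: algebra_simps)
      then have "of_real (5 ^ n * dcoef n) = (of_real (5 * dcoef n + (\<Sum>i=0..n. dcoef i * dcoef (n - i))) :: 'a)"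
        by simp
      then show ?thesis
        by (simp add: dil_nth dec_nth distrib_left fps_mult_nth[of dec dec] mult.commute[of dec 5] numeral_fps_const)
    qed
  qed
  then have "dil (1/5) (dil 5 dec) = dil (1/5) (dec * (5 + dec :: 'a fps))" by simp
  then show ?thesis by (simp add: dil_dil dil_one dil_simps)
qed

abbreviation decf :: "'a::{banach, real_normed_field} \<Rightarrow> 'a" where
  "decf \<equiv> eval_fps dec"

lemma decf_eq: "decf z = decf (z/5) * (5 + decf (z/5))"
proof -
  have e: "entire_fps (dil (1/5) dec :: 'a fps)" by (intro entire_dil entire_dec)
  have "decf z = eval_fps (dil (1/5) dec * (5 + dil (1/5) dec)) z" using dec_eq by metis
  also have "\<dots> = decf (z/5) * (5 + decf (z/5))"
    by (simp add: eval_entire e entire_add eval_dil)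
  finally show ?thesis .
qed

lemma decf_of_real: "decf (of_real x :: 'a) = (of_real (decf x) :: 'a::{banach, real_normed_field})"
proof -
  have "(\<lambda>n. fps_nth dec n * x ^ n) sums decf x" by (rule sums_eval_fps) (simp add: entire_dec)
  then have "(\<lambda>n. of_real (fps_nth dec n * x ^ n) :: 'a) sums of_real (decf x)" by (rule sums_of_real)
  moreover have "(\<lambda>n. fps_nth dec n * (of_real x :: 'a) ^ n) sums decf (of_real x)"
    by (rule sums_eval_fps) (simp add: entire_dec)
  ultimately show ?thesis by (simp add: dec_nth sums_unique2)
qed

lemma decf_cnj: "decf (cnj z) = cnj (decf z)"
proof -
  have "(\<lambda>n. fps_nth dec n * z ^ n) sums decf z" by (rule sums_eval_fps) (simp add: entire_dec)
  then have "(\<lambda>n. cnj (fps_nth dec n * z ^ n)) sums cnj (decf z)" by (simp only: sums_cnj)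
  moreover have "(\<lambda>n. fps_nth dec n * (cnj z) ^ n) sums decf (cnj z)"
    by (rule sums_eval_fps) (simp add: entire_dec)
  ultimately show ?thesis by (simp add: dec_nth sums_unique2)
qed

lemma decf_0: "decf 0 = 0"
  by (simp add: eval_fps_at_0 dec_nth dcoef_0)

lemma decf_pos: "x > 0 \<Longrightarrow> decf (x::real) > 0"
proof -
  assume x: "x > 0"
  have "summable (\<lambda>n. fps_nth dec n * x ^ n)" by (rule summable_fps) (simp add: entire_dec)
  moreover have "fps_nth dec n * x ^ n \<ge> 0" for n
    using x dcoef_bound[of n] by (simp add: dec_nth)
  moreover have "fps_nth dec 1 * x ^ 1 > 0" using x by (simp add: dec_nth dcoef_1)
  ultimately have "(\<Sum>n. fps_nth dec n * x ^ n) > 0" by (rule suminf_pos2)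
  then show ?thesis by (simp add: eval_fps_def)
qed

lemma decf_deriv: "(decf has_field_derivative eval_fps (fps_deriv dec) x) (at x within A)"
  by (rule has_field_derivative_eval_fps) (simp add: entire_dec)

lemma continuous_on_decf: "continuous_on A (decf :: 'a::{banach, real_normed_field} \<Rightarrow> 'a)"
  using decf_deriv by (meson DERIV_continuous continuous_on_eq_continuous_within)

lemma decf_quotient: "((\<lambda>x. decf x / x) \<longlongrightarrow> (2/3 :: 'a::{banach, real_normed_field})) (at 0)"
proof -
  have "(decf has_field_derivative (2/3 :: 'a)) (at 0)"
    using decf_deriv[of 0 UNIV] by (simp add: eval_fps_at_0 dec_nth dcoef_1)
  then show ?thesis by (simp add: has_field_derivative_iff decf_0)
qed

lemma decf_scaled_tendsto: "(\<lambda>m. 5 ^ m * decf (t / 5 ^ m)) \<longlonglongrightarrow> 2/3 * (t::real)"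
proof (cases "t = 0")
  case False
  have "(\<lambda>m. t / 5 ^ m) \<longlonglongrightarrow> 0" by real_asymp
  then have "filterlim (\<lambda>m. t / 5 ^ m) (at 0) sequentially"
    using False by (simp add: filterlim_at)
  then have "(\<lambda>m. decf (t / 5 ^ m) / (t / 5 ^ m)) \<longlonglongrightarrow> 2/3"
    by (rule filterlim_compose[OF decf_quotient])
  then have "(\<lambda>m. decf (t / 5 ^ m) / (t / 5 ^ m) * t) \<longlonglongrightarrow> 2/3 * t" by (rule tendsto_mult_right)
  then show ?thesis using False by (simp add: field_simps)
qed (simp add: decf_0)

lemma decf_tendsto_0: "(\<lambda>m. decf (t / 5 ^ m)) \<longlonglongrightarrow> (0::real)"
proof -
  have "(\<lambda>m. 5 ^ m * decf (t / 5 ^ m) * (1 / 5 ^ m)) \<longlonglongrightarrow> 2/3 * t * 0"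
    by (intro tendsto_mult decf_scaled_tendsto) real_asymp
  then show ?thesis by simp
qed

lemma decf_locally_inj:
  obtains r where "r > 0" "inj_on (decf :: complex \<Rightarrow> complex) (ball 0 r)"
proof -
  have h: "decf holomorphic_on (UNIV :: complex set)"
    using decf_deriv by (simp add: holomorphic_on_open) blast
  have "deriv decf (0::complex) = 2/3"
    using decf_deriv[of 0 UNIV] by (intro DERIV_imp_deriv) (simp add: eval_fps_at_0 dec_nth dcoef_1)
  then have "deriv decf (0::complex) \<noteq> 0" by (auto dest: sym)
  then show ?thesis using has_complex_derivative_locally_injective[OF h UNIV_I open_UNIV] that by blast
qed

lemma eventually_small: "r > 0 \<Longrightarrow> \<exists>M. \<forall>m\<ge>M. \<bar>x\<bar> / 5 ^ m < (r::real)"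
proof -
  assume "r > 0"
  have "(\<lambda>m. \<bar>x\<bar> / 5 ^ m) \<longlonglongrightarrow> 0" by real_asymp
  then have "\<forall>\<^sub>F m in sequentially. \<bar>x\<bar> / 5 ^ m < r" using \<open>r > 0\<close> by (rule order_tendstoD(2))
  then show ?thesis by (simp add: eventually_sequentially)
qed

lemma decf_eq_minus_3_real:
  assumes z: "decf (z::complex) = - 3"
  obtains x :: real where "x > 0" "z = of_real (- x)" "decf (- x) = - 3"
proof -
  have *: "\<exists>y\<in>{0..5}. decf (z / 5 ^ m) = of_real (- y)" for m
  proof (induction m)
    case 0
    then show ?case using z by (intro bexI[of _ 3]) auto
  next
    case (Suc m)
    then obtain y where y: "0 \<le> y" "y \<le> 5" "decf (z / 5 ^ m) = of_real (- y)" by auto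
    define w where "w = decf (z / 5 ^ Suc m)"
    define r where "r = sqrt (25/4 - y)"
    have r2: "r * r = 25/4 - y" "0 \<le> r" unfolding r_def using y by simp_all
    have "r * r \<le> (5/2) * (5/2)" using r2 y by simp
    then have r: "r \<le> 5/2" by (rule power2_le_imp_le[unfolded power2_eq_square]) simp
    have "w * (5 + w) = of_real (- y)"
      using decf_eq[of "z / 5 ^ m"] y(3) unfolding w_def by (simp add: mult.commute)
    moreover have "(w + 5/2) * (w + 5/2) = w * (5 + w) + 25/4" by (simp add: field_simps)
    ultimately have "(w + 5/2) * (w + 5/2) = of_real (r * r)" unfolding r2 by simp
    then have "w + 5/2 = of_real r \<or> w + 5/2 = - of_real r" by (simp add: square_eq_iff)
    moreover have "w = (w + 5/2) - 5/2" by simp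
    ultimately have "w = of_real r - 5/2 \<or> w = - of_real r - 5/2" by metis
    moreover have "complex_of_real (- (5/2 - r)) = of_real r - 5/2" "complex_of_real (- (5/2 + r)) = - of_real r - 5/2"
      by simp_all
    ultimately have "w = of_real (- (5/2 - r)) \<or> w = of_real (- (5/2 + r))" by argo
    moreover have "5/2 - r \<in> {0..5}" "5/2 + r \<in> {0..5}" using r r2 by auto
    ultimately show ?case unfolding w_def by blast
  qed
  obtain \<rho> where \<rho>: "\<rho> > 0" "inj_on (decf :: complex \<Rightarrow> complex) (ball 0 \<rho>)" by (rule decf_locally_inj)
  obtain m where m: "norm z / 5 ^ m < \<rho>" using eventually_small[OF \<rho>(1), of "norm z"] by auto
  obtain y where y: "decf (z / 5 ^ m) = of_real (- y)" using * by blast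
  have "decf (cnj (z / 5 ^ m)) = decf (z / 5 ^ m)" unfolding decf_cnj y by simp
  moreover have "cnj (z / 5 ^ m) \<in> ball 0 \<rho>" "z / 5 ^ m \<in> ball 0 \<rho>"
    using m by (simp_all add: norm_divide norm_power)
  ultimately have "cnj (z / 5 ^ m) = z / 5 ^ m" using \<rho>(2) by (blast dest: inj_onD)
  then have "cnj z = z" by simp
  then have zr: "z = of_real (Re z)" by (simp add: complex_eq_iff)
  then have d: "decf (Re z) = - 3" using z decf_of_real[of "Re z", where ?'a = complex]
    by (metis of_real_eq_iff of_real_minus of_real_numeral)
  then have "\<not> Re z > 0" "Re z \<noteq> 0" using decf_pos[of "Re z"] decf_0[where ?'a = real] by auto
  then have "Re z < 0" by linarith
  then show ?thesis using that[of "- Re z"] zr d by simp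
qed

text \<open>\<open>5 * decroot\<close> is the first nonzero Neumann eigenvalue.\<close>

definition decroot :: real where "decroot = Inf {x. x > 0 \<and> decf (- x) = - 3}"

lemma decf_neg_exists: "\<exists>x>0. decf (- x :: real) = - 3"
proof -
  define \<Phi> where "\<Phi> x = - decf (- x)" for x :: real
  have feq: "\<Phi> (5 * x) = \<Phi> x * (5 - \<Phi> x)" for x
    unfolding \<Phi>_def using decf_eq[of "- (5 * x)"] by simp
  have "\<forall>\<^sub>F x in at (0::real). decf x / x > 0" using decf_quotient[where ?'a = real] by (rule order_tendstoD(1)) simp
  then obtain d where d: "d > 0" "\<And>x. x \<noteq> 0 \<Longrightarrow> \<bar>x\<bar> < d \<Longrightarrow> decf x / x > (0::real)"
    unfolding eventually_at by (auto simp: dist_real_def)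
  define x0 where "x0 = d / 2"
  have x0: "x0 > 0" using d(1) unfolding x0_def by simp
  moreover have "decf (- x0) / (- x0) > 0" using d(1) by (intro d(2)) (auto simp: x0_def)
  ultimately have x0': "\<Phi> x0 > 0" unfolding \<Phi>_def by (simp add: zero_less_divide_iff divide_less_0_iff)
  have "\<exists>k. \<Phi> (5 ^ k * x0) \<ge> 3"
  proof (rule ccontr)
    assume "\<not> ?thesis"
    then have lt: "\<Phi> (5 ^ k * x0) < 3" for k by (meson not_less)
    have gr: "\<Phi> (5 ^ k * x0) \<ge> 2 ^ k * \<Phi> x0" for k
    proof (induction k)
      case (Suc k)
      have "0 < 2 ^ k * \<Phi> x0" using x0' by simp
      then have "\<Phi> (5 ^ k * x0) > 0" using Suc by linarith
      then have "\<Phi> (5 ^ k * x0) * 2 \<le> \<Phi> (5 ^ k * x0) * (5 - \<Phi> (5 ^ k * x0))"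
        using lt[of k] by (intro mult_left_mono) auto
      then have "\<Phi> (5 ^ Suc k * x0) \<ge> 2 * \<Phi> (5 ^ k * x0)" using feq[of "5 ^ k * x0"] by (simp add: mult.assoc)
      then show ?case using Suc by simp
    qed simp
    obtain k where "3 / \<Phi> x0 < 2 ^ k" using real_arch_pow[of 2] by auto
    then have "3 < 2 ^ k * \<Phi> x0" using x0' by (simp add: field_simps)
    then show False using gr[of k] lt[of k] by linarith
  qed
  then obtain k where k: "\<Phi> (5 ^ k * x0) \<ge> 3" by blast
  have cont: "continuous_on {0..5 ^ k * x0} \<Phi>"
    unfolding \<Phi>_def by (intro continuous_intros continuous_on_compose2[OF continuous_on_decf[of UNIV]]) auto
  have "\<exists>x\<ge>0. x \<le> 5 ^ k * x0 \<and> \<Phi> x = 3"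
    by (rule IVT'[OF _ k _ cont]) (use x0 in \<open>auto simp: \<Phi>_def decf_0\<close>)
  then obtain x where x: "x \<ge> 0" "\<Phi> x = 3" by blast
  then have "x \<noteq> 0" by (auto simp: \<Phi>_def decf_0)
  then show ?thesis using x unfolding \<Phi>_def by (intro exI[of _ x]) auto
qed

lemma decroot: "decroot > 0" "decf (- decroot) = - 3"
  and decroot_least: "x > 0 \<Longrightarrow> decf (- x) = - 3 \<Longrightarrow> decroot \<le> x"
proof -
  let ?S = "{x. x > 0 \<and> decf (- x :: real) = - 3}"
  let ?S' = "{x. x \<ge> 0 \<and> decf (- x :: real) = - 3}"
  have eq: "?S = ?S'" by (auto simp: decf_0 less_le)
  have "closed ?S'"
    by (intro closed_Collect_conj closed_Collect_le closed_Collect_eq continuous_intros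
        continuous_on_compose2[OF continuous_on_decf[of UNIV]]) auto
  moreover have "?S' \<noteq> {}" using decf_neg_exists by (auto intro: less_imp_le)
  moreover have bdd: "bdd_below ?S'" by (intro bdd_belowI[of _ 0]) auto
  ultimately have "Inf ?S' \<in> ?S'" by (intro closed_contains_Inf)
  then have "decroot \<in> ?S" unfolding decroot_def eq .
  then show "decroot > 0" "decf (- decroot) = - 3" by auto
  show "x > 0 \<Longrightarrow> decf (- x) = - 3 \<Longrightarrow> decroot \<le> x"
    unfolding decroot_def eq using bdd by (intro cInf_lower) auto
qed

lemma decf_preimage_finite: "finite {t. \<bar>t\<bar> \<le> X \<and> decf (t / 5 ^ m) = (c::real)}"
proof -
  obtain \<rho> where \<rho>: "\<rho> > 0" "inj_on (decf :: complex \<Rightarrow> complex) (ball 0 \<rho>)" by (rule decf_locally_inj)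
  obtain M where M: "\<And>m. m \<ge> M \<Longrightarrow> \<bar>X\<bar> / 5 ^ m < \<rho>" using eventually_small[OF \<rho>(1), of X] by auto
  have big: "finite {t. \<bar>t\<bar> \<le> X \<and> decf (t / 5 ^ m) = (c::real)}" if "m \<ge> M" for m c
  proof -
    have "t = t'" if t: "\<bar>t\<bar> \<le> X" "\<bar>t'\<bar> \<le> X" "decf (t / 5 ^ m) = decf (t' / 5 ^ m)" for t t'
    proof -
      have "\<bar>t\<bar> / 5 ^ m \<le> \<bar>X\<bar> / 5 ^ m" "\<bar>t'\<bar> / 5 ^ m \<le> \<bar>X\<bar> / 5 ^ m"
        using t by (auto intro!: divide_right_mono)
      then have "\<bar>t\<bar> / 5 ^ m < \<rho>" "\<bar>t'\<bar> / 5 ^ m < \<rho>" using M[OF \<open>m \<ge> M\<close>] by auto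
      then have "complex_of_real (t / 5 ^ m) \<in> ball 0 \<rho>" "complex_of_real (t' / 5 ^ m) \<in> ball 0 \<rho>"
        by (auto simp: norm_divide norm_power)
      moreover have "decf (complex_of_real (t / 5 ^ m)) = decf (complex_of_real (t' / 5 ^ m))"
        unfolding decf_of_real t(3) ..
      ultimately have "complex_of_real (t / 5 ^ m) = complex_of_real (t' / 5 ^ m)"
        using \<rho>(2) by (blast dest: inj_onD)
      then show ?thesis by (simp only: of_real_eq_iff) simp
    qed
    then have one: "t = t'" if "t \<in> {t. \<bar>t\<bar> \<le> X \<and> decf (t / 5 ^ m) = c}"
        "t' \<in> {t. \<bar>t\<bar> \<le> X \<and> decf (t / 5 ^ m) = c}" for t t' using that by simp
    show ?thesis
    proof (cases "{t. \<bar>t\<bar> \<le> X \<and> decf (t / 5 ^ m) = c} = {}")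
      case False
      then obtain t0 where t0: "t0 \<in> {t. \<bar>t\<bar> \<le> X \<and> decf (t / 5 ^ m) = c}" by blast
      have "{t. \<bar>t\<bar> \<le> X \<and> decf (t / 5 ^ m) = c} \<subseteq> {t0}" using one[OF _ t0] by blast
      then show ?thesis by (rule finite_subset) simp
    qed (simp only: finite.emptyI)
  qed
  have small: "finite {t. \<bar>t\<bar> \<le> X \<and> decf (t / 5 ^ m) = (c::real)}" if "m + k = M" for k m c
    using that
  proof (induction k arbitrary: m c)
    case 0 then show ?case using big by simp
  next
    case (Suc k)
    define r where "r = sqrt (25/4 + c)"
    have sub: "{t. \<bar>t\<bar> \<le> X \<and> decf (t / 5 ^ m) = c} \<subseteq>
      {t. \<bar>t\<bar> \<le> X \<and> decf (t / 5 ^ Suc m) = r - 5/2} \<union> {t. \<bar>t\<bar> \<le> X \<and> decf (t / 5 ^ Suc m) = - r - 5/2}"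
    proof
      fix t assume t: "t \<in> {t. \<bar>t\<bar> \<le> X \<and> decf (t / 5 ^ m) = c}"
      then have "decf (t / 5 ^ Suc m) * (5 + decf (t / 5 ^ Suc m)) = c"
        using decf_eq[of "t / 5 ^ m"] by (simp add: mult.commute)
      then have *: "(decf (t / 5 ^ Suc m) + 5/2)\<^sup>2 = 25/4 + c" by (simp add: power2_eq_square algebra_simps)
      then have "r = \<bar>decf (t / 5 ^ Suc m) + 5/2\<bar>" unfolding r_def by (metis real_sqrt_abs)
      then have "decf (t / 5 ^ Suc m) = r - 5/2 \<or> decf (t / 5 ^ Suc m) = - r - 5/2"
        by (cases "decf (t / 5 ^ Suc m) + 5/2 \<ge> 0") (simp_all add: abs_if)
      then show "t \<in> {t. \<bar>t\<bar> \<le> X \<and> decf (t / 5 ^ Suc m) = r - 5/2} \<union> {t. \<bar>t\<bar> \<le> X \<and> decf (t / 5 ^ Suc m) = - r - 5/2}"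
        using t by blast
    qed
    have "Suc m + k = M" using Suc.prems by simp
    then have "finite ({t. \<bar>t\<bar> \<le> X \<and> decf (t / 5 ^ Suc m) = r - 5/2} \<union> {t. \<bar>t\<bar> \<le> X \<and> decf (t / 5 ^ Suc m) = - r - 5/2})"
      by (intro finite_UnI Suc.IH)
    then show ?case by (rule finite_subset[OF sub])
  qed
  show ?thesis
  proof (cases "m \<ge> M")
    case False
    then show ?thesis by (intro small[of m "M - m"]) simp
  qed (rule big)
qed

text \<open>Coefficients of \<open>\<Prod>m\<ge>1. 1 / (1 + decf (t / 5 ^ m) / 3)\<close>.\<close>

fun invcoef :: "nat \<Rightarrow> real" where
  "invcoef n = (if n = 0 then 1
     else - (\<Sum>l\<in>{1..n}. dcoef l / 5 ^ l * invcoef (n - l)) / (3 * (1 - 1 / 5 ^ n)))"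

declare invcoef.simps [simp del]

lemma invcoef_0: "invcoef 0 = 1" by (simp add: invcoef.simps[of 0])

definition invprod :: "'a::{banach, real_normed_field} fps" where
  "invprod = Abs_fps (\<lambda>n. of_real (invcoef n))"

lemma invprod_nth: "fps_nth invprod n = of_real (invcoef n)"
  unfolding invprod_def by simp

lemma invprod_eq: "(3 + dil (1/5) dec) * invprod = 3 * dil (1/5) invprod"
proof (rule fps_ext)
  fix n
  have "3 * invcoef n + (\<Sum>l=0..n. dcoef l / 5 ^ l * invcoef (n - l)) = 3 * (1 / 5 ^ n * invcoef n)"
  proof (cases "n = 0")
    case False
    define k :: real where "k = 3 * (1 - 1 / 5 ^ n)"
    have "(1::real) < 5 ^ n" using False by simp
    then have k: "k \<noteq> 0" unfolding k_def by (auto simp: field_simps)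
    have "(\<Sum>l=0..n. dcoef l / 5 ^ l * invcoef (n - l)) = (\<Sum>l=1..n. dcoef l / 5 ^ l * invcoef (n - l))"
      by (simp add: sum.atLeast_Suc_atMost dcoef_0)
    also have "\<dots> = - invcoef n * k"
    proof -
      have "invcoef n = - (\<Sum>l=1..n. dcoef l / 5 ^ l * invcoef (n - l)) / k"
        unfolding k_def using False by (simp add: invcoef.simps[of n])
      then show ?thesis using k by simp
    qed
    finally show ?thesis unfolding k_def by (simp add: algebra_simps)
  qed (simp add: dcoef_0)
  then have *: "of_real (3 * invcoef n + (\<Sum>l=0..n. dcoef l / 5 ^ l * invcoef (n - l))) =
     (of_real (3 * (1 / 5 ^ n * invcoef n)) :: 'a)" by (simp only:)
  have "fps_nth ((3 + dil (1/5) dec) * invprod) n =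
      (of_real (3 * invcoef n + (\<Sum>l=0..n. dcoef l / 5 ^ l * invcoef (n - l))) :: 'a)"
    unfolding distrib_right fps_add_nth numeral_fps_const fps_mult_left_const_nth fps_mult_nth[of "dil (1/5) dec"]
      dil_nth dec_nth invprod_nth by (simp add: power_divide)
  also have "\<dots> = fps_nth (3 * dil (1/5) invprod) n"
    unfolding * numeral_fps_const fps_mult_left_const_nth dil_nth invprod_nth by (simp add: power_divide)
  finally show "fps_nth ((3 + dil (1/5) dec) * invprod) n = fps_nth (3 * dil (1/5) invprod :: 'a fps) n" .
qed

lemma invcoef_le_1: "\<bar>invcoef n\<bar> \<le> 1"
proof (induction n rule: less_induct)
  case (less n)
  show ?case
  proof (cases "n = 0")
    case False
    have p: "(1::real) / 5 ^ n \<le> 1/5" using False power_increasing[of 1 n "5::real"] by (simp add: field_simps)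
    have "\<bar>\<Sum>l\<in>{1..n}. dcoef l / 5 ^ l * invcoef (n - l)\<bar> \<le> (\<Sum>l\<in>{1..n}. \<bar>dcoef l / 5 ^ l * invcoef (n - l)\<bar>)"
      by (rule sum_abs)
    also have "\<dots> \<le> (\<Sum>l\<in>{1..n}. 1 / 5 ^ l)"
    proof (intro sum_mono)
      fix l assume l: "l \<in> {1..n}"
      have "dcoef l \<le> 1" using dcoef_bound[of l] recfact_le_1[of l] by linarith
      then have "dcoef l / 5 ^ l * \<bar>invcoef (n - l)\<bar> \<le> 1 / 5 ^ l * 1"
        using less[of "n - l"] l False dcoef_bound[of l] by (intro mult_mono divide_right_mono) auto
      then show "\<bar>dcoef l / 5 ^ l * invcoef (n - l)\<bar> \<le> 1 / 5 ^ l"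
        using dcoef_bound[of l] by (simp add: abs_mult)
    qed
    also have "\<dots> \<le> 1/4"
    proof -
      have "(\<Sum>l\<in>{1..N}. (1::real) / 5 ^ l) = (1 - 1 / 5 ^ N) / 4" for N
      proof (induction N)
        case (Suc N)
        have "(\<Sum>l\<in>{1..Suc N}. (1::real) / 5 ^ l) = (1 - 1 / 5 ^ N) / 4 + 1 / 5 ^ Suc N"
          using Suc by simp
        then show ?case by (simp add: field_simps)
      qed simp
      then show ?thesis by simp
    qed
    finally have "\<bar>\<Sum>l\<in>{1..n}. dcoef l / 5 ^ l * invcoef (n - l)\<bar> \<le> 1/4" .
    then have bd: "\<bar>\<Sum>l\<in>{1..n}. dcoef l / 5 ^ l * invcoef (n - l)\<bar> \<le> 3 * (1 - 1 / 5 ^ n)"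
    proof -
      define x :: real where "x = 1 / 5 ^ n"
      show "A \<le> 3 * (1 - 1 / 5 ^ n)" if "A \<le> 1/4" for A :: real
        using p that unfolding x_def[symmetric] by (simp add: algebra_simps)
    qed
    moreover have "3 * (1 - 1 / 5 ^ n) > (0::real)"
    proof -
      have "(1::real) < 5 ^ n" using False by simp
      then show ?thesis by (simp add: field_simps)
    qed
    ultimately show ?thesis unfolding invcoef.simps[of n] if_not_P[OF False] abs_divide abs_minus_cancel
      by (simp only: abs_of_pos divide_le_eq_1_pos)
  qed (simp add: invcoef_0)
qed

lemma invprod_radius_complex: "fps_conv_radius (invprod :: complex fps) \<ge> ereal (5 * decroot)"
proof -
  let ?g = "3 + dil (1/5) dec :: complex fps"
  let ?R = "fps_conv_radius (invprod :: complex fps)"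
  have eg: "entire_fps ?g" by (intro entire_add entire_dil entire_dec) simp
  have nz: "eval_fps ?g z \<noteq> 0" if z: "norm z < 5 * decroot" for z
  proof
    assume "eval_fps ?g z = 0"
    then have "decf (z / 5) = - 3"
      by (simp add: eval_entire entire_dil entire_dec eval_dil add_eq_0_iff)
    then obtain x where "x > 0" "z / 5 = of_real (- x)" "decf (- x) = - 3" by (rule decf_eq_minus_3_real)
    then have "norm z = 5 * x" "decroot \<le> x" using decroot_least
      by (auto simp: norm_mult nonzero_divide_eq_eq)
    then show False using z by simp
  qed
  have gi: "fps_conv_radius (inverse ?g) \<ge> min (ereal (5 * decroot)) (fps_conv_radius ?g)"
    by (rule fps_conv_radius_inverse) (use nz decroot in \<open>auto simp: zero_ereal_def[symmetric] eball_def dil_nth dec_nth dcoef_0\<close>)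
  have g0: "fps_nth ?g 0 \<noteq> 0" by (simp add: dil_nth dec_nth dcoef_0)
  have "inverse ?g * (?g * invprod) = invprod"
    unfolding mult.assoc[symmetric] inverse_mult_eq_1[OF g0] by simp
  then have "invprod = inverse ?g * (3 * dil (1/5) invprod)" unfolding invprod_eq by simp
  then have "?R = fps_conv_radius (inverse ?g * (3 * dil (1/5) invprod))" by (rule arg_cong)
  then have min: "?R \<ge> min (fps_conv_radius (inverse ?g)) (fps_conv_radius (3 * dil (1/5) invprod :: complex fps))"
    using fps_conv_radius_mult[of "inverse ?g" "3 * dil (1/5) invprod"] by (simp only:)
  have R1: "?R \<ge> ereal 1"
    unfolding fps_conv_radius_def
  proof (rule conv_radius_geI_ex')
    fix r :: real assume r: "0 < r" "ereal r < ereal 1"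
    show "summable (\<lambda>n. fps_nth invprod n * complex_of_real r ^ n)"
    proof (rule summable_comparison_test'[where N = 0])
      show "summable (\<lambda>n. r ^ n)" using r by (intro summable_geometric) auto
      show "norm (fps_nth invprod n * complex_of_real r ^ n) \<le> r ^ n" for n
        using mult_right_mono[OF invcoef_le_1[of n], of "r ^ n"] r by (simp add: invprod_nth norm_mult norm_power)
    qed
  qed
  show ?thesis
  proof (rule ccontr)
    assume n: "\<not> ?thesis"
    then obtain \<rho> where \<rho>: "?R = ereal \<rho>" using R1 by (cases ?R) auto
    have "fps_conv_radius (dil (1/5) invprod :: complex fps) \<ge> ereal (5 * \<rho>)"
      by (rule radius_dil_fifth) (simp add: \<rho>)
    moreover have "fps_conv_radius (3 :: complex fps) = \<infinity>" by simp
    ultimately have "fps_conv_radius (3 * dil (1/5) invprod :: complex fps) \<ge> ereal (5 * \<rho>)"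
      using fps_conv_radius_mult[of 3 "dil (1/5) invprod :: complex fps"] by (auto simp: min_def split: if_splits)
    then have "ereal \<rho> \<ge> min (ereal (5 * decroot)) (ereal (5 * \<rho>))"
    proof -
      have "ereal (5 * decroot) \<le> fps_conv_radius (inverse ?g)" using gi unfolding eg by simp
      then have "min (ereal (5 * decroot)) (ereal (5 * \<rho>)) \<le>
          min (fps_conv_radius (inverse ?g)) (fps_conv_radius (3 * dil (1/5) invprod :: complex fps))"
        using \<open>ereal (5 * \<rho>) \<le> fps_conv_radius (3 * dil (1/5) invprod)\<close> by (rule min.mono)
      also note min
      finally show ?thesis unfolding \<rho> .
    qed
    moreover have "\<rho> < 5 * decroot" "\<rho> \<ge> 1" using n R1 unfolding \<rho> by auto
    ultimately show False by (auto simp: min_def split: if_splits)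
  qed
qed

lemma invprod_radius: "fps_conv_radius (Abs_fps (\<lambda>n. \<bar>invcoef n\<bar>)) \<ge> ereal (5 * decroot)"
proof -
  have "conv_radius (\<lambda>n. \<bar>invcoef n\<bar>) = conv_radius (fps_nth (invprod :: complex fps))"
    using conv_radius_norm[of "fps_nth (invprod :: complex fps)"] by (simp add: invprod_nth)
  then show ?thesis using invprod_radius_complex by (simp add: fps_conv_radius_def)
qed

section \<open>Even eigenfunctions\<close>

text \<open>One refinement step for the coordinates of an eigenfunction: the values of \<open>cstep\<close> on the cell
  \<open>F q k\<close> in terms of the series \<open>f\<close> on the whole gasket. The parameter \<open>g\<close> stands for a quarter of
  the discrete eigenvalue on level one.\<close>

definition cstep :: "'r::comm_ring_1 \<Rightarrow> 3 \<Rightarrow> 3 \<Rightarrow> (3 \<Rightarrow> 'r) \<Rightarrow> 'r" where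
  "cstep g k i f = (if i = k then f i else (2 + 2 * g) * (f i - f k) + (1 + 2 * g) * f (- i - k))"

lemma cstep_fix: "cstep g k i (\<lambda>i. if i = k then 1 else 1 + g) = (if i = k then 1 else 1 + g * (5 + 4 * g))"
proof (cases "i = k")
  case False
  then show ?thesis using third_index[OF False] unfolding cstep_def
    by (simp add: algebra_simps)
qed (simp add: cstep_def)

lemma cstep_junction:
  assumes "k \<noteq> j"
  shows "cstep g k i (\<lambda>i. if i = j then 1 else 1 + g) = cstep g j i (\<lambda>i. if i = k then 1 else 1 + g)"
proof -
  consider "i = k" | "i = j" | "i = - k - j" using third_index(4)[OF assms] by blast
  then show ?thesis
  proof cases
    case 1
    then have "- i - j \<noteq> k" "- i - j \<noteq> i" using third_index[of i j] assms by auto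
    then show ?thesis using 1 assms unfolding cstep_def by (simp add: algebra_simps)
  next
    case 2
    then have "- i - k \<noteq> j" "- i - k \<noteq> i" using third_index[of i k] assms by auto
    then show ?thesis using 2 assms unfolding cstep_def by (simp add: algebra_simps)
  next
    case 3
    then have "i \<noteq> k" "i \<noteq> j" "- i - k = j" "- i - j = k" using third_index[OF assms] by auto
    then show ?thesis using assms unfolding cstep_def by simp
  qed
qed

lemma cstep_junction_normal:
  assumes "k \<noteq> j"
  shows "cstep g k i (\<lambda>i. if i = j then 0 else G) + cstep g j i (\<lambda>i. if i = k then 0 else G) = 0"
proof -
  consider "i = k" | "i = j" | "i = - k - j" using third_index(4)[OF assms] by blast
  then show ?thesis
  proof cases
    case 1
    then have "- i - j \<noteq> k" "- i - j \<noteq> i" using third_index[of i j] assms by auto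
    then show ?thesis using 1 assms unfolding cstep_def by (simp add: algebra_simps)
  next
    case 2
    then have "- i - k \<noteq> j" "- i - k \<noteq> i" using third_index[of i k] assms by auto
    then show ?thesis using 2 assms unfolding cstep_def by (simp add: algebra_simps)
  next
    case 3
    then have "i \<noteq> k" "i \<noteq> j" "- i - k = j" "- i - j = k" using third_index[OF assms] by auto
    then show ?thesis using assms unfolding cstep_def by simp
  qed
qed

lemma cstep_linear:
  "cstep g k i (\<lambda>i. f i - h i) = cstep g k i f - cstep g k i h"
  "cstep g k i (\<lambda>i. c * f i) = c * cstep g k i f"
  unfolding cstep_def by (simp_all add: algebra_simps)

lemma cstep_sum: "cstep g k i (\<lambda>i. \<Sum>y\<in>A. f y i) = (\<Sum>y\<in>A. cstep g k i (f y))"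
proof (induction A rule: infinite_finite_induct)
  case (insert y A)
  have "cstep g k i (\<lambda>i. f y i + (\<Sum>y\<in>A. f y i)) = cstep g k i (f y) + cstep g k i (\<lambda>i. \<Sum>y\<in>A. f y i)"
    unfolding cstep_def by (simp add: algebra_simps)
  then show ?case using insert by simp
qed (simp_all add: cstep_def)

lemma cstep_normal: "cstep g k i (\<lambda>i. A * (if i = k then 1 else 1 + g) - (if i = k then 0 else G)) =
  A * (if i = k then 1 else 1 + g * (5 + 4 * g)) - (if i = k then 0 else (3 + 4 * g) * G)"
proof (cases "i = k")
  case False
  then show ?thesis using third_index[OF False] unfolding cstep_def
    by (simp add: algebra_simps)
qed (simp add: cstep_def)

definition lin :: "3 \<Rightarrow> 3 \<Rightarrow> (3 \<Rightarrow> real) \<Rightarrow> real" where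
  "lin k i v = (if i = k then v i else 2 * (v i - v k) + v (- i - k))"

text \<open>The norm \<open>max (\<bar>v i\<bar> / 2) \<bar>v i - v j\<bar>\<close> is contracted by the factor \<open>3/5\<close>, while the maximum
  norm alone need not be contracted.\<close>

lemma lin_contract:
  assumes "0 \<le> \<kappa>" "\<kappa> \<le> 1/5" and v: "\<And>i. \<bar>v i\<bar> \<le> 2 * e" and d: "\<And>i j. \<bar>v i - v j\<bar> \<le> e"
  shows "\<bar>\<kappa> * lin k i v\<bar> \<le> 2 * (3/5 * e)" "\<bar>\<kappa> * lin k i v - \<kappa> * lin k j v\<bar> \<le> 3/5 * e"
proof -
  have e: "e \<ge> 0" using d[of i i] by simp
  have L: "\<bar>\<kappa> * y\<bar> \<le> 1/5 * z" if "\<bar>y\<bar> \<le> z" for y z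
    using assms(1,2) that by (simp only: abs_mult abs_of_nonneg) (intro mult_mono, auto)
  have "\<bar>lin k i v\<bar> \<le> 4 * e"
    using v[of i] v[of "- i - k"] d[of i k] e unfolding lin_def by auto
  from L[OF this] show "\<bar>\<kappa> * lin k i v\<bar> \<le> 2 * (3/5 * e)" using e by linarith
  have diff: "\<bar>lin k i v - lin k j v\<bar> \<le> 3 * e"
  proof -
    consider "i = k" "j = k" | "i = k" "j \<noteq> k" | "i \<noteq> k" "j = k" | "i \<noteq> k" "j \<noteq> k" by blast
    then show ?thesis
    proof cases
      case 2
      then show ?thesis using d[of j k] d[of "- j - k" k] unfolding lin_def by auto
    next
      case 3
      then show ?thesis using d[of i k] d[of "- i - k" k] unfolding lin_def by auto
    next
      case 4
      show ?thesis
      proof (cases "i = j")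
        case False
        then have "- i - k = j" "- j - k = i"
          using third_index(4)[of i k] third_index(4)[of j k] third_index[of i k] third_index[of j k] 4 by auto
        then show ?thesis using 4 d[of i j] unfolding lin_def by (simp add: algebra_simps)
      qed (use e in simp)
    qed (use e in simp)
  qed
  have "\<kappa> * lin k i v - \<kappa> * lin k j v = \<kappa> * (lin k i v - lin k j v)" by (simp add: algebra_simps)
  then show "\<bar>\<kappa> * lin k i v - \<kappa> * lin k j v\<bar> \<le> 3/5 * e" using L[OF diff] by simp
qed

lemma lin_diff: "lin k i (\<lambda>i. v i - w i) = lin k i v - lin k i w"
  unfolding lin_def by simp

lemma tendsto_lin: "(\<And>i. (\<lambda>n. w n i) \<longlonglongrightarrow> v i) \<Longrightarrow> (\<lambda>n. lin k i (w n)) \<longlonglongrightarrow> lin k i v"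
  unfolding lin_def by (cases "i = k") (auto intro!: tendsto_intros)

lemma continuous_on_lin: "(\<And>i. continuous_on S (w i)) \<Longrightarrow> continuous_on S (\<lambda>x. lin k i (\<lambda>i. w i x))"
  unfolding lin_def by (cases "i = k") (auto intro!: continuous_intros)

context gasket begin

lemma selfsimilar_exists:
  fixes g :: "3 \<Rightarrow> 3 \<Rightarrow> real^2 \<Rightarrow> real" and v :: "3 \<Rightarrow> 3 \<Rightarrow> real"
  assumes \<kappa>: "0 \<le> \<kappa>" "\<kappa> \<le> 1/5" and g: "\<And>k i. continuous_on (SG q) (g k i)"
    and fix_eq: "\<And>k i. \<kappa> * lin k i (\<lambda>i. v i k) + g k i (q k) = v i k"
    and junc: "\<And>k j i. k \<noteq> j \<Longrightarrow> \<kappa> * lin k i (\<lambda>i. v i j) + g k i (q j) = \<kappa> * lin j i (\<lambda>i. v i k) + g j i (q k)"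
  shows "\<exists>u. (\<forall>i. continuous_on (SG q) (u i)) \<and> (\<forall>i j. u i (q j) = v i j) \<and>
    (\<forall>k i. \<forall>x\<in>SG q. u i (F q k x) = \<kappa> * lin k i (\<lambda>i. u i x) + g k i x)"
proof -
  define ch where "ch y = (SOME kx. snd kx \<in> SG q \<and> F q (fst kx) (snd kx) = y)" for y
  have ch: "snd (ch (F q k x)) \<in> SG q \<and> F q (fst (ch (F q k x))) (snd (ch (F q k x))) = F q k x" if "x \<in> SG q" for k x
    unfolding ch_def by (rule someI[of _ "(k, x)"]) (use that in simp)
  define T where "T w i y = \<kappa> * lin (fst (ch y)) i (\<lambda>i. w i (snd (ch y))) + g (fst (ch y)) i (snd (ch y))"
    for w :: "3 \<Rightarrow> real^2 \<Rightarrow> real" and i y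
  define I where "I w \<longleftrightarrow> (\<forall>i. continuous_on (SG q) (w i)) \<and> (\<forall>i j. w i (q j) = v i j)"
    for w :: "3 \<Rightarrow> real^2 \<Rightarrow> real"
  have T: "T w i (F q k x) = \<kappa> * lin k i (\<lambda>i. w i x) + g k i x" if w: "I w" and x: "x \<in> SG q" for w i k x
  proof -
    define k' x' where "k' = fst (ch (F q k x))" and "x' = snd (ch (F q k x))"
    have kx: "x' \<in> SG q" "F q k' x' = F q k x" using ch[OF x] unfolding k'_def x'_def by auto
    show ?thesis
    proof (cases "k' = k")
      case True
      then have "x' = x" using kx F_inj by simp
      then show ?thesis unfolding T_def k'_def[symmetric] x'_def[symmetric] True by simp
    next
      case False
      then have "x' = q k" "x = q k'" using junction[OF kx(1) x kx(2)] by auto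
      then have "T w i (F q k x) = \<kappa> * lin k' i (\<lambda>i. v i k) + g k' i (q k)"
        using w unfolding T_def k'_def[symmetric] x'_def[symmetric] I_def by (simp only:)
      also have "\<dots> = \<kappa> * lin k i (\<lambda>i. v i k') + g k i (q k')" by (rule junc[OF False])
      also have "\<dots> = \<kappa> * lin k i (\<lambda>i. w i x) + g k i x"
        using w \<open>x = q k'\<close> unfolding I_def by (simp only:)
      finally show ?thesis .
    qed
  qed
  have IT: "I (T w)" if w: "I w" for w
    unfolding I_def
  proof (intro conjI allI)
    fix i j
    have "T w i (q j) = T w i (F q j (q j))" by (simp only: F_fix)
    also have "\<dots> = \<kappa> * lin j i (\<lambda>i. v i j) + g j i (q j)"
      unfolding T[OF w vertex_SG] using w unfolding I_def by (simp only:)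
    also have "\<dots> = v i j" by (rule fix_eq)
    finally show "T w i (q j) = v i j" .
  next
    fix i
    have "continuous_on (\<Union>k\<in>UNIV. F q k ` SG q) (T w i)"
    proof (rule continuous_on_closed_Union)
      fix k :: 3
      show "closed (F q k ` SG q)"
        by (intro compact_imp_closed compact_continuous_image continuous_on_F SG_compact)
      have inv: "2 *\<^sub>R F q k x - q k = x" for x unfolding F_def by simp
      have h: "continuous_on (F q k ` SG q) (\<lambda>y. 2 *\<^sub>R y - q k)" by (intro continuous_intros)
      have im: "(\<lambda>y. 2 *\<^sub>R y - q k) ` (F q k ` SG q) \<subseteq> SG q" unfolding image_image inv by simp
      have cw: "continuous_on (SG q) (w i)" for i using w unfolding I_def by blast
      have "continuous_on (F q k ` SG q) (\<lambda>y. \<kappa> * lin k i (\<lambda>i. w i (2 *\<^sub>R y - q k)) + g k i (2 *\<^sub>R y - q k))"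
        by (rule continuous_on_add[OF continuous_on_mult[OF continuous_on_const continuous_on_lin[OF
              continuous_on_compose2[OF cw h im]]] continuous_on_compose2[OF g h im]])
      then show "continuous_on (F q k ` SG q) (T w i)"
      proof (rule continuous_on_eq)
        fix y assume "y \<in> F q k ` SG q"
        then obtain x where x: "x \<in> SG q" "y = F q k x" by blast
        show "\<kappa> * lin k i (\<lambda>i. w i (2 *\<^sub>R y - q k)) + g k i (2 *\<^sub>R y - q k) = T w i y"
          unfolding x(2) inv T[OF w x(1)] ..
      qed
    qed simp
    then show "continuous_on (SG q) (T w i)" by (simp only: SG_F[symmetric])
  qed
  define w0 where "w0 i x = (\<Sum>j\<in>UNIV. bary j x * v i j)" for i x
  have "w0 i (q j) = v i j" for i j
  proof -
    have "w0 i (q j) = (\<Sum>k\<in>UNIV. if k = j then v i j else 0)"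
      unfolding w0_def by (intro sum.cong) (auto simp: bary_vertex)
    then show ?thesis by simp
  qed
  then have I0: "I w0" unfolding I_def w0_def by (auto intro!: continuous_intros continuous_on_bary)
  define w where "w n = (T ^^ n) w0" for n
  have Iw: "I (w n)" for n unfolding w_def by (induction n) (use I0 IT in auto)
  have wS: "w (Suc n) i (F q k x) = \<kappa> * lin k i (\<lambda>i. w n i x) + g k i x" if "x \<in> SG q" for n i k x
    using T[OF Iw that] unfolding w_def by simp
  define d where "d n i x = w (Suc n) i x - w n i x" for n i x
  have dS: "d (Suc n) i (F q k x) = \<kappa> * lin k i (\<lambda>i. d n i x)" if "x \<in> SG q" for n i k x
    unfolding d_def lin_diff wS[OF that] by (simp add: algebra_simps)
  have "\<exists>B. \<forall>x\<in>SG q. \<bar>d 0 i x\<bar> \<le> B" for i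
  proof -
    have "continuous_on (SG q) (d 0 i)" unfolding d_def
      using Iw unfolding I_def by (intro continuous_intros) auto
    then have "bounded (d 0 i ` SG q)" by (intro compact_imp_bounded compact_continuous_image SG_compact)
    then show ?thesis by (auto simp: bounded_iff)
  qed
  then obtain B where B: "\<And>i x. x \<in> SG q \<Longrightarrow> \<bar>d 0 i x\<bar> \<le> B i" by metis
  define E where "E = 2 * (\<bar>B 1\<bar> + \<bar>B 2\<bar> + \<bar>B 3\<bar>)"
  have B': "\<bar>d 0 i x\<bar> \<le> E / 2" if "x \<in> SG q" for i x
  proof -
    have "\<forall>i. \<bar>d 0 i x\<bar> \<le> E / 2" unfolding forall_3 E_def using B[OF that, of 1] B[OF that, of 2] B[OF that, of 3] by auto
    then show ?thesis by blast
  qed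
  have db: "(\<forall>i. \<bar>d n i x\<bar> \<le> 2 * (E * (3/5) ^ n)) \<and> (\<forall>i j. \<bar>d n i x - d n j x\<bar> \<le> E * (3/5) ^ n)"
    if "x \<in> SG q" for n x
    using that
  proof (induction n arbitrary: x)
    case 0
    have "\<bar>d 0 i x\<bar> \<le> 2 * E" "\<bar>d 0 i x - d 0 j x\<bar> \<le> E" for i j
      using B'[OF 0, of i] B'[OF 0, of j] by linarith+
    then show ?case by simp
  next
    case (Suc n)
    obtain k y where y: "y \<in> SG q" "x = F q k y" by (rule SG_cases[OF Suc.prems])
    have "\<bar>\<kappa> * lin k i (\<lambda>i. d n i y)\<bar> \<le> 2 * (3/5 * (E * (3/5) ^ n))"
      "\<bar>\<kappa> * lin k i (\<lambda>i. d n i y) - \<kappa> * lin k j (\<lambda>i. d n i y)\<bar> \<le> 3/5 * (E * (3/5) ^ n)" for i j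
      using Suc.IH[OF y(1)] by (intro lin_contract \<kappa>; blast)+
    then show ?case unfolding y(2) dS[OF y(1)] by (simp add: mult_ac)
  qed
  define u where "u i x = w0 i x + (\<Sum>n. d n i x)" for i x
  have uni: "uniform_limit (SG q) (\<lambda>n x. w n i x) (u i) sequentially" for i
  proof -
    have "uniform_limit (SG q) (\<lambda>n x. \<Sum>m<n. d m i x) (\<lambda>x. \<Sum>m. d m i x) sequentially"
    proof (rule Weierstrass_m_test)
      show "norm (d n i x) \<le> 2 * (E * (3/5) ^ n)" if "x \<in> SG q" for n x using db[OF that] by simp
      show "summable (\<lambda>n. 2 * (E * (3/5) ^ n))" by (intro summable_mult summable_geometric) simp
    qed
    then have "uniform_limit (SG q) (\<lambda>n x. w0 i x + (\<Sum>m<n. d m i x)) (u i) sequentially"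
      unfolding u_def by (intro uniform_limit_intros)
    moreover have "w0 i x + (\<Sum>m<n. d m i x) = w n i x" for n x
      by (induction n) (simp_all add: d_def w_def)
    ultimately show ?thesis by simp
  qed
  have lim: "(\<lambda>n. w n i x) \<longlonglongrightarrow> u i x" if "x \<in> SG q" for i x
    by (rule tendsto_uniform_limitI[OF uni that])
  show ?thesis
  proof (intro exI conjI allI ballI)
    show "continuous_on (SG q) (u i)" for i
      by (rule uniform_limit_theorem[OF _ uni]) (use Iw in \<open>auto simp: I_def\<close>)
    show "u i (q j) = v i j" for i j
    proof -
      have "(\<lambda>n. w n i (q j)) \<longlonglongrightarrow> v i j" using Iw unfolding I_def by simp
      then show ?thesis using lim[OF vertex_SG] LIMSEQ_unique by blast
    qed
    fix k i x assume x: "x \<in> SG q"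
    have "(\<lambda>n. w (Suc n) i (F q k x)) \<longlonglongrightarrow> \<kappa> * lin k i (\<lambda>i. u i x) + g k i x"
      unfolding wS[OF x] by (intro tendsto_intros tendsto_lin lim x)
    moreover have "(\<lambda>n. w (Suc n) i (F q k x)) \<longlonglongrightarrow> u i (F q k x)"
      by (intro LIMSEQ_Suc lim F_SG x)
    ultimately show "u i (F q k x) = \<kappa> * lin k i (\<lambda>i. u i x) + g k i x" by (rule LIMSEQ_unique[rotated])
  qed
qed

definition quart :: "real fps" where "quart = fps_const (1/4) * dil (1/5) dec"

definition cval :: "3 \<Rightarrow> 3 \<Rightarrow> real fps" where
  "cval i j = (if i = j then 1 else 1 + fps_const (1/4) * dec)"

lemma quart_nth_0: "fps_nth quart 0 = 0"
  unfolding quart_def by (simp add: dil_nth dec_nth dcoef_0)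

lemma four_quart: "4 * quart = dil (1/5) dec"
  unfolding quart_def numeral_fps_const mult.assoc[symmetric] fps_const_mult by simp

lemma quart_dec: "fps_const (1/4) * dec = quart * (5 + 4 * quart)"
proof -
  have "fps_const (1/4) * dec = fps_const (1/4) * (dil (1/5) dec * (5 + dil (1/5) dec))"
    using dec_eq by metis
  then show ?thesis unfolding four_quart by (simp add: quart_def mult.assoc)
qed

lemma dil_cval: "dil (1/5) (cval i j) = (if i = j then 1 else 1 + quart)"
  unfolding cval_def quart_def by (simp add: dil_simps)

lemma cval_eq: "cval i j = (if i = j then 1 else 1 + quart * (5 + 4 * quart))"
  unfolding cval_def quart_dec by simp

lemma cstep_cval_fix: "cstep quart k i (\<lambda>i. dil (1/5) (cval i k)) = cval i k"
  unfolding dil_cval unfolding cval_eq by (rule cstep_fix)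

lemma cstep_cval_junction:
  "k \<noteq> j \<Longrightarrow> cstep quart k i (\<lambda>i. dil (1/5) (cval i j)) = cstep quart j i (\<lambda>i. dil (1/5) (cval i k))"
  unfolding dil_cval by (rule cstep_junction)

definition corr :: "(nat \<Rightarrow> 3 \<Rightarrow> real^2 \<Rightarrow> real) \<Rightarrow> nat \<Rightarrow> 3 \<Rightarrow> 3 \<Rightarrow> real^2 \<Rightarrow> real" where
  "corr f n k i x = (if i = k then 0 else
     (\<Sum>l=0..n. 2 * fps_nth quart l * (1/5) ^ (n - l) * (f (n - l) i x - f (n - l) k x + f (n - l) (- i - k) x)))"

lemma corr_cong:
  assumes "\<And>l. l < n \<Longrightarrow> f l = g l"
  shows "corr f n k i x = corr g n k i x"
proof -
  have *: "2 * fps_nth quart l * (1/5) ^ (n - l) * (f (n - l) i x - f (n - l) k x + f (n - l) (- i - k) x) =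
      2 * fps_nth quart l * (1/5) ^ (n - l) * (g (n - l) i x - g (n - l) k x + g (n - l) (- i - k) x)" if "l \<in> {0..n}" for l
    using assms[of "n - l"] that by (cases "l = 0") (auto simp: quart_nth_0)
  show ?thesis unfolding corr_def by (rule if_cong[OF refl refl sum.cong[OF refl *]])
qed

lemma cstep_nth:
  "fps_nth (cstep quart k i (\<lambda>i. dil (1/5) (Abs_fps (\<lambda>n. f n i x)))) n =
     1 / 5 ^ n * lin k i (\<lambda>i. f n i x) + corr f n k i x"
proof (cases "i = k")
  case True
  then show ?thesis by (simp add: cstep_def lin_def corr_def dil_nth power_divide)
next
  case False
  have two: "fps_nth (2 * F) n = 2 * fps_nth F n" for F :: "real fps" by (simp add: numeral_fps_const)
  let ?D = "\<lambda>i. dil (1/5) (Abs_fps (\<lambda>n. f n i x))"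
  have "cstep quart k i ?D = 2 * (?D i - ?D k) + ?D (- i - k) + 2 * (quart * (?D i - ?D k + ?D (- i - k)))"
    using False unfolding cstep_def by (simp add: algebra_simps)
  moreover have "fps_nth (quart * (?D i - ?D k + ?D (- i - k))) n =
     (\<Sum>l=0..n. fps_nth quart l * (1/5) ^ (n - l) * (f (n - l) i x - f (n - l) k x + f (n - l) (- i - k) x))"
    unfolding fps_mult_nth by (simp add: dil_nth algebra_simps)
  ultimately have "fps_nth (cstep quart k i ?D) n =
      2 * (f n i x / 5 ^ n - f n k x / 5 ^ n) + f n (- i - k) x / 5 ^ n +
      2 * (\<Sum>l=0..n. fps_nth quart l * (1/5) ^ (n - l) * (f (n - l) i x - f (n - l) k x + f (n - l) (- i - k) x))"
    by (simp only: fps_add_nth fps_sub_nth two) (simp add: dil_nth power_divide)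
  moreover have "2 * (\<Sum>l=0..n. fps_nth quart l * (1/5) ^ (n - l) * (f (n - l) i x - f (n - l) k x + f (n - l) (- i - k) x))
      = corr f n k i x"
    using False unfolding corr_def by (simp only: sum_distrib_left mult.assoc if_False)
  moreover have "2 * (f n i x / 5 ^ n - f n k x / 5 ^ n) + f n (- i - k) x / 5 ^ n = 1 / 5 ^ n * lin k i (\<lambda>i. f n i x)"
    using False unfolding lin_def by (simp add: field_simps)
  ultimately show ?thesis by simp
qed

definition cosrel :: "(nat \<Rightarrow> 3 \<Rightarrow> real^2 \<Rightarrow> real) \<Rightarrow> nat \<Rightarrow> (3 \<Rightarrow> real^2 \<Rightarrow> real) \<Rightarrow> bool" where
  "cosrel f n r \<longleftrightarrow> (if n = 0 then r = (\<lambda>i x. 1) else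
     (\<forall>i. continuous_on (SG q) (r i)) \<and> (\<forall>i j. r i (q j) = fps_nth (cval i j) n) \<and>
     (\<forall>k i. \<forall>x\<in>SG q. r i (F q k x) = 1 / 5 ^ n * lin k i (\<lambda>i. r i x) + corr f n k i x))"

lemma cosrel_vertex: "cosrel f n (f n) \<Longrightarrow> f n i (q j) = fps_nth (cval i j) n"
  unfolding cosrel_def by (cases "n = 0") (auto simp: cval_def dec_nth dcoef_0)

lemma cosrel_exists: "\<exists>f. \<forall>n. cosrel f n (f n)"
proof (rule dependent_wf_choice[where R = less_than])
  show "wf less_than" by simp
  show "cosrel f n r = cosrel g n r" if "\<And>l. (l, n) \<in> less_than \<Longrightarrow> f l = g l" for f g n r
    using corr_cong[of n f g] that unfolding cosrel_def by simp
  fix n f assume IH: "\<And>l. (l, n) \<in> less_than \<Longrightarrow> cosrel f l (f l)"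
  show "\<exists>r. cosrel f n r"
  proof (cases "n = 0")
    case False
    define f' where "f' = f(n := \<lambda>i x. 0)"
    have cf: "continuous_on (SG q) (f l i)" if "l < n" for l i
      using IH[of l] that unfolding cosrel_def by (cases "l = 0") auto
    then have cf': "continuous_on (SG q) (f' l i)" if "l \<le> n" for l i
      using that unfolding f'_def by (cases "l = n") auto
    have corr': "corr f n k i = corr f' n k i" for k i
      by (rule ext, rule corr_cong) (simp add: f'_def)
    have v: "f l i (q j) = fps_nth (cval i j) l" if "l < n" for l i j
      using IH[of l] that cosrel_vertex by simp
    have corr_v: "1 / 5 ^ n * lin k i (\<lambda>i. fps_nth (cval i j) n) + corr f n k i (q j) =
        fps_nth (cstep quart k i (\<lambda>i. dil (1/5) (cval i j))) n" for k i j
    proof -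
      have "corr f n k i (q j) = corr (\<lambda>l i x. fps_nth (cval i j) l) n k i (q j)"
      proof -
        have "corr f n k i (q j) = corr (\<lambda>l i x. f l i (q j)) n k i (q j)" unfolding corr_def by simp
        also have "\<dots> = corr (\<lambda>l i x. fps_nth (cval i j) l) n k i (q j)" by (rule corr_cong) (simp add: v)
        finally show ?thesis .
      qed
      then show ?thesis using cstep_nth[of k i "\<lambda>l i x. fps_nth (cval i j) l" "q j" n] by (simp add: fps_nth_inverse)
    qed
    have "\<exists>u. (\<forall>i. continuous_on (SG q) (u i)) \<and> (\<forall>i j. u i (q j) = fps_nth (cval i j) n) \<and>
      (\<forall>k i. \<forall>x\<in>SG q. u i (F q k x) = 1 / 5 ^ n * lin k i (\<lambda>i. u i x) + corr f n k i x)"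
    proof (rule selfsimilar_exists)
      show "0 \<le> 1 / (5::real) ^ n" by simp
      show "1 / (5::real) ^ n \<le> 1/5" using False power_increasing[of 1 n "5::real"] by (simp add: field_simps)
      show "continuous_on (SG q) (corr f n k i)" for k i
        unfolding corr' unfolding corr_def[abs_def] by (cases "i = k") (auto intro!: continuous_intros cf')
      show "1 / 5 ^ n * lin k i (\<lambda>i. fps_nth (cval i k) n) + corr f n k i (q k) = fps_nth (cval i k) n" for k i
        unfolding corr_v cstep_cval_fix ..
      show "1 / 5 ^ n * lin k i (\<lambda>i. fps_nth (cval i j) n) + corr f n k i (q j) =
          1 / 5 ^ n * lin j i (\<lambda>i. fps_nth (cval i k) n) + corr f n j i (q k)" if "k \<noteq> j" for k j i
        unfolding corr_v cstep_cval_junction[OF that] ..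
    qed
    then show ?thesis unfolding cosrel_def using False by auto
  qed (simp add: cosrel_def)
qed

text \<open>The generating series of the monomials \<open>P\<^bsub>j1\<^esub>\<close> centred at the vertex \<open>q i\<close>: an eigenfunction that
  is even with respect to the reflection at \<open>q i\<close>.\<close>

definition cosine :: "3 \<Rightarrow> real^2 \<Rightarrow> real fps" where
  "cosine i x = Abs_fps (\<lambda>n. (SOME f. \<forall>n. cosrel f n (f n)) n i x)"

lemma cosine_cosrel: "cosrel (\<lambda>n i x. fps_nth (cosine i x) n) n (\<lambda>i x. fps_nth (cosine i x) n)"
  using someI_ex[OF cosrel_exists] unfolding cosine_def by simp

lemma cosine_0: "fps_nth (cosine i x) 0 = 1"
  using cosine_cosrel[of 0] unfolding cosrel_def by (auto dest!: fun_cong)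

lemma continuous_on_cosine: "continuous_on (SG q) (\<lambda>x. fps_nth (cosine i x) n)"
  using cosine_cosrel[of n] unfolding cosrel_def by (cases "n = 0") (auto simp: cosine_0)

lemma cosine_vertex: "cosine i (q j) = cval i j"
  by (rule fps_ext) (rule cosrel_vertex[OF cosine_cosrel])

lemma cosine_F: "x \<in> SG q \<Longrightarrow> cosine i (F q k x) = cstep quart k i (\<lambda>i. dil (1/5) (cosine i x))"
proof (rule fps_ext)
  fix n assume x: "x \<in> SG q"
  show "fps_nth (cosine i (F q k x)) n = fps_nth (cstep quart k i (\<lambda>i. dil (1/5) (cosine i x))) n"
  proof (cases "n = 0")
    case True
    then show ?thesis using third_index[of i k]
      by (auto simp: cosine_0 cstep_def dil_nth quart_nth_0 fps_mult_nth)
  next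
    case False
    then show ?thesis using cosine_cosrel[of n] x cstep_nth[of k i "\<lambda>n i x. fps_nth (cosine i x) n" x n]
      unfolding cosrel_def by (simp add: fps_nth_inverse)
  qed
qed

definition dlap :: "nat \<Rightarrow> (real^2 \<Rightarrow> 'b::ab_group_add) \<Rightarrow> real^2 \<Rightarrow> 'b" where
  "dlap m g x = (\<Sum>y\<in>neighbours q m x. g y - g x)"

lemma dlap_cong:
  assumes "\<And>x. x \<in> SG q \<Longrightarrow> f x = g x" "x \<in> SG q"
  shows "dlap m f x = dlap m g x"
proof -
  have "y \<in> SG q" if "y \<in> neighbours q m x" for y using that neighbours_subset V_SG by blast
  then show ?thesis unfolding dlap_def using assms by (intro sum.cong) auto
qed

lemma sum_F_image: "(\<Sum>y\<in>F q k ` A. h y) = (\<Sum>y\<in>A. h (F q k y))"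
  by (subst sum.reindex) (auto simp: inj_on_def F_inj)

lemma dlap_interior:
  assumes "x \<in> SG q" "x \<notin> V q 0"
  shows "dlap (Suc m) g (F q k x) = dlap m (\<lambda>x. g (F q k x)) x"
  unfolding dlap_def neighbours_interior[OF assms] sum_F_image ..

lemma dlap_vertex_Suc: "dlap (Suc m) g (q j) = dlap m (\<lambda>x. g (F q j x)) (q j)"
proof -
  have "neighbours q (Suc m) (q j) = F q j ` neighbours q m (q j)"
    unfolding neighbours_vertex by simp
  then show ?thesis unfolding dlap_def by (simp only: sum_F_image F_fix)
qed

lemma dlap_junction:
  assumes "i \<noteq> j"
  shows "dlap (Suc m) g (F q i (q j)) = dlap m (\<lambda>x. g (F q i x)) (q j) + dlap m (\<lambda>x. g (F q j x)) (q i)"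
  unfolding dlap_def neighbours_junction(1)[OF assms]
  by (subst sum.union_disjoint)
     (auto simp: finite_neighbours neighbours_junction(2)[OF assms] sum_F_image F_swap[of i j])

lemma dlap_0: "dlap 0 g (q j) = (g (q (j + 1)) - g (q j)) + (g (q (j - 1)) - g (q j))"
proof -
  have "q (j + 1) \<noteq> q (j - 1)" using succ_pred_index(3) inj_q by blast
  then show ?thesis unfolding dlap_def neighbours_0 by simp
qed

lemma dlap_vertex: "dlap m g (q j) = (g ((F q j ^^ m) (q (j + 1))) - g (q j)) + (g ((F q j ^^ m) (q (j - 1))) - g (q j))"
proof (induction m arbitrary: g)
  case (Suc m)
  show ?case unfolding dlap_vertex_Suc Suc by (simp add: F_fix)
qed (simp add: dlap_0)

lemma dlap_cstep:
  assumes "y \<in> SG q"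
  shows "dlap m (\<lambda>x. cosine i (F q k x)) y = cstep quart k i (\<lambda>i. dil (1/5) (dlap m (cosine i) y))"
proof -
  have "dlap m (\<lambda>x. cosine i (F q k x)) y = dlap m (\<lambda>x. cstep quart k i (\<lambda>i. dil (1/5) (cosine i x))) y"
    by (rule dlap_cong) (use assms cosine_F in auto)
  also have "\<dots> = cstep quart k i (\<lambda>i. dil (1/5) (dlap m (cosine i) y))"
    unfolding dlap_def dil_sum dil_diff cstep_sum cstep_linear ..
  finally show ?thesis .
qed

primrec norm_fps :: "nat \<Rightarrow> real fps" where
  "norm_fps 0 = fps_const (1/8) * dec * (6 + dec)"
| "norm_fps (Suc m) = (3 + dil (1/5) dec) * dil (1/5) (norm_fps m)"

lemma cosine_dlap_vertex:
  "dlap m (cosine i) (q j) =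
     fps_const (1/2) * dil ((1/5) ^ m) dec * cval i j - (if i = j then 0 else norm_fps m)"
proof (induction m arbitrary: i)
  case 0
  show ?case
  proof (cases "i = j")
    case True
    have "fps_const (1/4) * dec + fps_const (1/4) * dec = fps_const (1/2) * (dec :: real fps)"
      by (simp flip: distrib_right)
    then show ?thesis using True succ_pred_index(1,2)[of j]
      unfolding dlap_0 cosine_vertex by (auto simp: cval_def dil_one)
  next
    case False
    then consider "i = j + 1" | "i = j - 1" using succ_pred_index(10)[of j] by blast
    then have "dlap 0 (cosine i) (q j) = - (fps_const (1/4) * dec)"
      using False succ_pred_index(3)[of j]
      by cases (auto simp: dlap_0 cosine_vertex cval_def)
    moreover have "fps_const (1/2) * dec * (1 + fps_const (1/4) * dec) - fps_const (1/8) * dec * (6 + dec) = - (fps_const (1/4) * dec :: real fps)"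
    proof -
      have "fps_const (1/2) * dec * (1 + fps_const (1/4) * dec) - fps_const (1/8) * dec * (6 + dec) =
        (fps_const (1/2) - fps_const (1/8) * fps_const 6) * dec + (fps_const (1/2) * fps_const (1/4) - fps_const (1/8)) * (dec * dec :: real fps)"
        by (simp only: numeral_fps_const algebra_simps mult_1_left mult_1_right)
      also have "\<dots> = - (fps_const (1/4) * dec)"
        unfolding fps_const_mult fps_const_sub by (simp add: fps_const_neg[symmetric] del: fps_const_neg)
      finally show ?thesis .
    qed
    ultimately show ?thesis using False by (simp add: cval_def dil_one)
  qed
next
  case (Suc m)
  have e: "dil (1/5) (dlap m (cosine i) (q j)) = fps_const (1/2) * dil ((1/5) ^ Suc m) dec * (if i = j then 1 else 1 + quart)
    - (if i = j then 0 else dil (1/5) (norm_fps m))" for i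
    unfolding Suc by (auto simp: dil_simps dil_dil dil_cval)
  show ?case unfolding dlap_vertex_Suc dlap_cstep[OF vertex_SG] e cstep_normal cval_eq
    by (simp only: four_quart norm_fps.simps)
qed

theorem cosine_dlap:
  assumes "x \<in> V q m - V q 0"
  shows "dlap m (cosine i) x = dil ((1/5) ^ m) dec * cosine i x"
  using assms
proof (induction m arbitrary: x i)
  case (Suc m)
  from Suc.prems show ?case
  proof (cases rule: V_Suc_cases)
    case (interior k y)
    then have y: "y \<in> SG q" "y \<notin> V q 0" using V_SG by auto
    have "dlap (Suc m) (cosine i) x = cstep quart k i (\<lambda>i. dil (1/5) (dlap m (cosine i) y))"
      unfolding interior(2) dlap_interior[OF y] dlap_cstep[OF y(1)] ..
    also have "\<dots> = cstep quart k i (\<lambda>i. dil ((1/5) ^ Suc m) dec * dil (1/5) (cosine i y))"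
      by (simp add: Suc.IH[OF interior(1)] dil_simps dil_dil)
    also have "\<dots> = dil ((1/5) ^ Suc m) dec * cosine i x"
      unfolding cstep_linear interior(2) cosine_F[OF y(1)] ..
    finally show ?thesis .
  next
    case (junction a b)
    define A where "A = fps_const (1/2) * dil ((1/5) ^ Suc m) (dec :: real fps)"
    define G where "G = dil (1/5) (norm_fps m)"
    have e: "dil (1/5) (dlap m (cosine i) (q j)) = A * dil (1/5) (cval i j) - (if i = j then 0 else G)" for i j
      unfolding cosine_dlap_vertex A_def G_def by (simp add: dil_simps dil_dil)
    have "dlap (Suc m) (cosine i) x =
        A * cstep quart a i (\<lambda>i. dil (1/5) (cval i b)) + A * cstep quart b i (\<lambda>i. dil (1/5) (cval i a))
        - (cstep quart a i (\<lambda>i. if i = b then 0 else G) + cstep quart b i (\<lambda>i. if i = a then 0 else G))"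
      unfolding junction(2) dlap_junction[OF junction(1)] dlap_cstep[OF vertex_SG] e cstep_linear by simp
    also have "\<dots> = (A + A) * cstep quart a i (\<lambda>i. dil (1/5) (cval i b))"
      unfolding cstep_junction_normal[OF junction(1)] cstep_cval_junction[OF junction(1)] by (simp add: algebra_simps)
    also have "A + A = dil ((1/5) ^ Suc m) dec"
      unfolding A_def distrib_right[symmetric] fps_const_add by simp
    finally show ?thesis unfolding junction(2) cosine_F[OF vertex_SG] cosine_vertex .
  qed
qed simp

end

section \<open>Series of Taylor coefficients\<close>

definition wconv :: "(nat \<Rightarrow> real) \<Rightarrow> nat \<Rightarrow> real" where
  "wconv B n = (\<Sum>i=0..n. dcoef i * B (n - i))"

context gasket begin

definition chain :: "(real^2 \<Rightarrow> real fps) \<Rightarrow> bool" where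
  "chain G \<longleftrightarrow> (\<forall>n. continuous_on (SG q) (\<lambda>x. fps_nth (G x) n)) \<and>
     (\<forall>m. \<forall>x\<in>V q m - V q 0. dlap m G x = dil ((1/5) ^ m) dec * G x)"

lemma chain_continuous: "chain G \<Longrightarrow> continuous_on (SG q) (\<lambda>x. fps_nth (G x) n)"
  unfolding chain_def by blast

lemma chain_dlap: "chain G \<Longrightarrow> x \<in> V q m - V q 0 \<Longrightarrow> dlap m G x = dil ((1/5) ^ m) dec * G x"
  unfolding chain_def by blast

lemma chain_cosine: "chain (cosine i)"
  unfolding chain_def using continuous_on_cosine cosine_dlap by blast

lemma chain_diff: "chain G \<Longrightarrow> chain H \<Longrightarrow> chain (\<lambda>x. G x - H x)"
proof -
  assume G: "chain G" and H: "chain H"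
  have "dlap m (\<lambda>x. G x - H x) x = dlap m G x - dlap m H x" for m x
    unfolding dlap_def sum_subtractf[symmetric] by (rule sum.cong) auto
  then show ?thesis unfolding chain_def fps_sub_nth
    using chain_dlap[OF G] chain_dlap[OF H] chain_continuous[OF G] chain_continuous[OF H]
    by (auto intro!: continuous_on_diff simp: right_diff_distrib)
qed

lemma chain_mult: "chain G \<Longrightarrow> chain (\<lambda>x. c * G x)"
proof -
  assume G: "chain G"
  have "dlap m (\<lambda>x. c * G x) x = c * dlap m G x" for m x
    unfolding dlap_def sum_distrib_left by (simp add: right_diff_distrib)
  then show ?thesis unfolding chain_def fps_mult_nth
    using chain_dlap[OF G] chain_continuous[OF G]
    by (auto intro!: continuous_on_sum continuous_on_mult continuous_on_const simp: mult_ac)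
qed

lemma chain_shift:
  assumes G: "chain G" and 0: "\<And>x. x \<in> SG q \<Longrightarrow> fps_nth (G x) 0 = 0"
  shows "chain (\<lambda>x. fps_shift 1 (G x))"
proof -
  have X: "G x = fps_X * fps_shift 1 (G x)" if "x \<in> SG q" for x
    by (rule fps_ext) (use 0[OF that] in \<open>auto simp: fps_X_mult_nth gr0_conv_Suc\<close>)
  have "dlap m (\<lambda>x. fps_shift 1 (G x)) x = dil ((1/5) ^ m) dec * fps_shift 1 (G x)"
    if x: "x \<in> V q m - V q 0" for m x
  proof -
    have xS: "x \<in> SG q" using x V_SG by blast
    have "fps_X * dlap m (\<lambda>x. fps_shift 1 (G x)) x = dlap m (\<lambda>x. fps_X * fps_shift 1 (G x)) x"
      unfolding dlap_def sum_distrib_left by (simp add: right_diff_distrib)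
    also have "\<dots> = dlap m G x" by (rule dlap_cong[OF X[symmetric] xS])
    also have "\<dots> = dil ((1/5) ^ m) dec * (fps_X * fps_shift 1 (G x))"
      using chain_dlap[OF G x] X[OF xS] by metis
    also have "\<dots> = fps_X * (dil ((1/5) ^ m) dec * fps_shift 1 (G x))" by (simp only: mult_ac)
    finally show ?thesis by simp
  qed
  then show ?thesis unfolding chain_def fps_shift_nth using chain_continuous[OF G] by blast
qed

lemma series_uniform_limit:
  fixes c :: "nat \<Rightarrow> 'a::{real_normed_field, banach}" and h :: "nat \<Rightarrow> real^2 \<Rightarrow> real"
  assumes "\<And>n x. x \<in> S \<Longrightarrow> \<bar>h n x\<bar> \<le> B n" "summable (\<lambda>n. norm (c n) * B n)"
  shows "uniform_limit S (\<lambda>N x. \<Sum>n<N. c n * of_real (h n x)) (\<lambda>x. \<Sum>n. c n * of_real (h n x)) sequentially"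
    and "x \<in> S \<Longrightarrow> summable (\<lambda>n. norm (c n * of_real (h n x)))"
proof -
  have b: "norm (c n * of_real (h n x)) \<le> norm (c n) * B n" if "x \<in> S" for n x
    using assms(1)[OF that] by (simp add: norm_mult mult_left_mono)
  show "uniform_limit S (\<lambda>N x. \<Sum>n<N. c n * of_real (h n x)) (\<lambda>x. \<Sum>n. c n * of_real (h n x)) sequentially"
    by (rule Weierstrass_m_test[OF b assms(2)])
  show "summable (\<lambda>n. norm (c n * of_real (h n x)))" if "x \<in> S"
    by (rule summable_comparison_test'[OF assms(2), of 0]) (use b[OF that] in simp)
qed

lemma series_continuous:
  fixes c :: "nat \<Rightarrow> 'a::{real_normed_field, banach}" and h :: "nat \<Rightarrow> real^2 \<Rightarrow> real"
  assumes "\<And>n. continuous_on S (h n)" "\<And>n x. x \<in> S \<Longrightarrow> \<bar>h n x\<bar> \<le> B n" "summable (\<lambda>n. norm (c n) * B n)"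
  shows "continuous_on S (\<lambda>x. \<Sum>n. c n * of_real (h n x))"
  by (rule uniform_limit_theorem[OF _ series_uniform_limit(1)[OF assms(2,3)]])
     (auto intro!: always_eventually continuous_intros assms(1))

text \<open>On level \<open>m\<close> the difference operator maps \<open>G\<close> exactly to \<open>dil ((1/5) ^ m) dec * G\<close>; after
  normalisation the coefficient of order one of the factor is \<open>1\<close> and all others are \<open>O(5 ^ -m)\<close>.\<close>

theorem chain_has_laplacian:
  fixes c :: "nat \<Rightarrow> 'a::{real_normed_field, banach}"
  assumes G: "chain G" and B: "\<And>n x. x \<in> SG q \<Longrightarrow> \<bar>fps_nth (G x) n\<bar> \<le> B n"
    and s0: "summable (\<lambda>n. norm (c n) * B n)" and s1: "summable (\<lambda>n. norm (c n) * wconv B n)"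
  shows "has_laplacian q (\<lambda>x. \<Sum>n. c n * of_real (fps_nth (G x) n)) (\<lambda>x. \<Sum>n. c (Suc n) * of_real (fps_nth (G x) n))"
proof -
  have B0: "B n \<ge> 0" for n using B[OF vertex_SG, of 0 n] by (rule order_trans[OF abs_ge_zero])
  have "summable (\<lambda>n. norm (c (Suc n)) * B n)"
  proof (rule summable_comparison_test')
    show "summable (\<lambda>n. 3/2 * (norm (c (Suc n)) * wconv B (Suc n)))"
      using s1 summable_Suc_iff[of "\<lambda>n. norm (c n) * wconv B n"] by (intro summable_mult) (simp only:)
    fix n
    have "dcoef 1 * B (Suc n - 1) \<le> wconv B (Suc n)"
      unfolding wconv_def using B0 dcoef_bound by (intro member_le_sum) auto
    then have "B n \<le> 3/2 * wconv B (Suc n)" by (simp add: dcoef_1)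
    then have "norm (c (Suc n)) * B n \<le> norm (c (Suc n)) * (3/2 * wconv B (Suc n))"
      by (rule mult_left_mono) simp
    then show "norm (norm (c (Suc n)) * B n) \<le> 3/2 * (norm (c (Suc n)) * wconv B (Suc n))" using B0 by simp
  qed
  note s2 = this
  let ?u = "\<lambda>x. \<Sum>n. c n * of_real (fps_nth (G x) n)" and ?f = "\<lambda>x. \<Sum>n. c (Suc n) * of_real (fps_nth (G x) n)"
  define S where "S = (\<Sum>n. norm (c n) * wconv B n)"
  have W0: "wconv B n \<ge> 0" for n unfolding wconv_def using B0 dcoef_bound by (intro sum_nonneg mult_nonneg_nonneg) auto
  have key: "norm ((3/2 * 5 ^ m) *\<^sub>R (\<Sum>y\<in>neighbours q m x. ?u y - ?u x) - ?f x) \<le> 3/2 * S / 5 ^ m"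
    if x: "x \<in> V q m - V q 0" for m x
  proof -
    have xS: "x \<in> SG q" using x V_SG by blast
    have sm: "summable (\<lambda>n. c n * of_real (fps_nth (G y) n))" if "y \<in> SG q" for y
      by (rule summable_norm_cancel[OF series_uniform_limit(2)[OF B s0 that]])
    have nS: "y \<in> SG q" if "y \<in> neighbours q m x" for y using that neighbours_subset V_SG by blast
    define t where "t n = c n * of_real (dlap m (\<lambda>y. fps_nth (G y) n) x)" for n
    have "(\<lambda>n. \<Sum>y\<in>neighbours q m x. (c n * of_real (fps_nth (G y) n) - c n * of_real (fps_nth (G x) n)))
        sums (\<Sum>y\<in>neighbours q m x. ?u y - ?u x)"
      by (intro sums_sum sums_diff summable_sums sm xS nS)
    moreover have "(\<Sum>y\<in>neighbours q m x. (c n * of_real (fps_nth (G y) n) - c n * of_real (fps_nth (G x) n))) = t n" for n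
      unfolding t_def dlap_def of_real_sum sum_distrib_left of_real_diff right_diff_distrib ..
    ultimately have "t sums (\<Sum>y\<in>neighbours q m x. ?u y - ?u x)" by simp
    then have t: "(\<lambda>n. (3/2 * 5 ^ m) *\<^sub>R t n) sums ((3/2 * 5 ^ m) *\<^sub>R (\<Sum>y\<in>neighbours q m x. ?u y - ?u x))"
      by (rule sums_scaleR_right)
    define w where "w n = (case n of 0 \<Rightarrow> 0 | Suc k \<Rightarrow> c n * of_real (fps_nth (G x) k))" for n
    have "(\<lambda>n. w (Suc n)) sums ?f x"
      unfolding w_def nat.case
      by (rule summable_sums[OF summable_norm_cancel[OF series_uniform_limit(2)[OF B s2 xS]]])
    then have w: "w sums ?f x" using sums_Suc[of w "?f x"] by (simp add: w_def)
    have d: "(\<lambda>n. (3/2 * 5 ^ m) *\<^sub>R t n - w n) sums ((3/2 * 5 ^ m) *\<^sub>R (\<Sum>y\<in>neighbours q m x. ?u y - ?u x) - ?f x)"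
      by (rule sums_diff[OF t w])
    have bd: "norm ((3/2 * 5 ^ m) *\<^sub>R t n - w n) \<le> 3/2 / 5 ^ m * (norm (c n) * wconv B n)" for n
    proof (cases n)
      case 0
      have "dlap m (\<lambda>y. fps_nth (G y) 0) x = fps_nth (dlap m G x) 0"
        unfolding dlap_def by (simp add: fps_sum_nth)
      then have "t n = 0" unfolding t_def 0 chain_dlap[OF G x] by (simp add: dil_nth dec_nth dcoef_0)
      then show ?thesis using W0[of n] by (simp add: w_def 0)
    next
      case (Suc k)
      have "dlap m (\<lambda>y. fps_nth (G y) n) x = fps_nth (dlap m G x) n"
        unfolding dlap_def by (simp add: fps_sum_nth)
      also have "\<dots> = (\<Sum>i=0..n. (1 / 5 ^ m) ^ i * dcoef i * fps_nth (G x) (n - i))"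
        unfolding chain_dlap[OF G x] fps_mult_nth by (simp add: dil_nth dec_nth power_divide)
      also have "\<dots> = (1 / 5 ^ m) * (2/3) * fps_nth (G x) k + (\<Sum>i=2..n. (1 / 5 ^ m) ^ i * dcoef i * fps_nth (G x) (n - i))"
        using Suc by (simp add: sum.atLeast_Suc_atMost[of 0] sum.atLeast_Suc_atMost[of "Suc 0"] dcoef_0 dcoef_1 numeral_2_eq_2)
      finally have e: "dlap m (\<lambda>y. fps_nth (G y) n) x =
        (1 / 5 ^ m) * (2/3) * fps_nth (G x) k + (\<Sum>i=2..n. (1 / 5 ^ m) ^ i * dcoef i * fps_nth (G x) (n - i))" .
      define r where "r = (3/2 * 5 ^ m) * (\<Sum>i=2..n. (1 / 5 ^ m) ^ i * dcoef i * fps_nth (G x) (n - i))"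
      have "(3/2 * 5 ^ m) * dlap m (\<lambda>y. fps_nth (G y) n) x = fps_nth (G x) k + r"
        unfolding e r_def by (simp add: distrib_left)
      then have "(3/2 * 5 ^ m) *\<^sub>R t n = c n * of_real (fps_nth (G x) k + r)"
        unfolding t_def scaleR_conv_of_real by (metis mult.left_commute of_real_mult)
      then have "(3/2 * 5 ^ m) *\<^sub>R t n - w n = c n * of_real r"
        unfolding w_def Suc by (simp add: algebra_simps)
      then have n1: "norm ((3/2 * 5 ^ m) *\<^sub>R t n - w n) = norm (c n) * \<bar>r\<bar>" by (simp add: norm_mult)
      have "\<bar>\<Sum>i=2..n. (1 / 5 ^ m) ^ i * dcoef i * fps_nth (G x) (n - i)\<bar> \<le>
          (\<Sum>i=2..n. \<bar>(1 / 5 ^ m) ^ i * dcoef i * fps_nth (G x) (n - i)\<bar>)" by (rule sum_abs)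
      also have "\<dots> \<le> (\<Sum>i=2..n. (1 / 5 ^ m) ^ 2 * (dcoef i * B (n - i)))"
      proof (rule sum_mono)
        fix i assume i: "i \<in> {2..n}"
        have "(1 / (5::real) ^ m) ^ i \<le> (1 / 5 ^ m) ^ 2" using i by (intro power_decreasing) auto
        then have "(1 / 5 ^ m) ^ i * (dcoef i * \<bar>fps_nth (G x) (n - i)\<bar>) \<le> (1 / 5 ^ m) ^ 2 * (dcoef i * B (n - i))"
          using B[OF xS] dcoef_bound by (intro mult_mono mult_nonneg_nonneg) auto
        then show "\<bar>(1 / 5 ^ m) ^ i * dcoef i * fps_nth (G x) (n - i)\<bar> \<le> (1 / 5 ^ m) ^ 2 * (dcoef i * B (n - i))"
          using dcoef_bound[of i] by (simp only: abs_mult abs_of_nonneg zero_le_power zero_le_divide_1_iff zero_le_numeral mult.assoc)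
      qed
      also have "\<dots> \<le> (1 / 5 ^ m) ^ 2 * wconv B n"
        unfolding wconv_def sum_distrib_left[symmetric] using B0 dcoef_bound
        by (intro mult_left_mono sum_mono2 mult_nonneg_nonneg) auto
      finally have "\<bar>r\<bar> \<le> (3/2 * 5 ^ m) * ((1 / 5 ^ m) ^ 2 * wconv B n)"
        unfolding r_def abs_mult by (intro mult_mono) auto
      also have "\<dots> = 3/2 / 5 ^ m * wconv B n" by (simp add: power2_eq_square)
      finally have "norm (c n) * \<bar>r\<bar> \<le> norm (c n) * (3/2 / 5 ^ m * wconv B n)" by (rule mult_left_mono) simp
      then show ?thesis unfolding n1 by (simp only: mult_ac)
    qed
    have "norm (\<Sum>n. (3/2 * 5 ^ m) *\<^sub>R t n - w n) \<le> (\<Sum>n. 3/2 / 5 ^ m * (norm (c n) * wconv B n))"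
      by (rule norm_suminf_le[OF bd summable_mult[OF s1]])
    then show ?thesis unfolding sums_unique[OF d, symmetric] suminf_mult[OF s1] S_def[symmetric] by simp
  qed
  show ?thesis
    unfolding has_laplacian_def
  proof (intro conjI allI impI)
    show "continuous_on (SG q) ?u" by (rule series_continuous[OF chain_continuous[OF G] B s0])
    show "continuous_on (SG q) ?f" by (rule series_continuous[OF chain_continuous[OF G] B s2])
    fix \<epsilon> :: real assume \<epsilon>: "\<epsilon> > 0"
    have "(\<lambda>m. 3/2 * S / 5 ^ m) \<longlonglongrightarrow> 0" by real_asymp
    then have "\<forall>\<^sub>F m in sequentially. 3/2 * S / 5 ^ m < \<epsilon>" using \<epsilon> by (rule order_tendstoD(2))
    then obtain M where M: "\<And>m. m \<ge> M \<Longrightarrow> 3/2 * S / 5 ^ m < \<epsilon>" unfolding eventually_sequentially by blast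
    show "\<exists>M. \<forall>m\<ge>M. \<forall>x\<in>V q m - V q 0.
        dist ((3/2 * 5 ^ m) *\<^sub>R (\<Sum>y\<in>neighbours q m x. ?u y - ?u x)) (?f x) < \<epsilon>"
    proof (intro exI allI impI ballI)
      fix m x assume "m \<ge> M" "x \<in> V q m - V q 0"
      then show "dist ((3/2 * 5 ^ m) *\<^sub>R (\<Sum>y\<in>neighbours q m x. ?u y - ?u x)) (?f x) < \<epsilon>"
        unfolding dist_norm using key M by (rule_tac order_le_less_trans)
    qed
  qed
qed

lemma scaled_series_limit:
  fixes c :: "nat \<Rightarrow> 'a::{real_normed_field, banach}"
  assumes \<beta>: "0 \<le> \<beta>" "\<beta> < 5" "\<beta> = 1 \<or> h 0 = 0" and s: "summable (\<lambda>n. norm (c n) * \<bar>h n\<bar>)"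
  shows "(\<lambda>m. \<Sum>n. c n * of_real ((\<beta> / 5 ^ n) ^ m * h n)) \<longlonglongrightarrow> c 0 * of_real (h 0)"
proof -
  define S where "S = (\<Sum>n. norm (c (Suc n)) * \<bar>h (Suc n)\<bar>)"
  have s': "summable (\<lambda>n. norm (c (Suc n)) * \<bar>h (Suc n)\<bar>)" using s summable_Suc_iff[of "\<lambda>n. norm (c n) * \<bar>h n\<bar>"] by (simp only:)
  have b: "norm ((\<Sum>n. c n * of_real ((\<beta> / 5 ^ n) ^ m * h n)) - c 0 * of_real (h 0)) \<le> (\<beta> / 5) ^ m * S" for m
  proof -
    have bd: "norm (c (Suc n) * of_real ((\<beta> / 5 ^ Suc n) ^ m * h (Suc n))) \<le> (\<beta> / 5) ^ m * (norm (c (Suc n)) * \<bar>h (Suc n)\<bar>)" for n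
    proof -
      have "\<beta> / 5 ^ Suc n \<le> \<beta> / 5 ^ 1" using \<beta>(1) by (intro divide_left_mono power_increasing) auto
      then have "(\<beta> / 5 ^ Suc n) ^ m \<le> (\<beta> / 5) ^ m" using \<beta>(1) by (intro power_mono) auto
      then have "(\<beta> / 5 ^ Suc n) ^ m * (norm (c (Suc n)) * \<bar>h (Suc n)\<bar>) \<le> (\<beta> / 5) ^ m * (norm (c (Suc n)) * \<bar>h (Suc n)\<bar>)"
        by (rule mult_right_mono) simp
      moreover have "\<bar>(\<beta> / 5 ^ Suc n) ^ m\<bar> = (\<beta> / 5 ^ Suc n) ^ m" using \<beta>(1) by (intro abs_of_nonneg) simp
      ultimately show ?thesis unfolding norm_mult norm_of_real abs_mult by (simp only: mult.left_commute)
    qed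
    have sm: "summable (\<lambda>n. c (Suc n) * of_real ((\<beta> / 5 ^ Suc n) ^ m * h (Suc n)))"
      by (rule summable_comparison_test'[OF summable_mult[OF s'], of 0]) (rule bd)
    then have "summable (\<lambda>n. c n * of_real ((\<beta> / 5 ^ n) ^ m * h n))" by (simp only: summable_Suc_iff[of "\<lambda>n. c n * of_real ((\<beta> / 5 ^ n) ^ m * h n)"])
    then have "(\<Sum>n. c (Suc n) * of_real ((\<beta> / 5 ^ Suc n) ^ m * h (Suc n))) =
      (\<Sum>n. c n * of_real ((\<beta> / 5 ^ n) ^ m * h n)) - c 0 * of_real ((\<beta> / 5 ^ 0) ^ m * h 0)"
      by (rule suminf_split_head)
    moreover have "(\<beta> / 5 ^ 0) ^ m * h 0 = h 0" using \<beta>(3) by auto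
    ultimately have "(\<Sum>n. c n * of_real ((\<beta> / 5 ^ n) ^ m * h n)) - c 0 * of_real (h 0) =
       (\<Sum>n. c (Suc n) * of_real ((\<beta> / 5 ^ Suc n) ^ m * h (Suc n)))" by (simp only:)
    moreover have "norm (\<Sum>n. c (Suc n) * of_real ((\<beta> / 5 ^ Suc n) ^ m * h (Suc n))) \<le>
        (\<Sum>n. (\<beta> / 5) ^ m * (norm (c (Suc n)) * \<bar>h (Suc n)\<bar>))"
      by (rule norm_suminf_le[OF bd summable_mult[OF s']])
    ultimately show ?thesis unfolding S_def suminf_mult[OF s', symmetric] by (simp only:)
  qed
  have "(\<lambda>m. (\<beta> / 5) ^ m * S) \<longlonglongrightarrow> 0 * S"
    by (intro tendsto_intros LIMSEQ_realpow_zero) (use \<beta> in auto)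
  then have "(\<lambda>m. (\<Sum>n. c n * of_real ((\<beta> / 5 ^ n) ^ m * h n)) - c 0 * of_real (h 0)) \<longlonglongrightarrow> 0"
    by (intro Lim_null_comparison[OF always_eventually[OF allI[OF b]]]) simp
  then show ?thesis by (rule LIM_zero_cancel)
qed

lemma cosine_bound:
  "\<exists>K\<ge>1. \<forall>i n. \<forall>x\<in>SG q. \<bar>fps_nth (cosine i x) n\<bar> \<le> K * 2 ^ n * recfact n"
proof -
  define A where "A n = (\<lambda>(i, x). \<bar>fps_nth (cosine i x) n\<bar>) ` (UNIV \<times> SG q)" for n
  define M where "M n = Sup (A n)" for n
  have bdd: "bdd_above (A n)" for n
  proof -
    have "\<exists>b. \<forall>x\<in>SG q. \<bar>fps_nth (cosine i x) n\<bar> \<le> b" for i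
    proof -
      have "bounded ((\<lambda>x. fps_nth (cosine i x) n) ` SG q)"
        by (intro compact_imp_bounded compact_continuous_image SG_compact continuous_on_cosine)
      then show ?thesis by (auto simp: bounded_iff)
    qed
    then have "\<forall>i. \<exists>b. \<forall>x\<in>SG q. \<bar>fps_nth (cosine i x) n\<bar> \<le> b" by (rule allI)
    from choice[OF this] obtain b where b: "\<forall>i. \<forall>x\<in>SG q. \<bar>fps_nth (cosine i x) n\<bar> \<le> b i" by (rule exE)
    have bs: "b i \<le> (\<Sum>i\<in>UNIV. \<bar>b i\<bar>)" for i
    proof -
      have "\<bar>b i\<bar> \<le> (\<Sum>i\<in>UNIV. \<bar>b i\<bar>)" by (rule member_le_sum) simp_all
      then show ?thesis by linarith
    qed
    show ?thesis
    proof (rule bdd_aboveI[of _ "\<Sum>i\<in>UNIV. \<bar>b i\<bar>"])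
      fix z assume "z \<in> A n"
      then obtain i x where "x \<in> SG q" "z = \<bar>fps_nth (cosine i x) n\<bar>" unfolding A_def by auto
      then show "z \<le> (\<Sum>i\<in>UNIV. \<bar>b i\<bar>)" using b bs[of i] by (blast intro: order_trans)
    qed
  qed
  have up: "\<bar>fps_nth (cosine i x) n\<bar> \<le> M n" if "x \<in> SG q" for i x n
    unfolding M_def by (rule cSup_upper[OF _ bdd]) (use that in \<open>auto simp: A_def\<close>)
  have M0: "M n \<ge> 0" for n using up[OF vertex_SG, of 0 0 n] by (rule order_trans[OF abs_ge_zero])
  have least: "M n \<le> z" if "\<And>i x. x \<in> SG q \<Longrightarrow> \<bar>fps_nth (cosine i x) n\<bar> \<le> z" for n z
    unfolding M_def by (rule cSup_least) (use that vertex_SG[of 0] in \<open>auto simp: A_def\<close>)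
  define K where "K = max 1 (M 1)"
  have K: "K \<ge> 1" unfolding K_def by simp
  have MK: "M n \<le> K * 2 ^ n * recfact n" for n
  proof (induction n rule: less_induct)
    case (less n)
    consider "n = 0" | "n = 1" | "n \<ge> 2" by linarith
    then show ?case
    proof cases
      case 1
      then show ?thesis using least[of 0 1] K by (simp add: cosine_0 recfact_0)
    next
      case 2
      then show ?thesis using M0[of 1] by (simp add: recfact_1 K_def)
    next
      case 3
      let ?f = "\<lambda>n i x. fps_nth (cosine i x) n"
      have cb: "\<bar>corr ?f n k i x\<bar> \<le> 1/2 * (K * 2 ^ n * recfact n)" if x: "x \<in> SG q" for k i x
      proof (cases "i = k")
        case True
        then show ?thesis using K recfact_pos[of n] unfolding corr_def by simp
      next
        case False
        have "\<bar>corr ?f n k i x\<bar> \<le> (\<Sum>l=0..n. \<bar>2 * fps_nth quart l * (1/5) ^ (n - l) * (?f (n - l) i x - ?f (n - l) k x + ?f (n - l) (- i - k) x)\<bar>)"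
          unfolding corr_def using False by (simp only: if_False) (rule sum_abs)
        also have "\<dots> \<le> (\<Sum>l=0..n. K * 2 ^ n / 2 / 5 ^ n * (recfact l * recfact (n - l)))"
        proof (rule sum_mono)
          fix l assume l: "l \<in> {0..n}"
          show "\<bar>2 * fps_nth quart l * (1/5) ^ (n - l) * (?f (n - l) i x - ?f (n - l) k x + ?f (n - l) (- i - k) x)\<bar>
              \<le> K * 2 ^ n / 2 / 5 ^ n * (recfact l * recfact (n - l))"
          proof (cases "l = 0")
            case True
            then show ?thesis using K recfact_pos[of l] recfact_pos[of "n - l"] by (simp add: quart_nth_0)
          next
            case False
            define p where "p = n - l"
            have pn: "p < n" "n = l + p" using False l 3 unfolding p_def by auto
            have "M p \<le> K * 2 ^ p * recfact p" using less pn(1) by blast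
            then have fb: "\<bar>?f p j x\<bar> \<le> K * 2 ^ p * recfact p" for j using up[OF x, of j p] by linarith
            have "\<bar>?f p i x - ?f p k x + ?f p (- i - k) x\<bar> \<le> 3 * (K * 2 ^ p * recfact p)"
              using fb[of i] fb[of k] fb[of "- i - k"] by linarith
            moreover have "fps_nth quart l = dcoef l / 4 / 5 ^ l"
              unfolding quart_def by (simp add: dil_nth dec_nth power_divide)
            then have "\<bar>fps_nth quart l\<bar> \<le> 2/3 * recfact l / 4 / 5 ^ l"
              using dcoef_bound[of l] divide_right_mono[of "dcoef l" "2/3 * recfact l" "4 * 5 ^ l"] by simp
            ultimately have "\<bar>2 * fps_nth quart l * (1/5) ^ p * (?f p i x - ?f p k x + ?f p (- i - k) x)\<bar> \<le>
               2 * (2/3 * recfact l / 4 / 5 ^ l) * (1/5) ^ p * (3 * (K * 2 ^ p * recfact p))"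
              unfolding abs_mult using K recfact_pos[of p] recfact_pos[of l]
              by (intro mult_mono mult_nonneg_nonneg divide_nonneg_nonneg) auto
            also have "\<dots> = K * 2 ^ p / 5 ^ n * (recfact l * recfact p)"
              unfolding pn(2) by (simp add: power_add power_divide)
            also have "\<dots> \<le> K * 2 ^ n / 2 / 5 ^ n * (recfact l * recfact p)"
            proof -
              have "(2::real) ^ p * 2 ^ 1 \<le> 2 ^ p * 2 ^ l" using False by (intro mult_left_mono power_increasing) auto
              then have "(2::real) ^ p \<le> 2 ^ n / 2" unfolding pn(2) power_add by simp
              then have "K * 2 ^ p / 5 ^ n \<le> K * (2 ^ n / 2) / 5 ^ n"
                using K by (intro divide_right_mono mult_left_mono) auto
              then have "K * 2 ^ p / 5 ^ n \<le> K * 2 ^ n / 2 / 5 ^ n" by simp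
              then show ?thesis using recfact_pos[of l] recfact_pos[of p] by (intro mult_right_mono) auto
            qed
            finally show ?thesis unfolding p_def .
          qed
        qed
        also have "\<dots> = K * 2 ^ n / 2 / 5 ^ n * (\<Sum>l\<le>n. recfact l * recfact (n - l))"
          by (simp only: sum_distrib_left atLeast0AtMost)
        also have "\<dots> \<le> K * 2 ^ n / 2 / 5 ^ n * (5 ^ n * recfact n)"
          using K by (intro mult_left_mono recfact_conv) auto
        finally show ?thesis by simp
      qed
      have "M n \<le> M n / 5 + 1/2 * (K * 2 ^ n * recfact n)"
      proof (rule least)
        fix i y assume "y \<in> SG q"
        then obtain k x where x: "x \<in> SG q" "y = F q k x" by (rule SG_cases)
        have "?f n i y = 1 / 5 ^ n * lin k i (\<lambda>i. ?f n i x) + corr ?f n k i x"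
          using cosine_cosrel[of n] 3 x unfolding cosrel_def by auto
        moreover have "\<bar>lin k i (\<lambda>i. ?f n i x)\<bar> \<le> 5 * M n"
          using up[OF x(1), of i n] up[OF x(1), of k n] up[OF x(1), of "- i - k" n] unfolding lin_def by auto
        then have "1 / 5 ^ n * \<bar>lin k i (\<lambda>i. ?f n i x)\<bar> \<le> 1 / 25 * (5 * M n)"
          using five_power[OF 3] by (intro mult_mono) (auto simp: field_simps)
        ultimately show "\<bar>?f n i y\<bar> \<le> M n / 5 + 1/2 * (K * 2 ^ n * recfact n)"
          using cb[OF x(1), of k i] abs_triangle_ineq[of "1 / 5 ^ n * lin k i (\<lambda>i. ?f n i x)" "corr ?f n k i x"]
          by (simp add: abs_mult)
      qed
      moreover have "0 \<le> K * 2 ^ n * recfact n" using K recfact_pos[of n] by simp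
      ultimately show ?thesis by linarith
    qed
  qed
  show ?thesis
    by (intro exI[of _ K] conjI K allI ballI order_trans[OF up MK])
qed

end

section \<open>The other families and their growth\<close>

definition maj :: "real fps \<Rightarrow> real fps \<Rightarrow> bool" where
  "maj f g \<longleftrightarrow> (\<forall>n. \<bar>fps_nth f n\<bar> \<le> fps_nth g n)"

lemma maj_add: "maj f g \<Longrightarrow> maj f' g' \<Longrightarrow> maj (f + f') (g + g')"
  and maj_diff: "maj f g \<Longrightarrow> maj f' g' \<Longrightarrow> maj (f - f') (g + g')"
  unfolding maj_def fps_add_nth fps_sub_nth
  by (meson abs_triangle_ineq abs_triangle_ineq4 add_mono order_trans)+

lemma maj_mult:
  assumes "maj f g" "maj f' g'"
  shows "maj (f * f') (g * g')"
  unfolding maj_def fps_mult_nth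
proof
  fix n
  have "\<bar>\<Sum>i=0..n. fps_nth f i * fps_nth f' (n - i)\<bar> \<le> (\<Sum>i=0..n. \<bar>fps_nth f i * fps_nth f' (n - i)\<bar>)" by (rule sum_abs)
  also have "\<dots> \<le> (\<Sum>i=0..n. fps_nth g i * fps_nth g' (n - i))"
    unfolding abs_mult using assms unfolding maj_def by (intro sum_mono mult_mono') auto
  finally show "\<bar>\<Sum>i=0..n. fps_nth f i * fps_nth f' (n - i)\<bar> \<le> (\<Sum>i=0..n. fps_nth g i * fps_nth g' (n - i))" .
qed

lemma maj_numeral: "maj (numeral k) (numeral k)"
  unfolding maj_def by (simp add: numeral_fps_const)

lemma maj_nonneg: "maj f g \<Longrightarrow> fps_nth g n \<ge> 0"
  unfolding maj_def by (rule order_trans[OF abs_ge_zero]) blast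

context gasket begin

lemmas idx = succ_pred_index(1-9)

definition sinX :: "3 \<Rightarrow> real^2 \<Rightarrow> real fps" where
  "sinX l x = (4 + dec) * cosine l x - 2 * (cosine (l + 1) x + cosine (l - 1) x)"

text \<open>The generating series of the monomials \<open>P\<^bsub>j2\<^esub>\<close> and \<open>P\<^bsub>j3\<^esub>\<close>.\<close>

definition sine :: "3 \<Rightarrow> real^2 \<Rightarrow> real fps" where
  "sine l x = fps_shift 1 (fps_const (- 1/2) * invprod * sinX l x)"

definition tang :: "3 \<Rightarrow> real^2 \<Rightarrow> real fps" where
  "tang l x = fps_shift 1 (3 * (cosine (l - 1) x - cosine (l + 1) x))"

lemma sinX_alt: "k \<noteq> l \<Longrightarrow> sinX l x = (4 + dec) * cosine l x - 2 * (cosine k x + cosine (- l - k) x)"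
proof -
  assume "k \<noteq> l"
  then consider "k = l + 1" | "k = l - 1" using succ_pred_index(10)[of l] by blast
  then show ?thesis unfolding sinX_def
    by cases (simp_all only: idx add.commute[of "cosine (l - 1) x"])
qed

lemma dec_quart: "dec = 4 * quart * (5 + 4 * quart)"
  using dec_eq[where ?'a = real] unfolding four_quart[symmetric] .

lemma sinX_F_same:
  assumes "x \<in> SG q"
  shows "sinX l (F q l x) = (3 + dil (1/5) dec) * dil (1/5) (sinX l x)"
proof -
  have d: "dil (1/5) (sinX l x) = (4 + 4 * quart) * dil (1/5) (cosine l x)
      - 2 * (dil (1/5) (cosine (l + 1) x) + dil (1/5) (cosine (l - 1) x))"
    unfolding sinX_def four_quart by (simp only: dil_simps)
  show ?thesis
    unfolding d unfolding sinX_def cosine_F[OF assms] cstep_def four_quart[symmetric]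
    unfolding dec_quart
    by (simp only: idx if_False if_True) (simp add: algebra_simps)
qed

lemma sinX_F_other:
  assumes "x \<in> SG q" "k \<noteq> l"
  shows "sinX l (F q k x) = (3 + dil (1/5) dec) *
    ((8 * quart * quart + 12 * quart + 2) * (dil (1/5) (cosine l x) - dil (1/5) (cosine k x))
      + (8 * quart * quart + 8 * quart) * dil (1/5) (cosine (- l - k) x))"
proof -
  have i: "l \<noteq> k" "- l - k \<noteq> k" "- (- l - k) - k = l"
    using third_index[of l k] assms(2) by auto
  show ?thesis
    unfolding sinX_alt[OF assms(2)] cosine_F[OF assms(1)] cstep_def four_quart[symmetric]
    unfolding dec_quart
    using i by (simp add: algebra_simps)
qed

lemma chain_sine: "chain (sine l)"
proof -
  have "chain (\<lambda>x. sinX l x)"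
  proof -
    have "chain (\<lambda>x. (4 + dec) * cosine l x - 2 * cosine (l + 1) x - 2 * cosine (l - 1) x)"
      by (intro chain_diff chain_mult chain_cosine)
    then show ?thesis unfolding sinX_def by (simp add: algebra_simps)
  qed
  then have "chain (\<lambda>x. fps_const (- 1/2) * invprod * sinX l x)" by (rule chain_mult)
  then show ?thesis unfolding sine_def
    by (rule chain_shift) (simp add: sinX_def fps_mult_nth cosine_0 dec_nth dcoef_0)
qed

lemma chain_tang: "chain (tang l)"
proof -
  have "chain (\<lambda>x. 3 * (cosine (l - 1) x - cosine (l + 1) x))"
    by (intro chain_diff chain_mult chain_cosine)
  then show ?thesis unfolding tang_def by (rule chain_shift) (simp add: fps_mult_nth cosine_0)
qed

lemma cosine_scale: "x \<in> SG q \<Longrightarrow> fps_nth (cosine l (F q l x)) n = 1 / 5 ^ n * fps_nth (cosine l x) n"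
  by (simp add: cosine_F cstep_def dil_nth power_divide)

lemma sine_scale:
  assumes "x \<in> SG q"
  shows "fps_nth (sine l (F q l x)) n = (3/5) / 5 ^ n * fps_nth (sine l x) n"
proof -
  have "fps_const (- 1/2) * invprod * sinX l (F q l x) =
      fps_const (- 1/2) * ((3 + dil (1/5) dec) * invprod) * dil (1/5) (sinX l x)"
    unfolding sinX_F_same[OF assms] by (simp only: mult_ac)
  also have "\<dots> = 3 * dil (1/5) (fps_const (- 1/2) * invprod * sinX l x)"
    unfolding invprod_eq by (simp only: dil_simps mult_ac)
  finally have "fps_nth (fps_const (- 1/2) * invprod * sinX l (F q l x)) (Suc n) =
      3 * ((1/5) ^ Suc n * fps_nth (fps_const (- 1/2) * invprod * sinX l x) (Suc n))"
    by (simp only: numeral_fps_const fps_mult_left_const_nth dil_nth)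
  then show ?thesis unfolding sine_def fps_shift_nth by (simp add: power_divide)
qed

lemma tang_scale:
  assumes "x \<in> SG q"
  shows "fps_nth (tang l (F q l x)) n = (1/5) / 5 ^ n * fps_nth (tang l x) n"
proof -
  have "cosine (l - 1) (F q l x) - cosine (l + 1) (F q l x) = dil (1/5) (cosine (l - 1) x - cosine (l + 1) x)"
    unfolding cosine_F[OF assms] cstep_def
    by (simp only: idx if_False if_True dil_simps) (simp add: algebra_simps)
  then have "3 * (cosine (l - 1) (F q l x) - cosine (l + 1) (F q l x)) = dil (1/5) (3 * (cosine (l - 1) x - cosine (l + 1) x))"
    by (simp only: dil_simps)
  then have "fps_nth (3 * (cosine (l - 1) (F q l x) - cosine (l + 1) (F q l x))) (Suc n) =
      (1/5) ^ Suc n * fps_nth (3 * (cosine (l - 1) x - cosine (l + 1) x)) (Suc n)"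
    by (simp only: dil_nth)
  then show ?thesis unfolding tang_def fps_shift_nth by (simp add: power_divide)
qed

lemma cosine_values: "cosine l (q l) = 1" "cosine l (q (l + 1)) = 1 + fps_const (1/4) * dec"
  "cosine l (q (l - 1)) = 1 + fps_const (1/4) * dec"
  "cosine (l + 1) (q l) = 1 + fps_const (1/4) * dec" "cosine (l - 1) (q l) = 1 + fps_const (1/4) * dec"
  "cosine (l - 1) (q (l + 1)) = 1 + fps_const (1/4) * dec" "cosine (l + 1) (q (l - 1)) = 1 + fps_const (1/4) * dec"
  "cosine (l + 1) (q (l + 1)) = 1" "cosine (l - 1) (q (l - 1)) = 1"
  using succ_pred_index(1-3)[of l] succ_pred_index(1-3)[of l, symmetric] unfolding cosine_vertex cval_def by auto

lemma sine_values: "sine l (q l) = 0" "sine l (q (l + 1)) = sine l (q (l - 1))"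
  "fps_nth (sine l (q (l + 1))) 0 = - 1/2"
proof -
  have "(4::real fps) * (fps_const (1/4) * dec) = dec"
    unfolding numeral_fps_const mult.assoc[symmetric] fps_const_mult by simp
  then have "sinX l (q l) = 0" unfolding sinX_def cosine_values by (simp add: algebra_simps)
  then show "sine l (q l) = 0" unfolding sine_def by simp
  show "sine l (q (l + 1)) = sine l (q (l - 1))"
    unfolding sine_def sinX_def cosine_values by (simp add: add.commute)
  have n2: "fps_nth (numeral k * f) 1 = numeral k * fps_nth f 1" for k and f :: "real fps" by (simp add: numeral_fps_const)
  have "fps_nth (sinX l (q (l + 1))) 1 = 1" "fps_nth (sinX l (q (l + 1))) 0 = 0"
    unfolding sinX_def cosine_values
    by (simp_all add: fps_mult_nth_1 n2 dec_nth dcoef_0 dcoef_1)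
  then show "fps_nth (sine l (q (l + 1))) 0 = - 1/2"
    unfolding sine_def by (simp add: mult.assoc fps_mult_nth_1 invprod_nth invcoef_0)
qed

lemma tang_values: "tang l (q l) = 0" "tang l (q (l - 1)) = - tang l (q (l + 1))"
  "fps_nth (tang l (q (l + 1))) 0 = 1/2"
proof -
  show "tang l (q l) = 0" unfolding tang_def cosine_values by simp
  show "tang l (q (l - 1)) = - tang l (q (l + 1))" unfolding tang_def cosine_values
    by (rule fps_ext) (simp add: numeral_fps_const)
  show "fps_nth (tang l (q (l + 1))) 0 = 1/2" unfolding tang_def cosine_values
    by (simp add: numeral_fps_const dec_nth dcoef_1)
qed

lemma tang_bound:
  assumes K: "\<And>i n x. x \<in> SG q \<Longrightarrow> \<bar>fps_nth (cosine i x) n\<bar> \<le> K * 2 ^ n * recfact n" "K \<ge> 1" and x: "x \<in> SG q"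
  shows "\<bar>fps_nth (tang l x) n\<bar> \<le> 12 * K * 2 ^ n * recfact n"
proof -
  have "\<bar>fps_nth (tang l x) n\<bar> = 3 * \<bar>fps_nth (cosine (l - 1) x) (Suc n) - fps_nth (cosine (l + 1) x) (Suc n)\<bar>"
    by (simp only: tang_def fps_shift_nth numeral_fps_const fps_mult_left_const_nth fps_sub_nth abs_mult
        abs_numeral Suc_eq_plus1)
  also have "\<dots> \<le> 3 * (2 * (K * 2 ^ Suc n * recfact (Suc n)))"
  proof -
    have "\<bar>a - b\<bar> \<le> 2 * t" if "\<bar>a\<bar> \<le> t" "\<bar>b\<bar> \<le> t" for a b t :: real using that by linarith
    from this[OF K(1)[OF x, of "l - 1" "Suc n"] K(1)[OF x, of "l + 1" "Suc n"]] show ?thesis by (rule mult_left_mono) simp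
  qed
  also have "\<dots> \<le> 3 * (2 * (K * 2 ^ Suc n * recfact n))"
    using K(2) by (intro mult_left_mono recfact_decr) auto
  finally show ?thesis by simp
qed

text \<open>The product \<open>invprod\<close> has a pole at \<open>- 5 * decroot\<close>, but on the cells away from \<open>q l\<close> the pole of
  \<open>sine l\<close> cancels and \<open>invprod\<close> enters only with its argument divided by \<open>5\<close>.\<close>

lemma sine_bound:
  "\<exists>B. (\<forall>l n. \<forall>x\<in>SG q. \<bar>fps_nth (sine l x) n\<bar> \<le> B n) \<and>
     fps_conv_radius (Abs_fps B) \<ge> ereal (25 * decroot) \<and> (\<forall>n. B n \<ge> 0)"
proof -
  obtain K where K: "K \<ge> 1" "\<And>i n x. x \<in> SG q \<Longrightarrow> \<bar>fps_nth (cosine i x) n\<bar> \<le> K * 2 ^ n * recfact n"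
    using cosine_bound by blast
  define Bc where "Bc = Abs_fps (\<lambda>n. K * 2 ^ n * recfact n)"
  define e :: "real fps" where "e = fps_const (1/4) * dec"
  define I where "I = Abs_fps (\<lambda>n. \<bar>invcoef n\<bar>)"
  define zB where "zB = (8 * e * e + 12 * e + 2) * (Bc + Bc) + (8 * e * e + 8 * e) * Bc"
  define B where "B n = 3/2 * ((1/5) ^ Suc n * fps_nth (I * zB) (Suc n))" for n
  define Z where "Z l k x = (8 * e * e + 12 * e + 2) * (cosine l x - cosine k x) + (8 * e * e + 8 * e) * cosine (- l - k) x"
    for l k x
  have mc: "maj (cosine i x) Bc" if "x \<in> SG q" for i x unfolding maj_def Bc_def using K(2)[OF that] by simp
  have me: "maj e e" unfolding maj_def e_def using dcoef_bound by (simp add: dec_nth)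
  have mI: "maj invprod I" unfolding maj_def I_def by (simp add: invprod_nth)
  have mZ: "maj (invprod * Z l k x) (I * zB)" if "x \<in> SG q" for l k x
    unfolding Z_def zB_def by (intro maj_mult maj_add maj_diff mc that me mI maj_numeral)
  have B0: "B n \<ge> 0" for n unfolding B_def using maj_nonneg[OF mZ[OF vertex_SG]] by simp
  have ot: "\<bar>fps_nth (sine l (F q k x)) n\<bar> \<le> B n" if x: "x \<in> SG q" and kl: "k \<noteq> l" for l k x n
  proof -
    have de: "dil (1/5) e = quart" unfolding e_def quart_def by (simp only: dil_simps)
    have "sinX l (F q k x) = (3 + dil (1/5) dec) * dil (1/5) (Z l k x)"
      unfolding sinX_F_other[OF x kl] Z_def by (simp only: dil_simps de)
    then have "fps_const (- 1/2) * invprod * sinX l (F q k x) =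
        fps_const (- 1/2) * (((3 + dil (1/5) dec) * invprod) * dil (1/5) (Z l k x))" by (simp only: mult_ac)
    also have "\<dots> = fps_const (- 1/2) * (3 * dil (1/5) (invprod * Z l k x))"
      unfolding invprod_eq by (simp only: dil_simps mult_ac)
    finally have "fps_nth (sine l (F q k x)) n = - 1/2 * (3 * ((1/5) ^ Suc n * fps_nth (invprod * Z l k x) (Suc n)))"
      unfolding sine_def fps_shift_nth by (simp only: numeral_fps_const fps_mult_left_const_nth dil_nth Suc_eq_plus1)
    then have "\<bar>fps_nth (sine l (F q k x)) n\<bar> = 3/2 * ((1/5) ^ Suc n * \<bar>fps_nth (invprod * Z l k x) (Suc n)\<bar>)"
      by (simp add: abs_mult)
    also have "\<dots> \<le> B n" unfolding B_def
      using mZ[OF x, of l k] unfolding maj_def by (intro mult_left_mono) auto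
    finally show ?thesis .
  qed
  have bd: "\<bar>fps_nth (sine l x) n\<bar> \<le> B n" if "x \<in> SG q" for l n x
  proof -
    define f where "f y = \<bar>fps_nth (sine l y) n\<bar>" for y
    have cf: "continuous_on (SG q) f"
      unfolding f_def by (rule continuous_on_rabs[OF chain_continuous[OF chain_sine]])
    have ne: "SG q \<noteq> {}" using vertex_SG[of 0] by blast
    have "\<exists>y\<in>SG q. \<forall>z\<in>SG q. f z \<le> f y" by (rule continuous_attains_sup[OF SG_compact ne cf])
    then obtain y where y: "y \<in> SG q" "\<And>z. z \<in> SG q \<Longrightarrow> f z \<le> f y" by blast
    obtain k z where z: "z \<in> SG q" "y = F q k z" by (rule SG_cases[OF y(1)])
    have "f y \<le> B n"
    proof (cases "k = l")
      case True
      have "f y = (3/5) / 5 ^ n * f z" unfolding f_def z(2) True sine_scale[OF z(1)] by (simp add: abs_mult)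
      also have "\<dots> \<le> (3/5) * f y"
        using y(2)[OF z(1)] by (intro mult_mono) (auto simp: f_def field_simps)
      finally have "f y \<le> 0" by simp
      then show ?thesis using B0[of n] by linarith
    next
      case False
      then show ?thesis using ot[OF z(1) False] unfolding f_def z(2) by simp
    qed
    then show ?thesis using y(2)[OF that] unfolding f_def by linarith
  qed
  have "entire_fps Bc"
  proof (rule entire_of_bound)
    fix n
    have "K * 2 ^ n * recfact n \<le> K * 2 ^ n * (1 / fact n)"
      using K(1) by (intro mult_left_mono recfact_le) auto
    then show "norm (fps_nth Bc n) \<le> K * 2 ^ n / fact n"
      unfolding Bc_def using K(1) recfact_pos[of n] by simp
  qed
  moreover have "entire_fps e" unfolding e_def by (intro entire_mult entire_dec) simp
  ultimately have "entire_fps zB" unfolding zB_def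
    by (intro entire_add entire_mult fps_conv_radius_numeral)
  then have "ereal (5 * decroot) \<le> min (fps_conv_radius I) (fps_conv_radius zB)"
    using invprod_radius unfolding I_def[symmetric] by simp
  then have "fps_conv_radius (I * zB) \<ge> ereal (5 * decroot)"
    using fps_conv_radius_mult[of I zB] by (rule order_trans)
  then have "fps_conv_radius (dil (1/5) (I * zB)) \<ge> ereal (5 * (5 * decroot))" by (rule radius_dil_fifth)
  moreover have "Abs_fps B = fps_const (3/2) * fps_shift 1 (dil (1/5) (I * zB))"
    by (rule fps_ext) (simp add: B_def dil_nth)
  ultimately have "fps_conv_radius (Abs_fps B) \<ge> ereal (25 * decroot)" by (simp add: fps_conv_radius_cmult_left)
  then show ?thesis using bd B0 by (intro exI[of _ B] conjI allI ballI)
qed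

end

definition admissible :: "(nat \<Rightarrow> real) \<Rightarrow> (nat \<Rightarrow> 'a::real_normed_vector) \<Rightarrow> bool" where
  "admissible B c \<longleftrightarrow> (\<forall>N. summable (\<lambda>n. norm (c (n + N)) * B n) \<and> summable (\<lambda>n. norm (c (n + N)) * wconv B n))"

lemma wconv_fps: "wconv B n = fps_nth (dec * Abs_fps B) n"
  unfolding wconv_def fps_mult_nth by (simp add: dec_nth)

lemma wconv_nonneg: "(\<And>n. B n \<ge> 0) \<Longrightarrow> wconv B n \<ge> 0"
  unfolding wconv_def using dcoef_bound by (intro sum_nonneg mult_nonneg_nonneg) auto

lemma bigo_shift: "f \<in> O(g) \<Longrightarrow> (\<lambda>n. f (n + N)) \<in> O(\<lambda>n. g (n + N :: nat))"
  by (rule landau_o.big.compose) (auto intro: filterlim_add_const_nat_at_top)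

lemma summable_bigo_mult:
  fixes b f g :: "nat \<Rightarrow> real"
  assumes "f \<in> O(g)" "summable (\<lambda>n. \<bar>g n * b n\<bar>)"
  shows "summable (\<lambda>n. f n * b n)"
  by (rule summable_comparison_test_bigo[where g = "\<lambda>n. g n * b n"])
     (use assms(2) landau_o.big.mult[OF assms(1) landau_o.big_refl] in simp_all)

lemma admissible_geometric:
  fixes c :: "nat \<Rightarrow> 'a::real_normed_vector"
  assumes "(\<lambda>n. norm (c n)) \<in> O(\<lambda>n. R ^ n)" "0 \<le> R" "ereal R < fps_conv_radius (Abs_fps B)"
  shows "admissible B c"
  unfolding admissible_def
proof (intro allI conjI)
  have gen: "summable (\<lambda>n. norm (c (n + N)) * b n)" if b: "ereal R < fps_conv_radius (Abs_fps b)" for b N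
  proof (rule summable_bigo_mult)
    show "(\<lambda>n. norm (c (n + N))) \<in> O(\<lambda>n. R ^ (n + N))" by (rule bigo_shift[OF assms(1)])
    have "summable (\<lambda>n. norm (fps_nth (Abs_fps b) n * R ^ n))"
      by (rule norm_summable_fps) (use b assms(2) in simp)
    then have "summable (\<lambda>n. R ^ N * norm (fps_nth (Abs_fps b) n * R ^ n))" by (rule summable_mult)
    moreover have "R ^ N * norm (fps_nth (Abs_fps b) n * R ^ n) = \<bar>R ^ (n + N) * b n\<bar>" for n
      using assms(2) by (simp add: abs_mult power_add)
    ultimately show "summable (\<lambda>n. \<bar>R ^ (n + N) * b n\<bar>)" by (simp only:)
  qed
  fix N
  show "summable (\<lambda>n. norm (c (n + N)) * B n)" by (rule gen[OF assms(3)])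
  have "fps_conv_radius (Abs_fps B) \<le> fps_conv_radius (dec * Abs_fps B)"
    using fps_conv_radius_mult[of dec "Abs_fps B"] by (simp add: entire_dec)
  moreover have "Abs_fps (wconv B) = dec * Abs_fps B" by (rule fps_ext) (simp add: wconv_fps)
  ultimately have "ereal R < fps_conv_radius (Abs_fps (wconv B))" using assms(3) by simp
  then show "summable (\<lambda>n. norm (c (n + N)) * wconv B n)" by (rule gen)
qed

lemma summable_fact_powr:
  assumes "x > 0" "\<delta> < 0"
  shows "summable (\<lambda>n. x ^ n * fact n powr \<delta> :: real)"
proof -
  have "(\<lambda>n. real (Suc n) powr \<delta>) \<longlonglongrightarrow> 0"
    by (rule tendsto_neg_powr[OF assms(2)]) (rule filterlim_compose[OF filterlim_real_sequentially filterlim_Suc])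
  then have "\<forall>\<^sub>F n in sequentially. real (Suc n) powr \<delta> < 1 / (2 * x)"
    using assms(1) by (intro order_tendstoD(2)) auto
  then obtain N where N: "\<And>n. n \<ge> N \<Longrightarrow> real (Suc n) powr \<delta> < 1 / (2 * x)"
    unfolding eventually_sequentially by blast
  show ?thesis
  proof (rule summable_ratio_test[of "1/2" N])
    fix n assume "n \<ge> N"
    then have "x * real (Suc n) powr \<delta> \<le> 1/2" using N[of n] assms(1) by (simp add: field_simps)
    then have "x * real (Suc n) powr \<delta> * (x ^ n * fact n powr \<delta>) \<le> 1/2 * (x ^ n * fact n powr \<delta>)"
      using assms(1) by (intro mult_right_mono) auto
    moreover have "(fact (Suc n) :: real) powr \<delta> = real (Suc n) powr \<delta> * fact n powr \<delta>"
      unfolding fact_Suc by (rule powr_mult) 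
    ultimately show "norm (x ^ Suc n * fact (Suc n) powr \<delta>) \<le> 1/2 * norm (x ^ n * fact n powr \<delta>)"
      using assms(1) by (simp add: abs_mult mult_ac)
  qed simp
qed

lemma recfact_shift: "recfact n \<le> 5 ^ (n + N) / recfact N * recfact (n + N)"
proof -
  have "recfact N * recfact n = recfact (n + N) * real ((n + N) choose N) powr log 2 5"
    using recfact_binomial[of N "n + N"] by simp
  also have "\<dots> \<le> recfact (n + N) * (2 powr real (n + N)) powr log 2 5"
  proof (intro mult_left_mono powr_mono2)
    have "(n + N) choose N \<le> 2 ^ (n + N)" by (rule binomial_le_pow2)
    then have "real ((n + N) choose N) \<le> real (2 ^ (n + N))" by (simp only: of_nat_le_iff)
    also have "\<dots> = 2 powr real (n + N)" using powr_realpow[of 2 "n + N"] by simp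
    finally show "real ((n + N) choose N) \<le> 2 powr real (n + N)" .
  qed (use recfact_pos[of "n + N"] log25 in auto)
  also have "(2 powr real (n + N)) powr log 2 5 = (2 powr log 2 5) powr real (n + N)"
    unfolding powr_powr by (simp only: mult.commute)
  also have "\<dots> = 5 ^ (n + N)" using powr_realpow[of 5 "n + N"] by simp
  finally show ?thesis using recfact_pos[of N] by (simp add: field_simps)
qed

lemma admissible_factorial:
  fixes c :: "nat \<Rightarrow> 'a::real_normed_vector"
  assumes "(\<lambda>n. norm (c n)) \<in> O(\<lambda>n. fact n powr r)" "r < ln 5 / ln 2" "K \<ge> 0"
  shows "admissible (\<lambda>n. K * 2 ^ n * recfact n) c"
  unfolding admissible_def
proof (intro allI conjI)
  fix N
  have *: "summable (\<lambda>n. norm (c (n + N)) * (10 ^ n * recfact n))"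
  proof (rule summable_bigo_mult)
    show "(\<lambda>n. norm (c (n + N))) \<in> O(\<lambda>n. fact (n + N) powr r)" by (rule bigo_shift[OF assms(1)])
    have lg: "log 2 5 = ln 5 / ln (2::real)" by (simp add: log_def)
    have "summable (\<lambda>n. 50 ^ n * fact n powr (r - log 2 5) :: real)"
      by (rule summable_fact_powr) (use assms(2) lg in auto)
    then have "summable (\<lambda>n. 50 ^ (n + N) * fact (n + N) powr (r - log 2 5) :: real)"
      by (rule summable_ignore_initial_segment)
    then have "summable (\<lambda>n. 1 / recfact N * (50 ^ (n + N) * fact (n + N) powr (r - log 2 5)))"
      by (rule summable_mult)
    then show "summable (\<lambda>n. \<bar>fact (n + N) powr r * (10 ^ n * recfact n)\<bar>)"
    proof (rule summable_comparison_test'[where N = 0])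
      fix n
      have "(10::real) ^ n * recfact n \<le> 10 ^ (n + N) * (5 ^ (n + N) / recfact N * recfact (n + N))"
        using recfact_pos[of n] by (intro mult_mono power_increasing recfact_shift) auto
      then have "fact (n + N) powr r * (10 ^ n * recfact n) \<le>
          fact (n + N) powr r * (10 ^ (n + N) * (5 ^ (n + N) / recfact N * recfact (n + N)))"
        by (rule mult_left_mono) simp
      also have "\<dots> = 1 / recfact N * (((10 * 5) ^ (n + N)) * (fact (n + N) powr r * recfact (n + N)))"
        by (simp only: power_mult_distrib) simp
      also have "fact (n + N) powr r * recfact (n + N) = fact (n + N) powr (r - log 2 5)"
        unfolding recfact_def by (simp add: powr_add[symmetric])
      finally show "norm \<bar>fact (n + N) powr r * (10 ^ n * recfact n)\<bar> \<le>
          1 / recfact N * (50 ^ (n + N) * fact (n + N) powr (r - log 2 5))"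
        using recfact_pos[of n] by (simp add: abs_mult)
    qed
  qed
  have gen: "summable (\<lambda>n. norm (c (n + N)) * b n)"
    if b: "\<And>n. 0 \<le> b n" "\<And>n. b n \<le> K * (10 ^ n * recfact n)" for b
  proof (rule summable_comparison_test'[OF summable_mult[OF *, of K], of 0])
    fix n
    have "norm (c (n + N)) * b n \<le> norm (c (n + N)) * (K * (10 ^ n * recfact n))" by (rule mult_left_mono[OF b(2)]) simp
    then show "norm (norm (c (n + N)) * b n) \<le> K * (norm (c (n + N)) * (10 ^ n * recfact n))"
      using b(1)[of n] by (simp add: abs_mult mult_ac)
  qed
  have b0: "0 \<le> K * 2 ^ n * recfact n" for n using assms(3) recfact_pos[of n] by simp
  show "summable (\<lambda>n. norm (c (n + N)) * (K * 2 ^ n * recfact n))"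
  proof (rule gen[OF b0])
    fix n
    have "(2::real) ^ n \<le> 10 ^ n" by (rule power_mono) auto
    then show "K * 2 ^ n * recfact n \<le> K * (10 ^ n * recfact n)"
      using assms(3) recfact_pos[of n] by (simp only: mult.assoc) (intro mult_left_mono mult_right_mono, auto)
  qed
  show "summable (\<lambda>n. norm (c (n + N)) * wconv (\<lambda>n. K * 2 ^ n * recfact n) n)"
  proof (rule gen[OF wconv_nonneg[OF b0]])
    fix n
    have "wconv (\<lambda>n. K * 2 ^ n * recfact n) n \<le> (\<Sum>i=0..n. recfact i * (K * 2 ^ n * recfact (n - i)))"
      unfolding wconv_def
    proof (intro sum_mono mult_mono mult_right_mono mult_left_mono)
      fix i assume "i \<in> {0..n}"
      show "dcoef i \<le> recfact i" using dcoef_bound[of i] recfact_pos[of i] by linarith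
      show "(2::real) ^ (n - i) \<le> 2 ^ n" by (rule power_increasing) auto
    qed (use assms(3) recfact_pos b0 in \<open>auto intro: less_imp_le\<close>)
    also have "\<dots> = K * 2 ^ n * (\<Sum>i\<le>n. recfact i * recfact (n - i))"
      by (simp add: sum_distrib_left mult_ac atLeast0AtMost)
    also have "\<dots> \<le> K * 2 ^ n * (5 ^ n * recfact n)"
      using assms(3) by (intro mult_left_mono recfact_conv) auto
    also have "\<dots> = K * ((2 * 5) ^ n * recfact n)" by (simp only: power_mult_distrib mult_ac)
    finally show "wconv (\<lambda>n. K * 2 ^ n * recfact n) n \<le> K * (10 ^ n * recfact n)" by simp
  qed
qed

section \<open>The Laplacian and the maximum principle\<close>

context gasket begin

lemma has_laplacian_dlap:
  "has_laplacian q u f \<longleftrightarrow> continuous_on (SG q) u \<and> continuous_on (SG q) f \<and>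
     (\<forall>\<epsilon>>0. \<exists>M. \<forall>m\<ge>M. \<forall>x \<in> V q m - V q 0. dist ((3/2 * 5 ^ m) *\<^sub>R dlap m u x) (f x) < \<epsilon>)"
  unfolding has_laplacian_def dlap_def ..

lemma has_laplacian_continuous: "has_laplacian q u f \<Longrightarrow> continuous_on (SG q) u" "has_laplacian q u f \<Longrightarrow> continuous_on (SG q) f"
  unfolding has_laplacian_def by blast+

lemma has_laplacian_tendsto:
  assumes "has_laplacian q u f" "x \<in> V q n - V q 0"
  shows "(\<lambda>m. (3/2 * 5 ^ m) *\<^sub>R dlap m u x) \<longlonglongrightarrow> f x"
proof (rule metric_LIMSEQ_I)
  fix e :: real assume "e > 0"
  then obtain M where M: "\<forall>m\<ge>M. \<forall>x \<in> V q m - V q 0. dist ((3/2 * 5 ^ m) *\<^sub>R dlap m u x) (f x) < e"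
    using assms(1) unfolding has_laplacian_dlap by blast
  have "x \<in> V q m - V q 0" if "m \<ge> max M n" for m
    using V_mono'[of n m] that assms(2) by auto
  then show "\<exists>M. \<forall>m\<ge>M. dist ((3/2 * 5 ^ m) *\<^sub>R dlap m u x) (f x) < e"
    using M by (intro exI[of _ "max M n"]) auto
qed

lemma SG_closure: "SG q = closure (Vstar - V q 0)"
proof
  show "closure (Vstar - V q 0) \<subseteq> SG q" unfolding SG_eq by (rule closure_mono) blast
qed (rule Vstar_dense)

lemma SG_continuous_eqI:
  fixes f g :: "real^2 \<Rightarrow> 'b::real_normed_vector"
  assumes "continuous_on (SG q) f" "continuous_on (SG q) g" "\<And>m x. x \<in> V q m - V q 0 \<Longrightarrow> f x = g x" "x \<in> SG q"
  shows "f x = g x"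
proof -
  have "f x - g x = 0"
  proof (rule continuous_constant_on_closure[where S = "Vstar - V q 0"])
    show "continuous_on (closure (Vstar - V q 0)) (\<lambda>x. f x - g x)"
      unfolding SG_closure[symmetric] by (intro continuous_on_diff assms)
    show "f x - g x = 0" if "x \<in> Vstar - V q 0" for x
      using that assms(3) unfolding Vstar_def by auto
    show "x \<in> closure (Vstar - V q 0)" using assms(4) unfolding SG_closure[symmetric] .
  qed
  then show ?thesis by simp
qed

lemma has_laplacian_unique:
  assumes "has_laplacian q u f" "has_laplacian q u g" "x \<in> SG q"
  shows "f x = g x"
proof (rule SG_continuous_eqI[OF _ _ _ assms(3)])
  show "continuous_on (SG q) f" "continuous_on (SG q) g" using assms has_laplacian_continuous by blast+
  show "f y = g y" if "y \<in> V q m - V q 0" for m y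
    by (rule LIMSEQ_unique[OF has_laplacian_tendsto[OF assms(1) that] has_laplacian_tendsto[OF assms(2) that]])
qed

lemma has_laplacian_cong:
  assumes "has_laplacian q u f" "\<And>x. x \<in> SG q \<Longrightarrow> u x = u' x" "\<And>x. x \<in> SG q \<Longrightarrow> f x = f' x"
  shows "has_laplacian q u' f'"
proof -
  have c: "continuous_on (SG q) u'" "continuous_on (SG q) f'"
    using has_laplacian_continuous[OF assms(1)] assms(2,3) by (auto cong: continuous_on_cong)
  have e: "dlap m u x = dlap m u' x" "f x = f' x" if "x \<in> V q m - V q 0" for m x
  proof -
    have "x \<in> SG q" using that V_SG by blast
    then show "dlap m u x = dlap m u' x" "f x = f' x" using dlap_cong assms(2,3) by blast+
  qed
  show ?thesis unfolding has_laplacian_dlap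
  proof (intro conjI allI impI c)
    fix \<epsilon> :: real assume "\<epsilon> > 0"
    then obtain M where M: "\<forall>m\<ge>M. \<forall>x \<in> V q m - V q 0. dist ((3/2 * 5 ^ m) *\<^sub>R dlap m u x) (f x) < \<epsilon>"
      using assms(1) unfolding has_laplacian_dlap by blast
    show "\<exists>M. \<forall>m\<ge>M. \<forall>x \<in> V q m - V q 0. dist ((3/2 * 5 ^ m) *\<^sub>R dlap m u' x) (f' x) < \<epsilon>"
    proof (intro exI allI impI ballI)
      fix m x assume "m \<ge> M" and x: "x \<in> V q m - V q 0"
      then show "dist ((3/2 * 5 ^ m) *\<^sub>R dlap m u' x) (f' x) < \<epsilon>"
        unfolding e[OF x, symmetric] using M by blast
    qed
  qed
qed

lemma laplacian_eq:
  assumes "has_laplacian q u f"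
  shows "laplacian q u = (\<lambda>x. if x \<in> SG q then f x else 0)"
  unfolding laplacian_def
proof (rule the_equality)
  show "has_laplacian q u (\<lambda>x. if x \<in> SG q then f x else 0) \<and> (\<forall>x. x \<notin> SG q \<longrightarrow> (if x \<in> SG q then f x else 0) = 0)"
    using has_laplacian_cong[OF assms, of u "\<lambda>x. if x \<in> SG q then f x else 0"] by simp
  fix g assume g: "has_laplacian q u g \<and> (\<forall>x. x \<notin> SG q \<longrightarrow> g x = 0)"
  then show "g = (\<lambda>x. if x \<in> SG q then f x else 0)"
    using has_laplacian_unique[OF assms conjunct1[OF g]] by auto
qed

lemma has_laplacian_laplacian:
  assumes "\<exists>f. has_laplacian q u f"
  shows "has_laplacian q u (laplacian q u)" "x \<notin> SG q \<Longrightarrow> laplacian q u x = 0"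
proof -
  obtain f where f: "has_laplacian q u f" using assms by blast
  show "has_laplacian q u (laplacian q u)"
    unfolding laplacian_eq[OF f] by (rule has_laplacian_cong[OF f]) auto
  show "x \<notin> SG q \<Longrightarrow> laplacian q u x = 0" unfolding laplacian_eq[OF f] by simp
qed

lemma dlap_add: "dlap m (\<lambda>x. u x + v x) x = dlap m u x + dlap m v x"
  unfolding dlap_def sum.distrib[symmetric] by (rule sum.cong) auto

lemma dlap_scaleR:
  fixes u :: "real^2 \<Rightarrow> 'b::real_normed_vector"
  shows "dlap m (\<lambda>x. c *\<^sub>R u x) x = c *\<^sub>R dlap m u x"
  unfolding dlap_def by (simp only: scaleR_right.sum scaleR_diff_right)

lemma dist_scaleR_both: "dist (c *\<^sub>R x) (c *\<^sub>R y) = \<bar>c\<bar> * dist x (y :: 'b::real_normed_vector)"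
  unfolding dist_norm scaleR_diff_right[symmetric] by simp

lemma has_laplacian_add:
  assumes u: "has_laplacian q u f" and v: "has_laplacian q v g"
  shows "has_laplacian q (\<lambda>x. u x + v x) (\<lambda>x. f x + g x)"
  unfolding has_laplacian_dlap
proof (intro conjI allI impI)
  show "continuous_on (SG q) (\<lambda>x. u x + v x)" "continuous_on (SG q) (\<lambda>x. f x + g x)"
    by (rule continuous_on_add[OF has_laplacian_continuous(1)[OF u] has_laplacian_continuous(1)[OF v]],
        rule continuous_on_add[OF has_laplacian_continuous(2)[OF u] has_laplacian_continuous(2)[OF v]])
  fix e :: real assume "e > 0"
  then have "e / 2 > 0" by simp
  then obtain M N where M: "\<forall>m\<ge>M. \<forall>x \<in> V q m - V q 0. dist ((3/2 * 5 ^ m) *\<^sub>R dlap m u x) (f x) < e/2"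
    and N: "\<forall>m\<ge>N. \<forall>x \<in> V q m - V q 0. dist ((3/2 * 5 ^ m) *\<^sub>R dlap m v x) (g x) < e/2"
    using u v unfolding has_laplacian_dlap by meson
  have "dist ((3/2 * 5 ^ m) *\<^sub>R dlap m (\<lambda>x. u x + v x) x) (f x + g x) < e"
    if "m \<ge> max M N" "x \<in> V q m - V q 0" for m x
  proof -
    have "dist ((3/2 * 5 ^ m) *\<^sub>R dlap m u x) (f x) < e/2" "dist ((3/2 * 5 ^ m) *\<^sub>R dlap m v x) (g x) < e/2"
      using M N that by simp_all
    then show ?thesis unfolding dlap_add scaleR_add_right
      using dist_triangle_add[of "(3/2 * 5 ^ m) *\<^sub>R dlap m u x" "(3/2 * 5 ^ m) *\<^sub>R dlap m v x" "f x" "g x"] by linarith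
  qed
  then show "\<exists>M. \<forall>m\<ge>M. \<forall>x \<in> V q m - V q 0. dist ((3/2 * 5 ^ m) *\<^sub>R dlap m (\<lambda>x. u x + v x) x) (f x + g x) < e"
    by blast
qed

lemma has_laplacian_scaleR:
  assumes u: "has_laplacian q u f"
  shows "has_laplacian q (\<lambda>x. c *\<^sub>R u x) (\<lambda>x. c *\<^sub>R f x)"
  unfolding has_laplacian_dlap
proof (intro conjI allI impI)
  show "continuous_on (SG q) (\<lambda>x. c *\<^sub>R u x)" "continuous_on (SG q) (\<lambda>x. c *\<^sub>R f x)"
    by (rule continuous_on_scaleR[OF continuous_on_const has_laplacian_continuous(1)[OF u]],
        rule continuous_on_scaleR[OF continuous_on_const has_laplacian_continuous(2)[OF u]])
  fix e :: real assume e: "e > 0"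
  then have "e / (\<bar>c\<bar> + 1) > 0" by simp
  then obtain M where M: "\<forall>m\<ge>M. \<forall>x \<in> V q m - V q 0. dist ((3/2 * 5 ^ m) *\<^sub>R dlap m u x) (f x) < e / (\<bar>c\<bar> + 1)"
    using u unfolding has_laplacian_dlap by blast
  have "dist ((3/2 * 5 ^ m) *\<^sub>R dlap m (\<lambda>x. c *\<^sub>R u x) x) (c *\<^sub>R f x) < e"
    if "m \<ge> M" "x \<in> V q m - V q 0" for m x
  proof -
    have "dist ((3/2 * 5 ^ m) *\<^sub>R dlap m (\<lambda>x. c *\<^sub>R u x) x) (c *\<^sub>R f x) = \<bar>c\<bar> * dist ((3/2 * 5 ^ m) *\<^sub>R dlap m u x) (f x)"
      unfolding dlap_scaleR scaleR_left_commute[of _ c] dist_scaleR_both ..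
    also have "\<dots> \<le> \<bar>c\<bar> * (e / (\<bar>c\<bar> + 1))" using M that by (intro mult_left_mono) (auto intro: less_imp_le)
    also have "\<dots> < e" using e by (simp add: field_simps)
    finally show ?thesis .
  qed
  then show "\<exists>M. \<forall>m\<ge>M. \<forall>x \<in> V q m - V q 0. dist ((3/2 * 5 ^ m) *\<^sub>R dlap m (\<lambda>x. c *\<^sub>R u x) x) (c *\<^sub>R f x) < e"
    by blast
qed

lemma has_laplacian_diff:
  assumes "has_laplacian q u f" "has_laplacian q v g"
  shows "has_laplacian q (\<lambda>x. u x - v x) (\<lambda>x. f x - g x)"
  using has_laplacian_add[OF assms(1) has_laplacian_scaleR[OF assms(2), of "-1"]] by simp

lemma has_laplacian_cell:
  assumes u: "has_laplacian q u f"
  shows "has_laplacian q (\<lambda>x. u (F q k x)) (\<lambda>x. (1/5) *\<^sub>R f (F q k x))"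
  unfolding has_laplacian_dlap
proof (intro conjI allI impI)
  have im: "F q k ` SG q \<subseteq> SG q" using F_SG by blast
  show "continuous_on (SG q) (\<lambda>x. u (F q k x))"
    by (rule continuous_on_compose2[OF has_laplacian_continuous(1)[OF u] continuous_on_F im])
  show "continuous_on (SG q) (\<lambda>x. (1/5) *\<^sub>R f (F q k x))"
    by (rule continuous_on_scaleR[OF continuous_on_const continuous_on_compose2[OF has_laplacian_continuous(2)[OF u] continuous_on_F im]])
  fix e :: real assume e: "e > 0"
  then obtain M where M: "\<forall>m\<ge>M. \<forall>x \<in> V q m - V q 0. dist ((3/2 * 5 ^ m) *\<^sub>R dlap m u x) (f x) < e"
    using u unfolding has_laplacian_dlap by blast
  have "dist ((3/2 * 5 ^ m) *\<^sub>R dlap m (\<lambda>x. u (F q k x)) x) ((1/5) *\<^sub>R f (F q k x)) < e"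
    if m: "m \<ge> M" and x: "x \<in> V q m - V q 0" for m x
  proof -
    have xS: "x \<in> SG q" "x \<notin> V q 0" using x V_SG by blast+
    have "F q k x \<in> V q (Suc m)" using x by auto
    moreover have "F q k x \<notin> V q 0"
    proof
      assume "F q k x \<in> V q 0"
      then obtain i where "F q k x = q i" by auto
      then have "x = q i" by (rule F_eq_vertex(2)[OF xS(1)])
      then show False using xS(2) by auto
    qed
    ultimately have b: "dist ((3/2 * 5 ^ Suc m) *\<^sub>R dlap (Suc m) u (F q k x)) (f (F q k x)) < e"
      using M[rule_format, OF le_SucI[OF m], of "F q k x"] by blast
    have "(3/2 * 5 ^ m) *\<^sub>R dlap m (\<lambda>x. u (F q k x)) x = (1/5) *\<^sub>R ((3/2 * 5 ^ Suc m) *\<^sub>R dlap (Suc m) u (F q k x))"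
      unfolding dlap_interior[OF xS] scaleR_scaleR by (rule arg_cong2[where f = scaleR]) simp_all
    then have "dist ((3/2 * 5 ^ m) *\<^sub>R dlap m (\<lambda>x. u (F q k x)) x) ((1/5) *\<^sub>R f (F q k x)) =
        1/5 * dist ((3/2 * 5 ^ Suc m) *\<^sub>R dlap (Suc m) u (F q k x)) (f (F q k x))"
      by (simp only: dist_scaleR_both)
    then show ?thesis using b e by linarith
  qed
  then show "\<exists>M. \<forall>m\<ge>M. \<forall>x \<in> V q m - V q 0. dist ((3/2 * 5 ^ m) *\<^sub>R dlap m (\<lambda>x. u (F q k x)) x) ((1/5) *\<^sub>R f (F q k x)) < e"
    by blast
qed

lemma chain_bounded:
  assumes "chain G"
  shows "\<exists>B. \<forall>n. \<forall>x\<in>SG q. \<bar>fps_nth (G x) n\<bar> \<le> B n"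
proof -
  have "\<exists>b. \<forall>x\<in>SG q. \<bar>fps_nth (G x) n\<bar> \<le> b" for n
  proof -
    have "bounded ((\<lambda>x. fps_nth (G x) n) ` SG q)"
      by (intro compact_imp_bounded compact_continuous_image SG_compact chain_continuous[OF assms])
    then show ?thesis by (auto simp: bounded_iff)
  qed
  then have "\<forall>n. \<exists>b. \<forall>x\<in>SG q. \<bar>fps_nth (G x) n\<bar> \<le> b" by (rule allI)
  from choice[OF this] show ?thesis .
qed

lemma chain_coeff_laplacian:
  assumes G: "chain G"
  shows "has_laplacian q (\<lambda>x. fps_nth (G x) 0) (\<lambda>x. 0)"
    and "has_laplacian q (\<lambda>x. fps_nth (G x) (Suc n)) (\<lambda>x. fps_nth (G x) n)"
proof -
  obtain B where B: "\<forall>n. \<forall>x\<in>SG q. \<bar>fps_nth (G x) n\<bar> \<le> B n" using chain_bounded[OF G] by blast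
  define c where "c N n = (if n = N then 1 else 0 :: real)" for N n :: nat
  have sm: "summable (\<lambda>n. norm (c N n) * b n)" for N b
    by (rule summable_finite[of "{N}"]) (auto simp: c_def)
  have h: "has_laplacian q (\<lambda>x. \<Sum>n. c N n * of_real (fps_nth (G x) n)) (\<lambda>x. \<Sum>n. c N (Suc n) * of_real (fps_nth (G x) n))" for N
    by (rule chain_has_laplacian[OF G _ sm sm]) (use B in blast)
  have e: "(\<Sum>n. c N n * of_real (fps_nth (G x) n)) = fps_nth (G x) N" for N x
    by (subst suminf_finite[of "{N}"]) (auto simp: c_def)
  have e0: "(\<Sum>n. c 0 (Suc n) * of_real (fps_nth (G x) n)) = 0" for x
    by (simp add: c_def)
  have eS: "(\<Sum>n. c (Suc N) (Suc n) * of_real (fps_nth (G x) n)) = fps_nth (G x) N" for N x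
    by (subst suminf_finite[of "{N}"]) (auto simp: c_def)
  show "has_laplacian q (\<lambda>x. fps_nth (G x) 0) (\<lambda>x. 0)" using h[of 0] unfolding e e0 .
  show "has_laplacian q (\<lambda>x. fps_nth (G x) (Suc n)) (\<lambda>x. fps_nth (G x) n)" using h[of "Suc n"] unfolding e eS .
qed

lemma discrete_maximum:
  fixes v :: "real^2 \<Rightarrow> real"
  assumes "\<And>x. x \<in> V q m - V q 0 \<Longrightarrow> dlap m v x > 0" "x \<in> V q m"
  shows "\<exists>i. v x \<le> v (q i)"
proof -
  obtain y where y: "y \<in> V q m" "\<And>z. z \<in> V q m \<Longrightarrow> v z \<le> v y"
  proof -
    have f: "finite (v ` V q m)" "v ` V q m \<noteq> {}" using finite_V assms(2) by auto
    obtain y where "y \<in> V q m" "v y = Max (v ` V q m)" using Max_in[OF f] by auto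
    then show ?thesis using that[of y] Max_ge[OF f(1)] by auto
  qed
  have "dlap m v y \<le> 0"
    unfolding dlap_def using y neighbours_subset by (intro sum_nonpos) auto
  then have "y \<in> V q 0" using assms(1)[of y] y(1) by auto
  then obtain i where "y = q i" by auto
  then show ?thesis using y(2)[OF assms(2)] by auto
qed

text \<open>The torsion function \<open>cosine 0 _ $ 1\<close> with Laplacian \<open>1\<close> serves as a barrier.\<close>

lemma maximum_principle:
  "\<exists>T\<ge>0. \<forall>(u :: real^2 \<Rightarrow> real) f M A. has_laplacian q u f \<longrightarrow> (\<forall>x\<in>SG q. \<bar>f x\<bar> \<le> M) \<longrightarrow> (\<forall>i. \<bar>u (q i)\<bar> \<le> A) \<longrightarrow>
     (\<forall>x\<in>SG q. \<bar>u x\<bar> \<le> A + M * T)"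
proof -
  define g where "g x = fps_nth (cosine 0 x) 1" for x
  have lg: "has_laplacian q g (\<lambda>x. 1)"
    using chain_coeff_laplacian(2)[OF chain_cosine, of 0 0] unfolding g_def cosine_0 by simp
  obtain B where B: "\<forall>n. \<forall>x\<in>SG q. \<bar>fps_nth (cosine 0 x) n\<bar> \<le> B n" using chain_bounded[OF chain_cosine] by blast
  define T where "T = 2 * B 1"
  have gB: "\<bar>g x\<bar> \<le> B 1" if "x \<in> SG q" for x using B that unfolding g_def by blast
  have T0: "T \<ge> 0" using gB[OF vertex_SG[of 0]] unfolding T_def by linarith
  have half: "u x \<le> A + M * T"
    if u: "has_laplacian q u f" and f: "\<forall>x\<in>SG q. \<bar>f x\<bar> \<le> M" and A: "\<forall>i. \<bar>u (q i)\<bar> \<le> A" and x: "x \<in> SG q" for u f M A x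
  proof -
    have "0 \<le> \<bar>f (q 0)\<bar>" by simp
    also have "\<dots> \<le> M" using f vertex_SG[of 0] by (rule bspec)
    finally have M0: "M \<ge> 0" .
    have *: "u y \<le> A + (M + e) * T" if e: "e > 0" and y: "y \<in> V q n" for e y n
    proof -
      define v where "v x = u x + (M + e) *\<^sub>R g x" for x
      have lv: "has_laplacian q v (\<lambda>x. f x + (M + e) *\<^sub>R 1)"
        unfolding v_def by (rule has_laplacian_add[OF u has_laplacian_scaleR[OF lg]])
      then obtain N where N: "\<forall>m\<ge>N. \<forall>x \<in> V q m - V q 0. dist ((3/2 * 5 ^ m) *\<^sub>R dlap m v x) (f x + (M + e) *\<^sub>R 1) < e"
        using e unfolding has_laplacian_dlap by blast
      define m where "m = max N n"
      have "dlap m v z > 0" if z: "z \<in> V q m - V q 0" for z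
      proof -
        have "dist ((3/2 * 5 ^ m) *\<^sub>R dlap m v z) (f z + (M + e) *\<^sub>R 1) < e" using N z unfolding m_def by simp
        moreover have "\<bar>f z\<bar> \<le> M" using f z V_SG by blast
        ultimately have "(3/2 * 5 ^ m) * dlap m v z > 0"
          by (simp only: dist_real_def real_scaleR_def mult_1_right)
        then show ?thesis by (simp add: zero_less_mult_iff)
      qed
      moreover have "y \<in> V q m" using y V_mono'[of n m] unfolding m_def by auto
      ultimately obtain i where i: "v y \<le> v (q i)" using discrete_maximum by blast
      have b: "(M + e) * \<bar>g y\<bar> \<le> (M + e) * B 1" "(M + e) * \<bar>g (q i)\<bar> \<le> (M + e) * B 1"
      proof -
        have "y \<in> SG q" using y V_SG by blast
        then show "(M + e) * \<bar>g y\<bar> \<le> (M + e) * B 1" using M0 e by (intro mult_left_mono gB) simp_all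
        show "(M + e) * \<bar>g (q i)\<bar> \<le> (M + e) * B 1" using M0 e by (intro mult_left_mono gB vertex_SG) simp_all
      qed
      have z: "- ((M + e) * \<bar>z\<bar>) \<le> (M + e) * z" "(M + e) * z \<le> (M + e) * \<bar>z\<bar>" for z
      proof -
        have "(M + e) * (- \<bar>z\<bar>) \<le> (M + e) * z" using M0 e by (intro mult_left_mono) auto
        then show "- ((M + e) * \<bar>z\<bar>) \<le> (M + e) * z" by simp
        show "(M + e) * z \<le> (M + e) * \<bar>z\<bar>" using M0 e by (intro mult_left_mono) auto
      qed
      have "\<bar>u (q i)\<bar> \<le> A" using A by (rule spec)
      then have uA: "u (q i) \<le> A" by (rule abs_le_D1)
      have imp: "a \<le> A + 2 * b" if "a + (M + e) * x \<le> a' + (M + e) * y" "(M + e) * \<bar>x\<bar> \<le> b" "(M + e) * \<bar>y\<bar> \<le> b"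
          "- ((M + e) * \<bar>x\<bar>) \<le> (M + e) * x" "(M + e) * y \<le> (M + e) * \<bar>y\<bar>" "a' \<le> A" for a a' b x y
        using that by linarith
      have "u y \<le> A + 2 * ((M + e) * B 1)"
        by (rule imp[OF i[unfolded v_def real_scaleR_def] b z(1) z(2) uA])
      then show ?thesis unfolding T_def by (simp only: mult_ac)
    qed
    have V: "u y \<le> A + M * T" if y: "y \<in> V q n" for y n
    proof (rule field_le_epsilon)
      fix e :: real assume e: "e > 0"
      have "u y \<le> A + (M + e / (T + 1)) * T" by (rule *[OF _ y]) (use e T0 in simp)
      also have "\<dots> = A + M * T + e * (T / (T + 1))" by (simp add: distrib_right)
      also have "\<dots> \<le> A + M * T + e * 1" using e T0 by (intro add_left_mono mult_left_mono) auto
      finally show "u y \<le> A + M * T + e" by simp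
    qed
    have "x \<in> closure (Vstar - V q 0)" using x unfolding SG_closure[symmetric] .
    moreover have "continuous_on (closure (Vstar - V q 0)) u"
      unfolding SG_closure[symmetric] by (rule has_laplacian_continuous(1)[OF u])
    ultimately show ?thesis
      using V unfolding Vstar_def
      by (intro continuous_le_on_closure[of _ u x "A + M * T"]) auto
  qed
  have "\<bar>u x\<bar> \<le> A + M * T"
    if u: "has_laplacian q u f" and f: "\<forall>x\<in>SG q. \<bar>f x\<bar> \<le> M" and A: "\<forall>i. \<bar>u (q i)\<bar> \<le> A" and x: "x \<in> SG q" for u f M A x
  proof -
    have "- u x \<le> A + M * T"
      using half[OF has_laplacian_scaleR[OF u, of "-1"] _ _ x, of M A] f A by simp
    then show ?thesis using half[OF u f A x] by linarith
  qed
  then show ?thesis using T0 by (intro exI[of _ T] conjI allI impI ballI)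
qed

lemma harmonic_zero:
  fixes u :: "real^2 \<Rightarrow> real"
  assumes "has_laplacian q u (\<lambda>x. 0)" "\<And>i. u (q i) = 0" "x \<in> SG q"
  shows "u x = 0"
proof -
  obtain T where T: "\<forall>(u :: real^2 \<Rightarrow> real) f M A. has_laplacian q u f \<longrightarrow> (\<forall>x\<in>SG q. \<bar>f x\<bar> \<le> M) \<longrightarrow> (\<forall>i. \<bar>u (q i)\<bar> \<le> A) \<longrightarrow>
     (\<forall>x\<in>SG q. \<bar>u x\<bar> \<le> A + M * T)" using maximum_principle by blast
  have "\<forall>x\<in>SG q. \<bar>u x\<bar> \<le> 0 + 0 * T"
    using T[rule_format, OF assms(1), of 0 0] assms(2) by simp
  then show ?thesis using assms(3) by auto
qed

definition mon :: "3 \<Rightarrow> nat \<Rightarrow> real^2 \<Rightarrow> real fps" where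
  "mon l k = (if k = 1 then cosine l else if k = 2 then sine l else tang l)"

definition mon_scale :: "nat \<Rightarrow> real" where
  "mon_scale k = (if k = 1 then 1 else if k = 2 then 3/5 else 1/5)"

lemma chain_mon: "chain (mon l k)"
  unfolding mon_def by (simp add: chain_cosine chain_sine chain_tang)

lemma mon_F: "x \<in> SG q \<Longrightarrow> fps_nth (mon l k (F q l x)) n = mon_scale k / 5 ^ n * fps_nth (mon l k x) n"
  unfolding mon_def mon_scale_def by (simp add: cosine_scale sine_scale tang_scale)

lemma F_funpow_SG: "x \<in> SG q \<Longrightarrow> (F q l ^^ m) x \<in> SG q"
  by (induction m) (auto simp: F_SG)

lemma mon_F_funpow:
  "x \<in> SG q \<Longrightarrow> fps_nth (mon l k ((F q l ^^ m) x)) n = (mon_scale k / 5 ^ n) ^ m * fps_nth (mon l k x) n"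
  by (induction m) (simp_all add: mon_F F_funpow_SG)

lemma F_funpow_fix: "(F q l ^^ m) (q l) = q l"
  by (induction m) (simp_all add: F_fix)

lemma mon_jets:
  fixes c :: "nat \<Rightarrow> 'a::{real_normed_field, banach}"
  assumes k: "k \<in> {1..3}" and B: "\<And>n x. x \<in> SG q \<Longrightarrow> \<bar>fps_nth (mon l k x) n\<bar> \<le> B n" and s: "summable (\<lambda>n. norm (c n) * B n)"
    and u: "\<And>x. x \<in> SG q \<Longrightarrow> u x = (\<Sum>n. c n * of_real (fps_nth (mon l k x) n))"
  shows "u (q l) = (if k = 1 then c 0 else 0)"
    and "has_normal_derivative q u l (if k = 2 then c 0 else 0)"
    and "has_tangential_derivative q u l (if k = 3 then c 0 else 0)"
proof -
  have k': "k = 1 \<or> k = 2 \<or> k = 3" using k by auto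
  let ?P = "mon l k"
  have sm: "summable (\<lambda>n. c n * of_real (fps_nth (?P x) n))" if "x \<in> SG q" for x
    by (rule summable_norm_cancel[OF series_uniform_limit(2)[OF B s that]])
  have "(\<lambda>n. c n * of_real (fps_nth (?P (q l)) n)) = (\<lambda>n. if n = 0 then (if k = 1 then c 0 else 0) else 0)"
    using k' by (auto simp: fun_eq_iff mon_def cosine_values(1) sine_values(1) tang_values(1))
  then show "u (q l) = (if k = 1 then c 0 else 0)"
    unfolding u[OF vertex_SG] by (simp only:) (subst suminf_finite[of "{0}"], auto)
  define h where "h n = 2 * fps_nth (?P (q l)) n - fps_nth (?P (q (l + 1))) n - fps_nth (?P (q (l - 1))) n" for n
  define h' where "h' n = fps_nth (?P (q (l + 1))) n - fps_nth (?P (q (l - 1))) n" for n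
  have hB: "\<bar>h n\<bar> \<le> 4 * B n" "\<bar>h' n\<bar> \<le> 4 * B n" for n
    using B[OF vertex_SG, of l n] B[OF vertex_SG, of "l + 1" n] B[OF vertex_SG, of "l - 1" n]
    unfolding h_def h'_def by linarith+
  have sh: "summable (\<lambda>n. norm (c n) * \<bar>h n\<bar>)" "summable (\<lambda>n. norm (c n) * \<bar>h' n\<bar>)"
  proof -
    have s4: "summable (\<lambda>n. 4 * (norm (c n) * B n))" by (rule summable_mult[OF s])
    have "norm (norm (c n) * \<bar>h n\<bar>) \<le> 4 * (norm (c n) * B n)" "norm (norm (c n) * \<bar>h' n\<bar>) \<le> 4 * (norm (c n) * B n)" for n
      using mult_left_mono[OF hB(1)[of n], of "norm (c n)"] mult_left_mono[OF hB(2)[of n], of "norm (c n)"]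
      by (simp_all add: mult_ac)
    then show "summable (\<lambda>n. norm (c n) * \<bar>h n\<bar>)" "summable (\<lambda>n. norm (c n) * \<bar>h' n\<bar>)"
      by - (rule summable_comparison_test'[OF s4, of 0]; assumption)+
  qed
  have uF: "u ((F q l ^^ m) x) = (\<Sum>n. c n * of_real ((mon_scale k / 5 ^ n) ^ m * fps_nth (?P x) n))" if "x \<in> SG q" for m x
    unfolding u[OF F_funpow_SG[OF that]] mon_F_funpow[OF that] ..
  have smF: "summable (\<lambda>n. c n * of_real ((mon_scale k / 5 ^ n) ^ m * fps_nth (?P x) n))" if "x \<in> SG q" for m x
    using sm[OF F_funpow_SG[OF that, where m = m and l = l]] unfolding mon_F_funpow[OF that] .
  have N: "b ^ m *\<^sub>R (2 *\<^sub>R u (q l) - u ((F q l ^^ m) (q (l + 1))) - u ((F q l ^^ m) (q (l - 1)))) =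
      (\<Sum>n. c n * of_real ((b * mon_scale k / 5 ^ n) ^ m * h n))" for b m
  proof -
    have "(\<lambda>n. b ^ m *\<^sub>R (2 *\<^sub>R (c n * of_real ((mon_scale k / 5 ^ n) ^ m * fps_nth (?P (q l)) n)) -
        c n * of_real ((mon_scale k / 5 ^ n) ^ m * fps_nth (?P (q (l + 1))) n) -
        c n * of_real ((mon_scale k / 5 ^ n) ^ m * fps_nth (?P (q (l - 1))) n)))
      sums (b ^ m *\<^sub>R (2 *\<^sub>R u ((F q l ^^ m) (q l)) - u ((F q l ^^ m) (q (l + 1))) - u ((F q l ^^ m) (q (l - 1)))))"
      unfolding uF[OF vertex_SG]
      by (intro sums_scaleR_right sums_diff summable_sums smF vertex_SG)
    moreover have "b ^ m *\<^sub>R (2 *\<^sub>R (c n * of_real ((mon_scale k / 5 ^ n) ^ m * fps_nth (?P (q l)) n)) -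
        c n * of_real ((mon_scale k / 5 ^ n) ^ m * fps_nth (?P (q (l + 1))) n) -
        c n * of_real ((mon_scale k / 5 ^ n) ^ m * fps_nth (?P (q (l - 1))) n)) =
       c n * of_real ((b * mon_scale k / 5 ^ n) ^ m * h n)" for n
      unfolding h_def scaleR_conv_of_real
      by (simp add: power_mult_distrib power_divide algebra_simps)
    ultimately show ?thesis unfolding F_funpow_fix by (simp only: sums_iff)
  qed
  have N': "b ^ m *\<^sub>R (u ((F q l ^^ m) (q (l + 1))) - u ((F q l ^^ m) (q (l - 1)))) =
      (\<Sum>n. c n * of_real ((b * mon_scale k / 5 ^ n) ^ m * h' n))" for b m
  proof -
    have "(\<lambda>n. b ^ m *\<^sub>R (c n * of_real ((mon_scale k / 5 ^ n) ^ m * fps_nth (?P (q (l + 1))) n) -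
        c n * of_real ((mon_scale k / 5 ^ n) ^ m * fps_nth (?P (q (l - 1))) n)))
      sums (b ^ m *\<^sub>R (u ((F q l ^^ m) (q (l + 1))) - u ((F q l ^^ m) (q (l - 1)))))"
      unfolding uF[OF vertex_SG]
      by (intro sums_scaleR_right sums_diff summable_sums smF vertex_SG)
    moreover have "b ^ m *\<^sub>R (c n * of_real ((mon_scale k / 5 ^ n) ^ m * fps_nth (?P (q (l + 1))) n) -
        c n * of_real ((mon_scale k / 5 ^ n) ^ m * fps_nth (?P (q (l - 1))) n)) =
       c n * of_real ((b * mon_scale k / 5 ^ n) ^ m * h' n)" for n
      unfolding h'_def scaleR_conv_of_real
      by (simp add: power_mult_distrib power_divide algebra_simps)
    ultimately show ?thesis by (simp only: sums_iff)
  qed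
  have h1: "h 0 = 0" if "k = 1"
    using that unfolding h_def mon_def by (simp add: cosine_0)
  have h2: "h 0 = 1" if "k = 2"
    using that sine_values(3)[of l] unfolding h_def mon_def by (simp add: sine_values(1) sine_values(2)[symmetric])
  have h3: "h = (\<lambda>n. 0)" if "k = 3"
    using that unfolding h_def[abs_def] mon_def by (simp add: tang_values)
  have h'12: "h' = (\<lambda>n. 0)" if "k = 1 \<or> k = 2"
    using that unfolding h'_def[abs_def] mon_def by (auto simp: sine_values(2) cosine_values)
  have h'3: "h' 0 = 1" if "k = 3"
    using that tang_values(3)[of l] unfolding h'_def mon_def by (simp add: tang_values(2))
  show "has_normal_derivative q u l (if k = 2 then c 0 else 0)"
    unfolding has_normal_derivative_def N
  proof -
    have "(\<lambda>m. \<Sum>n. c n * of_real ((5/3 * mon_scale k / 5 ^ n) ^ m * h n)) \<longlonglongrightarrow> c 0 * of_real (h 0)"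
      by (rule scaled_series_limit[OF _ _ _ sh(1)]) (use k' h1 h3 in \<open>auto simp: mon_scale_def\<close>)
    moreover have "c 0 * of_real (h 0) = (if k = 2 then c 0 else 0)" using k' h1 h2 h3 by auto
    ultimately show "(\<lambda>m. \<Sum>n. c n * of_real ((5/3 * mon_scale k / 5 ^ n) ^ m * h n)) \<longlonglongrightarrow> (if k = 2 then c 0 else 0)"
      by simp
  qed
  show "has_tangential_derivative q u l (if k = 3 then c 0 else 0)"
    unfolding has_tangential_derivative_def N'
  proof (cases "k = 3")
    case True
    have "(\<lambda>m. \<Sum>n. c n * of_real ((5 * mon_scale k / 5 ^ n) ^ m * h' n)) \<longlonglongrightarrow> c 0 * of_real (h' 0)"
      by (rule scaled_series_limit[OF _ _ _ sh(2)]) (use True in \<open>auto simp: mon_scale_def\<close>)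
    then show "(\<lambda>m. \<Sum>n. c n * of_real ((5 * mon_scale k / 5 ^ n) ^ m * h' n)) \<longlonglongrightarrow> (if k = 3 then c 0 else 0)"
      using True h'3 by simp
  next
    case False
    then have "k = 1 \<or> k = 2" using k' by blast
    then show "(\<lambda>m. \<Sum>n. c n * of_real ((5 * mon_scale k / 5 ^ n) ^ m * h' n)) \<longlonglongrightarrow> (if k = 3 then c 0 else 0)"
      using False by (simp add: h'12)
  qed
qed

end

section \<open>Identification of the monomials\<close>

context gasket begin

lemma mon_coeff_jets:
  assumes k: "k \<in> {1..3}" and u: "\<And>x. x \<in> SG q \<Longrightarrow> u x = fps_nth (mon l k x) N"
  shows "u (q l) = of_bool (N = 0 \<and> k = 1)"
    and "has_normal_derivative q u l (of_bool (N = 0 \<and> k = 2) :: real)"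
    and "has_tangential_derivative q u l (of_bool (N = 0 \<and> k = 3) :: real)"
proof -
  obtain B where B: "\<forall>n. \<forall>x\<in>SG q. \<bar>fps_nth (mon l k x) n\<bar> \<le> B n" using chain_bounded[OF chain_mon] by blast
  then have B': "\<bar>fps_nth (mon l k x) n\<bar> \<le> B n" if "x \<in> SG q" for x n using that by blast
  define c where "c n = (if n = N then 1 else 0 :: real)" for n
  have sm: "summable (\<lambda>n. norm (c n) * B n)"
    by (rule summable_finite[of "{N}"]) (auto simp: c_def)
  have e: "u x = (\<Sum>n. c n * of_real (fps_nth (mon l k x) n))" if "x \<in> SG q" for x
    unfolding u[OF that] by (subst suminf_finite[of "{N}"]) (auto simp: c_def)
  have c0: "(if k = j then c 0 else 0) = of_bool (N = 0 \<and> k = j)" for j by (auto simp: c_def)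
  show "u (q l) = of_bool (N = 0 \<and> k = 1)"
    and "has_normal_derivative q u l (of_bool (N = 0 \<and> k = 2) :: real)"
    and "has_tangential_derivative q u l (of_bool (N = 0 \<and> k = 3) :: real)"
    using mon_jets[OF k B' sm e] unfolding c0 by blast+
qed

lemma has_normal_derivative_lin:
  assumes "has_normal_derivative q u l (d::real)" "has_normal_derivative q v l e"
  shows "has_normal_derivative q (\<lambda>x. a * u x + b * v x) l (a * d + b * e)"
proof -
  have "(\<lambda>m. a * ((5/3) ^ m *\<^sub>R (2 *\<^sub>R u (q l) - u ((F q l ^^ m) (q (l + 1))) - u ((F q l ^^ m) (q (l - 1))))) +
     b * ((5/3) ^ m *\<^sub>R (2 *\<^sub>R v (q l) - v ((F q l ^^ m) (q (l + 1))) - v ((F q l ^^ m) (q (l - 1)))))) \<longlonglongrightarrow> a * d + b * e"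
    using assms unfolding has_normal_derivative_def by (intro tendsto_intros)
  then show ?thesis unfolding has_normal_derivative_def by (simp add: algebra_simps)
qed

lemma has_tangential_derivative_lin:
  assumes "has_tangential_derivative q u l (d::real)" "has_tangential_derivative q v l e"
  shows "has_tangential_derivative q (\<lambda>x. a * u x + b * v x) l (a * d + b * e)"
proof -
  have "(\<lambda>m. a * (5 ^ m *\<^sub>R (u ((F q l ^^ m) (q (l + 1))) - u ((F q l ^^ m) (q (l - 1))))) +
     b * (5 ^ m *\<^sub>R (v ((F q l ^^ m) (q (l + 1))) - v ((F q l ^^ m) (q (l - 1)))))) \<longlonglongrightarrow> a * d + b * e"
    using assms unfolding has_tangential_derivative_def by (intro tendsto_intros)
  then show ?thesis unfolding has_tangential_derivative_def by (simp add: algebra_simps)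
qed

lemma has_normal_derivative_cong:
  assumes "has_normal_derivative q u l d" "\<And>x. x \<in> SG q \<Longrightarrow> u x = v x"
  shows "has_normal_derivative q v l d"
  using assms(1) unfolding has_normal_derivative_def
  by (simp only: assms(2)[OF vertex_SG] assms(2)[OF F_funpow_SG[OF vertex_SG]])

lemma has_tangential_derivative_cong:
  assumes "has_tangential_derivative q u l d" "\<And>x. x \<in> SG q \<Longrightarrow> u x = v x"
  shows "has_tangential_derivative q v l d"
  using assms(1) unfolding has_tangential_derivative_def
  by (simp only: assms(2)[OF F_funpow_SG[OF vertex_SG]])

lemma harmonic_jet_zero:
  fixes u :: "real^2 \<Rightarrow> real"
  assumes u: "has_laplacian q u (\<lambda>x. 0)" and u0: "u (q l) = 0"
    and un: "has_normal_derivative q u l 0" and ut: "has_tangential_derivative q u l 0" and x: "x \<in> SG q"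
  shows "u x = 0"
proof -
  define P2 where "P2 x = fps_nth (mon l 2 x) 0" for x
  define P3 where "P3 x = fps_nth (mon l 3 x) 0" for x
  define \<alpha> where "\<alpha> = - (u (q (l + 1)) + u (q (l - 1)))"
  define \<gamma> where "\<gamma> = u (q (l + 1)) - u (q (l - 1))"
  define w where "w x = \<alpha> * P2 x + \<gamma> * P3 x" for x
  have "has_laplacian q w (\<lambda>x. \<alpha> *\<^sub>R 0 + \<gamma> *\<^sub>R 0)"
    unfolding w_def P2_def P3_def real_scaleR_def[symmetric]
    by (intro has_laplacian_add has_laplacian_scaleR chain_coeff_laplacian(1) chain_mon)
  then have lw: "has_laplacian q w (\<lambda>x. 0)" by simp
  have P: "P2 (q l) = 0" "P2 (q (l + 1)) = - 1/2" "P2 (q (l - 1)) = - 1/2"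
    "P3 (q l) = 0" "P3 (q (l + 1)) = 1/2" "P3 (q (l - 1)) = - 1/2"
    using sine_values(3)[of l] tang_values(3)[of l] unfolding P2_def P3_def mon_def
    by (simp_all add: sine_values(1) sine_values(2)[symmetric] tang_values(1,2))
  have "u (q i) - w (q i) = 0" for i
  proof -
    consider "i = l" | "i = l + 1" | "i = l - 1" using succ_pred_index(10)[of l] by blast
    then show ?thesis unfolding w_def \<alpha>_def \<gamma>_def by cases (simp_all only: P u0, simp_all add: field_simps)
  qed
  then have uw: "u x = w x" if "x \<in> SG q" for x
    using harmonic_zero[of "\<lambda>x. u x - w x", OF _ _ that] has_laplacian_diff[OF u lw] by simp
  have nw: "has_normal_derivative q w l (\<alpha> * of_bool ((0::nat) = 0 \<and> (2::nat) = 2) + \<gamma> * of_bool ((0::nat) = 0 \<and> (3::nat) = 2))"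
    unfolding w_def P2_def P3_def by (intro has_normal_derivative_lin mon_coeff_jets(2)) auto
  have tw: "has_tangential_derivative q w l (\<alpha> * of_bool ((0::nat) = 0 \<and> (2::nat) = 3) + \<gamma> * of_bool ((0::nat) = 0 \<and> (3::nat) = 3))"
    unfolding w_def P2_def P3_def by (intro has_tangential_derivative_lin mon_coeff_jets(3)) auto
  have "\<alpha> = 0"
    using LIMSEQ_unique[OF nw[unfolded has_normal_derivative_def] has_normal_derivative_cong[OF un uw, unfolded has_normal_derivative_def]] by simp
  moreover have "\<gamma> = 0"
    using LIMSEQ_unique[OF tw[unfolded has_tangential_derivative_def] has_tangential_derivative_cong[OF ut uw, unfolded has_tangential_derivative_def]] by simp
  ultimately show ?thesis using uw[OF x] unfolding w_def by simp
qed

definition monf :: "3 \<Rightarrow> nat \<Rightarrow> nat \<Rightarrow> real^2 \<Rightarrow> real" where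
  "monf l j k x = (if x \<in> SG q then fps_nth (mon l k x) j else 0)"

lemma has_laplacian_zero: "has_laplacian q (\<lambda>x. 0 :: 'b::real_normed_vector) (\<lambda>x. 0)"
  unfolding has_laplacian_dlap by (auto simp: dlap_def)

lemma has_laplacian_monf: "has_laplacian q (monf l 0 k) (\<lambda>x. 0)" "has_laplacian q (monf l (Suc j) k) (monf l j k)"
  by (rule has_laplacian_cong[OF chain_coeff_laplacian(1)[OF chain_mon]], auto simp: monf_def)
     (rule has_laplacian_cong[OF chain_coeff_laplacian(2)[OF chain_mon]], auto simp: monf_def)

lemma laplacian_zero: "laplacian q (\<lambda>x. 0 :: 'b::real_normed_vector) = (\<lambda>x. 0)"
  unfolding laplacian_eq[OF has_laplacian_zero] by simp

lemma laplacian_monf: "laplacian q (monf l 0 k) = (\<lambda>x. 0)" "laplacian q (monf l (Suc j) k) = monf l j k"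
  unfolding laplacian_eq[OF has_laplacian_monf(1)] laplacian_eq[OF has_laplacian_monf(2)] by (auto simp: monf_def)

lemma laplacian_power_monf: "(laplacian q ^^ m) (monf l j k) = (if m \<le> j then monf l (j - m) k else (\<lambda>x. 0))"
proof (induction m)
  case (Suc m)
  show ?case
  proof (cases "m < j")
    case True
    then have "j - m = Suc (j - Suc m)" by simp
    then show ?thesis using Suc True by (simp add: laplacian_monf(2))
  next
    case False
    then show ?thesis using Suc by (cases "m = j") (simp_all add: laplacian_monf(1) laplacian_zero)
  qed
qed simp

lemma zero_dom: "(\<lambda>x. 0 :: 'b::real_normed_vector) \<in> dom_laplacian_power q n"
proof (induction n)
  case (Suc n)
  then show ?case using has_laplacian_zero by (auto simp: laplacian_zero)
qed simp

lemma monf_dom: "monf l j k \<in> dom_laplacian_power q n"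
proof (induction n arbitrary: j)
  case 0
  have "\<exists>f. has_laplacian q (monf l j k) f" using has_laplacian_monf by (cases j) blast+
  then show ?case using has_laplacian_continuous(1) by auto
next
  case (Suc n)
  show ?case
  proof (cases j)
    case 0
    then show ?thesis using has_laplacian_monf(1)[of l k] by (auto simp: laplacian_monf zero_dom)
  next
    case (Suc i)
    then show ?thesis using has_laplacian_monf(2)[of l i k] Suc.IH[of i] by (auto simp: laplacian_monf)
  qed
qed

definition same_jet :: "3 \<Rightarrow> (real^2 \<Rightarrow> real) \<Rightarrow> (real^2 \<Rightarrow> real) \<Rightarrow> bool" where
  "same_jet l u v \<longleftrightarrow> u (q l) = v (q l) \<and>
     (\<exists>d. has_normal_derivative q u l d \<and> has_normal_derivative q v l d) \<and>
     (\<exists>d. has_tangential_derivative q u l d \<and> has_tangential_derivative q v l d)"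

lemma same_jet_eq:
  assumes u: "has_laplacian q u f" and v: "has_laplacian q v g" and fg: "\<And>x. x \<in> SG q \<Longrightarrow> f x = g x"
    and j: "same_jet l u v" and x: "x \<in> SG q"
  shows "u x = v x"
proof -
  obtain d e where d: "has_normal_derivative q u l d" "has_normal_derivative q v l d"
    and e: "has_tangential_derivative q u l e" "has_tangential_derivative q v l e"
    using j unfolding same_jet_def by blast
  have l: "has_laplacian q (\<lambda>x. 1 * u x + (-1) * v x) (\<lambda>x. 0)"
    by (rule has_laplacian_cong[OF has_laplacian_diff[OF u v]]) (simp_all add: fg)
  have n: "has_normal_derivative q (\<lambda>x. 1 * u x + (-1) * v x) l 0"
    using has_normal_derivative_lin[OF d, of 1 "-1"] by simp
  have t: "has_tangential_derivative q (\<lambda>x. 1 * u x + (-1) * v x) l 0"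
    using has_tangential_derivative_lin[OF e, of 1 "-1"] by simp
  have "1 * u x + (-1) * v x = 0"
    by (rule harmonic_jet_zero[OF l _ n t x]) (use j in \<open>simp add: same_jet_def\<close>)
  then show ?thesis by simp
qed

lemma multiharmonic_jet_unique:
  assumes "P \<in> dom_laplacian_power q (Suc j)" "P' \<in> dom_laplacian_power q (Suc j)"
    and "\<forall>x\<in>SG q. (laplacian q ^^ Suc j) P x = 0" "\<forall>x\<in>SG q. (laplacian q ^^ Suc j) P' x = 0"
    and "\<And>m. m \<le> j \<Longrightarrow> same_jet l ((laplacian q ^^ m) P) ((laplacian q ^^ m) P')" and "x \<in> SG q"
  shows "P x = P' x"
  using assms
proof (induction j arbitrary: P P' x)
  case 0
  have h: "has_laplacian q P (laplacian q P)" "has_laplacian q P' (laplacian q P')"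
    using 0(1,2) has_laplacian_laplacian(1) by auto
  show ?case
    by (rule same_jet_eq[OF h _ _ 0(6), of l]) (use 0(3,4) 0(5)[of 0] in simp_all)
next
  case (Suc j)
  have ex: "\<exists>f. has_laplacian q P f" "\<exists>f. has_laplacian q P' f"
    and dom: "laplacian q P \<in> dom_laplacian_power q (Suc j)" "laplacian q P' \<in> dom_laplacian_power q (Suc j)"
    using Suc.prems(1,2) unfolding dom_laplacian_power.simps(2)[of q "Suc j"] by blast+
  have sw: "(laplacian q ^^ m) (laplacian q u) = (laplacian q ^^ Suc m) u" for m and u :: "real^2 \<Rightarrow> real"
    by (simp add: funpow_swap1)
  have eq: "laplacian q P y = laplacian q P' y" if y: "y \<in> SG q" for y
  proof (rule Suc.IH[OF dom _ _ _ y])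
    show "\<forall>x\<in>SG q. (laplacian q ^^ Suc j) (laplacian q P) x = 0" unfolding sw by (rule Suc.prems(3))
    show "\<forall>x\<in>SG q. (laplacian q ^^ Suc j) (laplacian q P') x = 0" unfolding sw by (rule Suc.prems(4))
    show "same_jet l ((laplacian q ^^ m) (laplacian q P)) ((laplacian q ^^ m) (laplacian q P'))" if "m \<le> j" for m
      unfolding sw by (rule Suc.prems(5)) (use that in simp)
  qed
  have j0: "same_jet l P P'" using Suc.prems(5)[of 0] by simp
  show ?case
    by (rule same_jet_eq[OF has_laplacian_laplacian(1)[OF ex(1)] has_laplacian_laplacian(1)[OF ex(2)] eq j0 Suc.prems(6)])
qed

theorem monomial_eq:
  assumes k: "k \<in> {1..3}"
  shows "monomial q l j k = monf l j k"
  unfolding monomial_def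
proof (rule the_equality)
  let ?J = "\<lambda>P. \<forall>m\<le>j. (laplacian q ^^ m) P (q l) = of_bool (m = j \<and> k = 1) \<and>
            has_normal_derivative q ((laplacian q ^^ m) P) l (of_bool (m = j \<and> k = 2)) \<and>
            has_tangential_derivative q ((laplacian q ^^ m) P) l (of_bool (m = j \<and> k = 3))"
  have J: "?J (monf l j k)"
  proof (intro allI impI)
    fix m assume m: "m \<le> j"
    have e: "(laplacian q ^^ m) (monf l j k) x = fps_nth (mon l k x) (j - m)" if "x \<in> SG q" for x
      using that m by (simp add: laplacian_power_monf monf_def)
    have b: "(j - m = 0) = (m = j)" using m by auto
    show "(laplacian q ^^ m) (monf l j k) (q l) = of_bool (m = j \<and> k = 1) \<and>
            has_normal_derivative q ((laplacian q ^^ m) (monf l j k)) l (of_bool (m = j \<and> k = 2)) \<and>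
            has_tangential_derivative q ((laplacian q ^^ m) (monf l j k)) l (of_bool (m = j \<and> k = 3))"
      using mon_coeff_jets[OF k e] unfolding b by blast
  qed
  have mh: "monf l j k \<in> multiharmonic q j"
    unfolding multiharmonic_def using monf_dom by (simp only: mem_Collect_eq laplacian_power_monf) simp
  show "monf l j k \<in> multiharmonic q j \<and> (\<forall>x. x \<notin> SG q \<longrightarrow> monf l j k x = 0) \<and> ?J (monf l j k)"
    using mh J by (simp add: monf_def)
  fix P assume P: "P \<in> multiharmonic q j \<and> (\<forall>x. x \<notin> SG q \<longrightarrow> P x = 0) \<and> ?J P"
  show "P = monf l j k"
  proof
    fix x
    show "P x = monf l j k x"
    proof (cases "x \<in> SG q")
      case True
      show ?thesis
      proof (rule multiharmonic_jet_unique[OF _ _ _ _ _ True])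
        show "P \<in> dom_laplacian_power q (Suc j)" "\<forall>x\<in>SG q. (laplacian q ^^ Suc j) P x = 0"
          "monf l j k \<in> dom_laplacian_power q (Suc j)" "\<forall>x\<in>SG q. (laplacian q ^^ Suc j) (monf l j k) x = 0"
          using P mh unfolding multiharmonic_def by blast+
        show "same_jet l ((laplacian q ^^ m) P) ((laplacian q ^^ m) (monf l j k))" if "m \<le> j" for m
          unfolding same_jet_def using P J that by metis
      qed
    next
      case False
      then show ?thesis using P by (simp add: monf_def)
    qed
  qed
qed

end

section \<open>Neumann eigenvalues\<close>

lemma eval_fps_sum_entire:
  fixes f :: "'i \<Rightarrow> real fps"
  assumes "\<And>i. i \<in> A \<Longrightarrow> entire_fps (f i)"
  shows "entire_fps (\<Sum>i\<in>A. f i) \<and> eval_fps (\<Sum>i\<in>A. f i) t = (\<Sum>i\<in>A. eval_fps (f i) t)"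
  using assms
proof (induction A rule: infinite_finite_induct)
  case (insert i A)
  then have "entire_fps (f i)" "entire_fps (\<Sum>i\<in>A. f i)" by simp_all
  then show ?case using insert by (simp add: eval_entire entire_add)
qed simp_all

context gasket begin

lemma entire_cosine: "x \<in> SG q \<Longrightarrow> entire_fps (cosine i x)"
proof -
  assume x: "x \<in> SG q"
  obtain K where K: "K \<ge> 1" "\<forall>i n. \<forall>x\<in>SG q. \<bar>fps_nth (cosine i x) n\<bar> \<le> K * 2 ^ n * recfact n"
    using cosine_bound by blast
  show ?thesis
  proof (rule entire_of_bound)
    fix n
    have "K * 2 ^ n * recfact n \<le> K * 2 ^ n * (1 / fact n)"
      using K(1) by (intro mult_left_mono recfact_le) auto
    moreover have "\<bar>fps_nth (cosine i x) n\<bar> \<le> K * 2 ^ n * recfact n" using K(2) x by blast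
    ultimately show "norm (fps_nth (cosine i x) n) \<le> K * 2 ^ n / fact n" by simp
  qed
qed

definition eig :: "3 \<Rightarrow> real \<Rightarrow> real^2 \<Rightarrow> real" where
  "eig i t x = eval_fps (cosine i x) t"

lemma eig_laplacian: "has_laplacian q (eig i t) (\<lambda>x. t * eig i t x)"
proof -
  obtain K where K: "K \<ge> 1" "\<forall>i n. \<forall>x\<in>SG q. \<bar>fps_nth (cosine i x) n\<bar> \<le> K * 2 ^ n * recfact n"
    using cosine_bound by blast
  let ?B = "\<lambda>n. K * 2 ^ n * recfact n"
  have eB: "entire_fps (Abs_fps ?B)"
  proof (rule entire_of_bound)
    fix n
    have "K * 2 ^ n * recfact n \<le> K * 2 ^ n * (1 / fact n)"
      using K(1) by (intro mult_left_mono recfact_le) auto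
    then show "norm (fps_nth (Abs_fps ?B) n) \<le> K * 2 ^ n / fact n"
      using K(1) recfact_pos[of n] by simp
  qed
  have adm: "admissible ?B (\<lambda>n. t ^ n)"
    by (rule admissible_geometric[of _ "\<bar>t\<bar>"]) (simp_all add: power_abs eB)
  have "summable (\<lambda>n. norm (t ^ n) * ?B n)" "summable (\<lambda>n. norm (t ^ n) * wconv ?B n)"
    using adm[unfolded admissible_def, rule_format, of 0] by simp_all
  then have "has_laplacian q (\<lambda>x. \<Sum>n. t ^ n * of_real (fps_nth (cosine i x) n)) (\<lambda>x. \<Sum>n. t ^ Suc n * of_real (fps_nth (cosine i x) n))"
    by (intro chain_has_laplacian[OF chain_cosine]) (use K(2) in blast)
  moreover have "(\<Sum>n. t ^ n * of_real (fps_nth (cosine i x) n)) = eig i t x" for x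
    unfolding eig_def eval_fps_def by (simp add: mult.commute)
  moreover have "(\<Sum>n. t ^ Suc n * of_real (fps_nth (cosine i x) n)) = t * eig i t x" if x: "x \<in> SG q" for x
  proof -
    have "summable (\<lambda>n. fps_nth (cosine i x) n * t ^ n)" by (rule summable_fps) (simp add: entire_cosine[OF x])
    then have "(\<Sum>n. t * (fps_nth (cosine i x) n * t ^ n)) = t * (\<Sum>n. fps_nth (cosine i x) n * t ^ n)"
      by (rule suminf_mult)
    then show ?thesis unfolding eig_def eval_fps_def by (simp add: mult_ac)
  qed
  ultimately show ?thesis
    by (rule_tac has_laplacian_cong[of "\<lambda>x. \<Sum>n. t ^ n * of_real (fps_nth (cosine i x) n)" "\<lambda>x. \<Sum>n. t ^ Suc n * of_real (fps_nth (cosine i x) n)"])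
qed

lemma eig_vertex: "eig i t (q j) = (if i = j then 1 else 1 + decf t / 4)"
proof -
  have "eval_fps (1 + fps_const (1/4) * dec) t = 1 + decf t / 4"
    by (simp add: eval_entire entire_mult entire_dec)
  then show ?thesis unfolding eig_def cosine_vertex cval_def by simp
qed

definition normf :: "nat \<Rightarrow> real \<Rightarrow> real" where
  "normf m t = eval_fps (norm_fps m) t"

lemma entire_norm_fps: "entire_fps (norm_fps m)"
  by (induction m) (simp_all add: entire_mult entire_add entire_dec entire_dil)

lemma normf_0: "normf 0 t = decf t * (6 + decf t) / 8"
  unfolding normf_def by (simp add: eval_entire entire_mult entire_add entire_dec)

lemma normf_Suc: "normf (Suc m) t = (3 + decf (t / 5)) * normf m (t / 5)"
  unfolding normf_def
  by (simp add: eval_entire entire_mult entire_add entire_dec entire_dil entire_norm_fps eval_dil)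

lemma normf_prod: "normf m t = (\<Prod>i<m. 3 + decf (t / 5 ^ Suc i)) * (decf (t / 5 ^ m) * (6 + decf (t / 5 ^ m)) / 8)"
proof (induction m arbitrary: t)
  case (Suc m)
  have "(\<Prod>i<Suc m. 3 + decf (t / 5 ^ Suc i)) = (3 + decf (t / 5)) * (\<Prod>i<m. 3 + decf (t / 5 / 5 ^ Suc i))"
    unfolding prod.lessThan_Suc_shift by (simp add: field_simps)
  then show ?case unfolding normf_Suc Suc by (simp add: field_simps)
qed (simp add: normf_0)

lemma eig_dlap_vertex:
  "dlap m (eig i t) (q j) = decf (t / 5 ^ m) / 2 * eig i t (q j) - (if i = j then 0 else normf m t)"
proof -
  have ent: "entire_fps (cosine i y - cosine i (q j))" if "y \<in> neighbours q m (q j)" for y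
  proof -
    have "y \<in> SG q" using that neighbours_subset V_SG by blast
    then show ?thesis by (intro entire_diff entire_cosine vertex_SG)
  qed
  have "dlap m (eig i t) (q j) = (\<Sum>y\<in>neighbours q m (q j). eval_fps (cosine i y - cosine i (q j)) t)"
    unfolding dlap_def eig_def
  proof (rule sum.cong[OF refl])
    fix y assume "y \<in> neighbours q m (q j)"
    then have "y \<in> SG q" using neighbours_subset V_SG by blast
    then show "eval_fps (cosine i y) t - eval_fps (cosine i (q j)) t = eval_fps (cosine i y - cosine i (q j)) t"
      by (simp add: eval_entire entire_cosine vertex_SG)
  qed
  also have "\<dots> = eval_fps (dlap m (cosine i) (q j)) t"
    unfolding dlap_def
    using eval_fps_sum_entire[of "neighbours q m (q j)" "\<lambda>y. cosine i y - cosine i (q j)" t, OF ent] by simp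
  also have "\<dots> = decf (t / 5 ^ m) / 2 * eig i t (q j) - (if i = j then 0 else normf m t)"
  proof -
    have e1: "entire_fps (dil ((1/5) ^ m) (dec :: real fps))" by (intro entire_dil entire_dec)
    have e2: "entire_fps (cval i j)" unfolding cval_def by (simp add: entire_add entire_mult entire_dec)
    have e3: "entire_fps (fps_const (1/2) * dil ((1/5) ^ m) dec * cval i j)"
      by (intro entire_mult e1 e2) simp
    have "eval_fps (fps_const (1/2) * dil ((1/5) ^ m) dec * cval i j) t = 1/2 * decf ((1/5) ^ m * t) * eig i t (q j)"
      using e1 e2 by (simp add: eval_entire entire_mult eval_dil eig_def cosine_vertex)
    moreover have "(1/5) ^ m * t = t / 5 ^ m" by (simp add: power_divide)
    ultimately show ?thesis
      unfolding cosine_dlap_vertex normf_def using e3 entire_norm_fps[of m]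
      by (cases "i = j") (simp_all add: eval_entire(2))
  qed
  finally show ?thesis .
qed

definition eigc :: "(3 \<Rightarrow> real) \<Rightarrow> real \<Rightarrow> real^2 \<Rightarrow> real" where
  "eigc y t x = (\<Sum>i\<in>UNIV. y i * eig i t x)"

lemma eigc_laplacian: "has_laplacian q (eigc y t) (\<lambda>x. t * eigc y t x)"
proof -
  have "has_laplacian q (\<lambda>x. y 1 *\<^sub>R eig 1 t x + y 2 *\<^sub>R eig 2 t x + y 3 *\<^sub>R eig 3 t x)
      (\<lambda>x. y 1 *\<^sub>R (t * eig 1 t x) + y 2 *\<^sub>R (t * eig 2 t x) + y 3 *\<^sub>R (t * eig 3 t x))"
    by (intro has_laplacian_add has_laplacian_scaleR eig_laplacian)
  then show ?thesis unfolding eigc_def sum_3 by (simp add: algebra_simps)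
qed

lemma eigc_vertex: "eigc y t (q j) = (\<Sum>i\<in>UNIV. y i) * (1 + decf t / 4) - decf t / 4 * y j"
proof -
  have "eigc y t (q j) = (\<Sum>i\<in>UNIV. y i * (1 + decf t / 4) - (if i = j then decf t / 4 * y i else 0))"
    unfolding eigc_def eig_vertex by (intro sum.cong) (auto simp: algebra_simps)
  then show ?thesis by (simp add: sum_subtractf sum_distrib_right)
qed

lemma eigc_dlap_vertex:
  "dlap m (eigc y t) (q j) = decf (t / 5 ^ m) / 2 * eigc y t (q j) - ((\<Sum>i\<in>UNIV. y i) - y j) * normf m t"
proof -
  have "dlap m (eigc y t) (q j) = (\<Sum>i\<in>UNIV. y i * dlap m (eig i t) (q j))"
    unfolding dlap_def eigc_def by (simp only: sum_3 right_diff_distrib sum_subtractf sum_distrib_left sum.distrib)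
  also have "\<dots> = (\<Sum>i\<in>UNIV. decf (t / 5 ^ m) / 2 * (y i * eig i t (q j)) - (y i * normf m t - (if i = j then y i * normf m t else 0)))"
    unfolding eig_dlap_vertex by (intro sum.cong) (auto simp: algebra_simps)
  also have "\<dots> = decf (t / 5 ^ m) / 2 * eigc y t (q j) - ((\<Sum>i\<in>UNIV. y i) - y j) * normf m t"
    unfolding eigc_def by (simp add: sum_subtractf sum_distrib_left sum_distrib_right left_diff_distrib)
  finally show ?thesis .
qed

lemma eigc_interpolate:
  assumes "decf t \<noteq> 0" "decf t \<noteq> - 6"
  shows "\<exists>y. \<forall>j. eigc y t (q j) = b j"
proof -
  define a where "a = decf t / 4"
  have a: "a \<noteq> 0" "3 + 2 * a \<noteq> 0" using assms unfolding a_def by (auto simp: field_simps)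
  define Y where "Y = (\<Sum>i\<in>UNIV. b i) / (3 + 2 * a)"
  define y where "y j = (Y * (1 + a) - b j) / a" for j
  have "(\<Sum>i\<in>UNIV. y i) = (3 * (Y * (1 + a)) - (\<Sum>i\<in>UNIV. b i)) / a"
    unfolding y_def by (simp add: sum_divide_distrib[symmetric] sum_subtractf)
  also have "(\<Sum>i\<in>UNIV. b i) = Y * (3 + 2 * a)" unfolding Y_def using a by simp
  also have "(3 * (Y * (1 + a)) - Y * (3 + 2 * a)) / a = Y" using a by (simp add: field_simps)
  finally have "(\<Sum>i\<in>UNIV. y i) = Y" .
  then have "eigc y t (q j) = b j" for j
    unfolding eigc_vertex a_def[symmetric] using a by (simp add: y_def)
  then show ?thesis by blast
qed

lemma has_normal_derivative_dlap:
  fixes u :: "real^2 \<Rightarrow> real"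
  shows "has_normal_derivative q u j d \<longleftrightarrow> (\<lambda>m. - ((5/3) ^ m * dlap m u (q j))) \<longlonglongrightarrow> d"
  unfolding has_normal_derivative_def dlap_vertex by (simp add: algebra_simps)

lemma decf_third_tendsto: "(\<lambda>m. (5/3) ^ m * (decf (t / 5 ^ m) / 2 * z)) \<longlonglongrightarrow> (0::real)"
proof -
  have "(\<lambda>m. 5 ^ m * decf (t / 5 ^ m) * (1 / 3 ^ m * (z / 2))) \<longlonglongrightarrow> 2/3 * t * 0"
    by (intro tendsto_mult decf_scaled_tendsto) real_asymp
  then show ?thesis by (simp add: power_divide field_simps)
qed

lemma neumann_decroot:
  assumes "k \<ge> 1"
  shows "neumann_eigenvalue q (5 ^ k * decroot)"
proof -
  define t where "t = - (5 ^ k * decroot)"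
  have "normf m t = 0" if "m \<ge> k" for m
  proof -
    have "t / 5 ^ Suc (k - 1) = - decroot" unfolding t_def using assms by simp
    then have "3 + decf (t / 5 ^ Suc (k - 1)) = 0" using decroot(2) by simp
    moreover have "k - 1 \<in> {..<m}" using assms that by auto
    ultimately have "(\<Prod>i<m. 3 + decf (t / 5 ^ Suc i)) = 0" by (metis finite_lessThan prod_zero)
    then show ?thesis unfolding normf_prod by simp
  qed
  note nz = this
  have "has_normal_derivative q (eig 0 t) j 0" for j
    unfolding has_normal_derivative_dlap
  proof (rule Lim_transform_eventually)
    show "(\<lambda>m. - ((5/3) ^ m * (decf (t / 5 ^ m) / 2 * eig 0 t (q j)))) \<longlonglongrightarrow> 0"
      using tendsto_minus[OF decf_third_tendsto[of t "eig 0 t (q j)"]] by simp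
    show "\<forall>\<^sub>F m in sequentially. - ((5/3) ^ m * (decf (t / 5 ^ m) / 2 * eig 0 t (q j))) = - ((5/3) ^ m * dlap m (eig 0 t) (q j))"
      unfolding eventually_sequentially
      by (intro exI[of _ k] allI impI) (simp add: eig_dlap_vertex nz)
  qed
  moreover have "eig 0 t (q 0) \<noteq> 0" by (simp add: eig_vertex)
  moreover have "has_laplacian q (eig 0 t) (\<lambda>x. - (5 ^ k * decroot) * eig 0 t x)"
    using eig_laplacian[of 0 t] unfolding t_def .
  ultimately show ?thesis unfolding neumann_eigenvalue_def using vertex_SG[of 0] by blast
qed

text \<open>Away from the exceptional values of spectral decimation, every eigenfunction is a combination of the
  three functions \<open>eig i t\<close>.\<close>

definition regular :: "real \<Rightarrow> bool" where
  "regular t \<longleftrightarrow> t \<noteq> 0 \<and> (\<forall>m. decf (t / 5 ^ m) \<notin> {0, - 2, - 3, - 5, - 6})"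

lemma regular_scale: "regular t \<Longrightarrow> regular (t / 5)"
  unfolding regular_def
proof (intro conjI allI)
  fix m assume "t \<noteq> 0 \<and> (\<forall>m. decf (t / 5 ^ m) \<notin> {0, - 2, - 3, - 5, - 6})"
  then have "decf (t / 5 ^ Suc m) \<notin> {0, - 2, - 3, - 5, - 6}" by blast
  then show "decf (t / 5 / 5 ^ m) \<notin> {0, - 2, - 3, - 5, - 6}" by simp
qed simp

lemma regularD: "regular t \<Longrightarrow> decf (t / 5 ^ m) \<notin> {0, - 2, - 3, - 5, - 6}" "regular t \<Longrightarrow> t \<noteq> 0"
  unfolding regular_def by blast+

lemma normf_not_to_0:
  assumes t: "regular t" and lim: "(\<lambda>m. z * ((5/3) ^ m * normf m t)) \<longlonglongrightarrow> 0"
  shows "z = 0"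
proof (rule ccontr)
  assume z: "z \<noteq> 0"
  define f where "f i = 1 + decf (t / 5 ^ Suc i) / 3" for i
  have f0: "f i \<noteq> 0" for i using regularD(1)[OF t, of "Suc i"] unfolding f_def by auto
  have "summable (\<lambda>i. norm (f i - 1))"
  proof -
    have "(\<lambda>m. 5 ^ m * decf (t / 5 ^ m)) \<longlonglongrightarrow> 2/3 * t" by (rule decf_scaled_tendsto)
    then have "Bseq (\<lambda>m. 5 ^ m * decf (t / 5 ^ m))" by (intro convergent_imp_Bseq) (auto simp: convergent_def)
    then have "\<exists>C. \<forall>m. norm (5 ^ m * decf (t / 5 ^ m)) \<le> C" unfolding Bseq_def by blast
    then obtain C where C: "\<And>m. norm (5 ^ m * decf (t / 5 ^ m)) \<le> C" by blast
    have b: "norm (norm (f i - 1)) \<le> C * (1/5) ^ i" for i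
    proof -
      have "C \<ge> 0" by (rule order_trans[OF norm_ge_zero C[of 0]])
      have "norm (f i - 1) = \<bar>decf (t / 5 ^ Suc i)\<bar> / 3" unfolding f_def by simp
      also have "\<dots> \<le> C / 5 ^ Suc i / 3" using C[of "Suc i"]
        by (intro divide_right_mono) (simp_all add: abs_mult pos_le_divide_eq mult.commute)
      also have "\<dots> \<le> C * (1/5) ^ i" using \<open>C \<ge> 0\<close> by (simp add: power_divide field_simps)
      finally show ?thesis by simp
    qed
    have "summable (\<lambda>i. C * (1/5) ^ i)" by (intro summable_mult summable_geometric) simp
    then show ?thesis using b by (rule summable_comparison_test'[where N = 0])
  qed
  then have conv: "convergent_prod f"
    by (intro abs_convergent_prod_imp_convergent_prod summable_imp_abs_convergent_prod)
  define s where "s m = 5 ^ m * decf (t / 5 ^ m) * (6 + decf (t / 5 ^ m)) / 8" for m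
  have s: "s \<longlonglongrightarrow> 2/3 * t * (6 + 0) / 8"
    unfolding s_def[abs_def]
    by (rule tendsto_divide[OF tendsto_mult[OF decf_scaled_tendsto tendsto_add[OF tendsto_const decf_tendsto_0]] tendsto_const]) simp
  have s0: "2/3 * t * (6 + 0) / 8 \<noteq> 0" using regularD(2)[OF t] by simp
  have e: "(5/3) ^ m * normf m t = (\<Prod>i<m. f i) * s m" for m
  proof -
    have "(\<Prod>i<m. 3 + decf (t / 5 ^ Suc i)) = (\<Prod>i<m. 3 * f i)" unfolding f_def by (intro prod.cong) auto
    also have "\<dots> = 3 ^ m * (\<Prod>i<m. f i)" by (simp add: prod.distrib)
    finally show ?thesis unfolding normf_prod s_def by (simp add: power_divide)
  qed
  have "(\<lambda>m. z * ((5/3) ^ m * normf m t) / (z * s m)) \<longlonglongrightarrow> 0 / (z * (2/3 * t * (6 + 0) / 8))"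
    by (intro tendsto_divide lim tendsto_mult_left s) (use z s0 in simp)
  moreover have "\<forall>\<^sub>F m in sequentially. z * ((5/3) ^ m * normf m t) / (z * s m) = (\<Prod>i<m. f i)"
    using tendsto_imp_eventually_ne[OF s s0] by (rule eventually_mono) (use z in \<open>simp add: e\<close>)
  ultimately have "(\<lambda>m. \<Prod>i<m. f i) \<longlonglongrightarrow> 0 / (z * (2/3 * t * (6 + 0) / 8))" by (rule Lim_transform_eventually)
  then have "(\<lambda>m. \<Prod>i<m. f i) \<longlonglongrightarrow> 0" by simp
  then have "(\<lambda>m. \<Prod>i<Suc m. f i) \<longlonglongrightarrow> 0" by (rule LIMSEQ_Suc)
  then have "(\<lambda>m. \<Prod>i\<le>m. f i) \<longlonglongrightarrow> 0" by (simp only: lessThan_Suc_atMost)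
  then show False using convergent_prod_to_zero_iff[OF conv] f0 by simp
qed

definition dirichlet_unique :: "real \<Rightarrow> bool" where
  "dirichlet_unique t \<longleftrightarrow> (\<forall>w. has_laplacian q w (\<lambda>x. t * w x) \<longrightarrow> (\<forall>i. w (q i) = 0) \<longrightarrow> (\<forall>x\<in>SG q. w x = 0))"

lemma eigenfunction_rep:
  assumes t: "dirichlet_unique t" "decf t \<noteq> 0" "decf t \<noteq> - 6" and u: "has_laplacian q u (\<lambda>x. t * u x)"
  obtains y where "\<And>x. x \<in> SG q \<Longrightarrow> u x = eigc y t x"
proof -
  obtain y where y: "\<forall>j. eigc y t (q j) = u (q j)" using eigc_interpolate[OF t(2,3), of "\<lambda>j. u (q j)"] by blast
  have "has_laplacian q (\<lambda>x. u x - eigc y t x) (\<lambda>x. t * (u x - eigc y t x))"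
    by (rule has_laplacian_cong[OF has_laplacian_diff[OF u eigc_laplacian]]) (simp_all add: algebra_simps)
  moreover have "\<forall>i. u (q i) - eigc y t (q i) = 0" using y by simp
  ultimately have "\<forall>x\<in>SG q. u x - eigc y t x = 0"
    using t(1)[unfolded dirichlet_unique_def, rule_format, of "\<lambda>x. u x - eigc y t x"] by blast
  then show ?thesis using that[of y] by simp
qed

lemma dirichlet_unique_step:
  assumes t: "regular t" and IH: "dirichlet_unique (t / 5)"
  shows "dirichlet_unique t"
  unfolding dirichlet_unique_def
proof (intro allI impI ballI)
  fix w x assume w: "has_laplacian q w (\<lambda>x. t * w x)" and w0: "\<forall>i. w (q i) = 0" and x: "x \<in> SG q"
  define v where "v k x = w (F q k x)" for k x
  have v: "has_laplacian q (v k) (\<lambda>x. t / 5 * v k x)" for k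
    unfolding v_def by (rule has_laplacian_cong[OF has_laplacian_cell[OF w, of k]]) simp_all
  have s1: "decf (t / 5) \<notin> {0, - 2, - 3, - 5, - 6}" using regularD(1)[OF t, of 1] by simp
  have "\<exists>y. \<forall>x\<in>SG q. v k x = eigc y (t / 5) x" for k
  proof -
    obtain y where "\<And>x. x \<in> SG q \<Longrightarrow> v k x = eigc y (t / 5) x"
      using eigenfunction_rep[OF IH _ _ v[of k]] s1 by auto
    then show ?thesis by blast
  qed
  then have "\<forall>k. \<exists>y. \<forall>x\<in>SG q. v k x = eigc y (t / 5) x" by (rule allI)
  from choice[OF this] obtain Y where Y: "\<forall>k. \<forall>x\<in>SG q. v k x = eigc (Y k) (t / 5) x" by (rule exE)
  have dl: "dlap m (v k) (q j) = decf (t / 5 ^ Suc m) / 2 * v k (q j) - ((\<Sum>i\<in>UNIV. Y k i) - Y k j) * normf m (t / 5)" for m k j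
  proof -
    have "dlap m (v k) (q j) = dlap m (eigc (Y k) (t / 5)) (q j)"
      by (rule dlap_cong[OF _ vertex_SG]) (use Y in blast)
    moreover have "v k (q j) = eigc (Y k) (t / 5) (q j)" using Y vertex_SG by blast
    ultimately show ?thesis unfolding eigc_dlap_vertex by simp
  qed
  have M: "dlap 1 w (F q a (q b)) = decf (t / 5) * w (F q a (q b))" if ab: "a \<noteq> b" for a b
  proof -
    define z where "z = ((\<Sum>i\<in>UNIV. Y a i) - Y a b) + ((\<Sum>i\<in>UNIV. Y b i) - Y b a)"
    have vv: "v a (q b) = w (F q a (q b))" "v b (q a) = w (F q a (q b))" unfolding v_def F_swap[of b a] by simp_all
    have D: "dlap (Suc m) w (F q a (q b)) = decf (t / 5 ^ Suc m) * w (F q a (q b)) - z * normf m (t / 5)" for m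
    proof -
      have "dlap (Suc m) w (F q a (q b)) = dlap m (v a) (q b) + dlap m (v b) (q a)"
        unfolding dlap_junction[OF ab] v_def ..
      then show ?thesis unfolding dl vv z_def by (simp add: algebra_simps)
    qed
    have "F q a (q b) \<in> V q 1 - V q 0"
    proof
      have "q b \<in> V q 0" by simp
      then show "F q a (q b) \<in> V q 1" unfolding One_nat_def V.simps(2) by blast
      show "F q a (q b) \<notin> V q 0"
      proof
        assume "F q a (q b) \<in> V q 0"
        then obtain i where i: "F q a (q b) = q i" by auto
        then have "a = i" "q b = q i" by (rule F_eq_vertex[OF vertex_SG])+
        then show False using inj_q[of b i] ab by simp
      qed
    qed
    then have "(\<lambda>m. (3/2 * 5 ^ m) *\<^sub>R dlap m w (F q a (q b))) \<longlonglongrightarrow> t * w (F q a (q b))"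
      by (rule has_laplacian_tendsto[OF w])
    then have L: "(\<lambda>m. (3/2 * 5 ^ Suc m) *\<^sub>R dlap (Suc m) w (F q a (q b))) \<longlonglongrightarrow> t * w (F q a (q b))"
      by (rule LIMSEQ_Suc)
    have "(\<lambda>m. 3/2 * (5 ^ Suc m * decf (t / 5 ^ Suc m)) * w (F q a (q b))) \<longlonglongrightarrow> 3/2 * (2/3 * t) * w (F q a (q b))"
      by (intro tendsto_intros LIMSEQ_Suc[OF decf_scaled_tendsto])
    from tendsto_diff[OF this L] have "(\<lambda>m. 3/2 * (5 ^ Suc m * decf (t / 5 ^ Suc m)) * w (F q a (q b)) -
        (3/2 * 5 ^ Suc m) *\<^sub>R dlap (Suc m) w (F q a (q b))) \<longlonglongrightarrow> 0" by simp
    moreover have "3/2 * (5 ^ Suc m * decf (t / 5 ^ Suc m)) * w (F q a (q b)) -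
        (3/2 * 5 ^ Suc m) *\<^sub>R dlap (Suc m) w (F q a (q b)) = 3/2 * 5 ^ Suc m * (z * normf m (t / 5))" for m
      unfolding D real_scaleR_def by (simp add: algebra_simps)
    ultimately have "(\<lambda>m. 3/2 * 5 ^ Suc m * (z * normf m (t / 5))) \<longlonglongrightarrow> 0" by (simp only:)
    then have "(\<lambda>m. 3/2 * 5 ^ Suc m * (z * normf m (t / 5)) * (2/15 * (1/3) ^ m)) \<longlonglongrightarrow> 0 * (2/15 * 0)"
      by (intro tendsto_mult tendsto_const LIMSEQ_realpow_zero) auto
    moreover have "3/2 * 5 ^ Suc m * (z * normf m (t / 5)) * (2/15 * (1/3) ^ m) = z * ((5/3) ^ m * normf m (t / 5))" for m
      by (simp add: power_divide)
    ultimately have "(\<lambda>m. z * ((5/3) ^ m * normf m (t / 5))) \<longlonglongrightarrow> 0 * (2/15 * 0)" by (simp only:)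
    then have "(\<lambda>m. z * ((5/3) ^ m * normf m (t / 5))) \<longlonglongrightarrow> 0" by simp
    then have "z = 0" by (rule normf_not_to_0[OF regular_scale[OF t]])
    then show ?thesis using D[of 0] by simp
  qed
  define A where "A = w (F q 1 (q 2))"
  define B where "B = w (F q 2 (q 3))"
  define C where "C = w (F q 3 (q 1))"
  have sw: "w (F q 2 (q 1)) = A" "w (F q 3 (q 2)) = B" "w (F q 1 (q 3)) = C"
    unfolding A_def B_def C_def F_swap[of 2 1] F_swap[of 3 2] F_swap[of 1 3] by (rule refl)+
  have ww: "w (F q i (q i)) = 0" for i using w0 F_fix by simp
  have i3: "(1::3) + 1 = 2" "(1::3) - 1 = 3" "(2::3) + 1 = 3" "(2::3) - 1 = 1" "(3::3) + 1 = 1" "(3::3) - 1 = 2"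
    by simp_all
  have d1: "dlap 1 w (F q a (q b)) = (w (F q a (q (b + 1))) - w (F q a (q b))) + (w (F q a (q (b - 1))) - w (F q a (q b)))
      + ((w (F q b (q (a + 1))) - w (F q b (q a))) + (w (F q b (q (a - 1))) - w (F q b (q a))))" if "a \<noteq> b" for a b
    using dlap_junction[OF that, of 0 w] unfolding dlap_0 by simp
  define s where "s = decf (t / 5)"
  have eA: "B + C - 4 * A = s * A"
    using M[of 1 2] d1[of 1 2] unfolding i3 s_def[symmetric] by (simp add: ww sw A_def[symmetric] B_def[symmetric] C_def[symmetric])
  have eB: "A + C - 4 * B = s * B"
    using M[of 2 3] d1[of 2 3] unfolding i3 s_def[symmetric] by (simp add: ww sw A_def[symmetric] B_def[symmetric] C_def[symmetric])
  have eC: "A + B - 4 * C = s * C"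
    using M[of 3 1] d1[of 3 1] unfolding i3 s_def[symmetric] by (simp add: ww sw A_def[symmetric] B_def[symmetric] C_def[symmetric])
  have s: "s + 2 \<noteq> 0" "s + 5 \<noteq> 0" using s1 unfolding s_def by auto
  have "s * A + s * B + s * C + 2 * (A + B + C) = 0" by (simp only: eA[symmetric] eB[symmetric] eC[symmetric]) simp
  then have "(s + 2) * (A + B + C) = 0" by (simp add: algebra_simps)
  then have sum0: "A + B + C = 0" using s by simp
  have "(s + 5) * A = A + B + C" "(s + 5) * B = A + B + C" "(s + 5) * C = A + B + C"
    unfolding distrib_right eA[symmetric] eB[symmetric] eC[symmetric] by simp_all
  then have ABC: "A = 0" "B = 0" "C = 0" using sum0 s by simp_all
  have v0: "\<forall>k i. v k (q i) = 0"
    unfolding forall_3 v_def using ww sw ABC by (simp add: A_def B_def C_def)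
  have vy: "v k y = 0" if "y \<in> SG q" for k y
    using IH[unfolded dirichlet_unique_def, rule_format, OF v[of k] _ that] v0 by blast
  obtain k y where "y \<in> SG q" "x = F q k y" by (rule SG_cases[OF x])
  then show "w x = 0" using vy unfolding v_def by simp
qed

lemma dirichlet_unique_small: "\<exists>r>0. \<forall>t. \<bar>t\<bar> < r \<longrightarrow> dirichlet_unique t"
proof -
  obtain T where T: "T \<ge> 0" "\<forall>(u :: real^2 \<Rightarrow> real) f M A. has_laplacian q u f \<longrightarrow> (\<forall>x\<in>SG q. \<bar>f x\<bar> \<le> M) \<longrightarrow> (\<forall>i. \<bar>u (q i)\<bar> \<le> A) \<longrightarrow>
     (\<forall>x\<in>SG q. \<bar>u x\<bar> \<le> A + M * T)" using maximum_principle by blast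
  have "dirichlet_unique t" if t: "\<bar>t\<bar> < 1 / (T + 1)" for t
    unfolding dirichlet_unique_def
  proof (intro allI impI ballI)
    fix w x assume w: "has_laplacian q w (\<lambda>x. t * w x)" and w0: "\<forall>i. w (q i) = 0" and x: "x \<in> SG q"
    have c: "continuous_on (SG q) (\<lambda>x. \<bar>w x\<bar>)" by (rule continuous_on_rabs[OF has_laplacian_continuous(1)[OF w]])
    have ne: "SG q \<noteq> {}" using x by blast
    have "\<exists>y\<in>SG q. \<forall>z\<in>SG q. \<bar>w z\<bar> \<le> \<bar>w y\<bar>" by (rule continuous_attains_sup[OF SG_compact ne c])
    then obtain y where y: "y \<in> SG q" "\<forall>z\<in>SG q. \<bar>w z\<bar> \<le> \<bar>w y\<bar>" by blast
    have "\<forall>x\<in>SG q. \<bar>t * w x\<bar> \<le> \<bar>t\<bar> * \<bar>w y\<bar>" using y(2) by (simp add: abs_mult mult_left_mono)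
    then have "\<forall>x\<in>SG q. \<bar>w x\<bar> \<le> 0 + \<bar>t\<bar> * \<bar>w y\<bar> * T"
      using T(2)[rule_format, OF w, of "\<bar>t\<bar> * \<bar>w y\<bar>" 0] w0 by simp
    then have "\<bar>w y\<bar> \<le> \<bar>t\<bar> * \<bar>w y\<bar> * T" using y(1) by simp
    then have "\<bar>w y\<bar> * (1 - \<bar>t\<bar> * T) \<le> 0" by (simp add: algebra_simps)
    moreover have "\<bar>t\<bar> * T < 1"
    proof -
      have "\<bar>t\<bar> * T \<le> 1 / (T + 1) * T" using t T(1) by (intro mult_right_mono) auto
      also have "\<dots> < 1" using T(1) by simp
      finally show ?thesis .
    qed
    ultimately have "\<bar>w y\<bar> \<le> 0" by (simp add: mult_le_0_iff)
    then show "w x = 0" using y(2) x by force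
  qed
  then show ?thesis using T(1) by (intro exI[of _ "1 / (T + 1)"]) auto
qed

lemma dirichlet_unique_regular:
  assumes "regular t"
  shows "dirichlet_unique t"
proof -
  obtain r where r: "r > 0" "\<And>t. \<bar>t\<bar> < r \<Longrightarrow> dirichlet_unique t" using dirichlet_unique_small by blast
  obtain M where M: "\<bar>t\<bar> / 5 ^ M < r" using eventually_small[OF r(1), of t] by blast
  have "dirichlet_unique s" if "\<bar>s\<bar> / 5 ^ n < r" "regular s" for n s
    using that
  proof (induction n arbitrary: s)
    case (Suc n)
    have "dirichlet_unique (s / 5)"
      by (rule Suc.IH) (use Suc.prems regular_scale in auto)
    then show ?case by (rule dirichlet_unique_step[OF Suc.prems(2)])
  qed (use r in auto)
  then show ?thesis using M assms by blast
qed

lemma not_neumann_regular: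
  assumes t: "regular t"
  shows "\<not> neumann_eigenvalue q (- t)"
proof
  assume "neumann_eigenvalue q (- t)"
  then obtain u :: "real^2 \<Rightarrow> real" and x where x: "x \<in> SG q" "u x \<noteq> 0" and u: "has_laplacian q u (\<lambda>x. t * u x)"
    and n: "\<And>i. has_normal_derivative q u i 0" unfolding neumann_eigenvalue_def by auto
  have s: "decf t \<noteq> 0" "decf t \<noteq> - 6" using regularD(1)[OF t, of 0] by auto
  obtain y where y: "\<And>x. x \<in> SG q \<Longrightarrow> u x = eigc y t x"
    using eigenfunction_rep[OF dirichlet_unique_regular[OF t] s u] by blast
  have y0: "(\<Sum>i\<in>UNIV. y i) - y j = 0" for j
  proof -
    have "has_normal_derivative q (eigc y t) j 0" by (rule has_normal_derivative_cong[OF n y])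
    then have "(\<lambda>m. - ((5/3) ^ m * dlap m (eigc y t) (q j))) \<longlonglongrightarrow> 0" unfolding has_normal_derivative_dlap .
    from tendsto_add[OF this decf_third_tendsto[of t "eigc y t (q j)"]]
    have "(\<lambda>m. - ((5/3) ^ m * dlap m (eigc y t) (q j)) + (5/3) ^ m * (decf (t / 5 ^ m) / 2 * eigc y t (q j))) \<longlonglongrightarrow> 0" by simp
    moreover have "- ((5/3) ^ m * dlap m (eigc y t) (q j)) + (5/3) ^ m * (decf (t / 5 ^ m) / 2 * eigc y t (q j)) =
        ((\<Sum>i\<in>UNIV. y i) - y j) * ((5/3) ^ m * normf m t)" for m
      unfolding eigc_dlap_vertex by (simp add: algebra_simps)
    ultimately have "(\<lambda>m. ((\<Sum>i\<in>UNIV. y i) - y j) * ((5/3) ^ m * normf m t)) \<longlonglongrightarrow> 0" by (simp only:)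
    then show ?thesis by (rule normf_not_to_0[OF t])
  qed
  have "y i = 0" for i
  proof -
    have "y 1 + y 2 + y 3 - y j = 0" for j using y0[of j] unfolding sum_3 .
    from this[of 1] this[of 2] this[of 3] have "y 1 = 0" "y 2 = 0" "y 3 = 0" by linarith+
    then have "\<forall>i. y i = 0" unfolding forall_3 by blast
    then show ?thesis by blast
  qed
  then have "u x = 0" using y[OF x(1)] unfolding eigc_def by simp
  then show False using x(2) by simp
qed

lemma regular_pos: "t > 0 \<Longrightarrow> regular t"
proof -
  assume t: "t > 0"
  have p: "decf (t / 5 ^ m) > 0" for m by (rule decf_pos) (use t in simp)
  have "decf (t / 5 ^ m) \<notin> {0, - 2, - 3, - 5, - 6}" for m
    using p[of m] by auto
  then show ?thesis unfolding regular_def using t by blast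
qed

lemma finite_irregular: "finite {t. \<bar>t\<bar> \<le> X \<and> t \<noteq> 0 \<and> \<not> regular t}"
proof -
  have "\<forall>\<^sub>F x in at (0::real). decf x / x > 0" using decf_quotient[where ?'a = real] by (rule order_tendstoD(1)) simp
  moreover have "\<forall>\<^sub>F x in at (0::real). decf x > -1"
  proof -
    have "isCont (decf :: real \<Rightarrow> real) 0" using continuous_on_decf[of "UNIV :: real set"] by (simp add: continuous_on_eq_continuous_at)
    then have "(decf \<longlongrightarrow> (0::real)) (at 0)" unfolding isCont_def decf_0 .
    then show ?thesis by (rule order_tendstoD(1)) simp
  qed
  ultimately have "\<forall>\<^sub>F x in at (0::real). decf x / x > 0 \<and> decf x > -1" by (rule eventually_conj)
  then obtain r where r: "r > 0" "\<And>x::real. x \<noteq> 0 \<Longrightarrow> \<bar>x\<bar> < r \<Longrightarrow> decf x / x > 0 \<and> decf x > -1"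
    unfolding eventually_at by (auto simp: dist_real_def)
  obtain M where M: "\<And>m. m \<ge> M \<Longrightarrow> \<bar>X\<bar> / 5 ^ m < r" using eventually_small[OF r(1), of X] by blast
  have "{t. \<bar>t\<bar> \<le> X \<and> t \<noteq> 0 \<and> \<not> regular t} \<subseteq> (\<Union>m\<in>{..<M}. \<Union>c\<in>{0, - 2, - 3, - 5, - 6}. {t. \<bar>t\<bar> \<le> X \<and> decf (t / 5 ^ m) = c})"
  proof
    fix t assume t: "t \<in> {t. \<bar>t\<bar> \<le> X \<and> t \<noteq> 0 \<and> \<not> regular t}"
    then obtain m where m: "decf (t / 5 ^ m) \<in> {0, - 2, - 3, - 5, - 6}" unfolding regular_def by blast
    have "m < M"
    proof (rule ccontr)
      assume "\<not> m < M"
      then have "\<bar>X\<bar> / 5 ^ m < r" using M by simp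
      moreover have "\<bar>t\<bar> / 5 ^ m \<le> \<bar>X\<bar> / 5 ^ m" using t by (intro divide_right_mono) auto
      ultimately have "\<bar>t / 5 ^ m\<bar> < r" by (simp add: abs_divide)
      moreover have "t / 5 ^ m \<noteq> 0" using t by simp
      ultimately have "decf (t / 5 ^ m) / (t / 5 ^ m) > 0" "decf (t / 5 ^ m) > -1" using r(2) by blast+
      then show False using m by auto
    qed
    then show "t \<in> (\<Union>m\<in>{..<M}. \<Union>c\<in>{0, - 2, - 3, - 5, - 6}. {t. \<bar>t\<bar> \<le> X \<and> decf (t / 5 ^ m) = c})"
      using t m by blast
  qed
  moreover have "finite (\<Union>m\<in>{..<M}. \<Union>c\<in>{0, - 2, - 3, - 5, - 6}. {t. \<bar>t\<bar> \<le> X \<and> decf (t / 5 ^ m) = (c::real)})"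
    by (intro finite_UN_I decf_preimage_finite) auto
  ultimately show ?thesis by (rule finite_subset)
qed

lemma lambda2_le: "lambda2 q \<le> 25 * decroot"
proof -
  define N where "N \<mu> \<longleftrightarrow> neumann_eigenvalue q \<mu> \<and> \<mu> \<noteq> 0" for \<mu>
  have N12: "N (5 * decroot)" "N (25 * decroot)"
    using neumann_decroot[of 1] neumann_decroot[of 2] decroot(1) unfolding N_def by simp_all
  have Npos: "\<mu> > 0" if "N \<mu>" for \<mu>
  proof (rule ccontr)
    assume "\<not> \<mu> > 0"
    then have "- \<mu> > 0" using that unfolding N_def by auto
    from not_neumann_regular[OF regular_pos[OF this]] show False using that unfolding N_def by simp
  qed
  have "finite {\<mu>. N \<mu> \<and> \<mu> \<le> 25 * decroot}"
  proof (rule finite_subset)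
    show "{\<mu>. N \<mu> \<and> \<mu> \<le> 25 * decroot} \<subseteq> uminus ` {t. \<bar>t\<bar> \<le> 25 * decroot \<and> t \<noteq> 0 \<and> \<not> regular t}"
    proof
      fix \<mu> assume \<mu>: "\<mu> \<in> {\<mu>. N \<mu> \<and> \<mu> \<le> 25 * decroot}"
      then have "\<not> regular (- \<mu>)" using not_neumann_regular[of "- \<mu>"] unfolding N_def by auto
      moreover have "\<bar>- \<mu>\<bar> \<le> 25 * decroot" "- \<mu> \<noteq> 0" using \<mu> Npos[of \<mu>] by auto
      ultimately show "\<mu> \<in> uminus ` {t. \<bar>t\<bar> \<le> 25 * decroot \<and> t \<noteq> 0 \<and> \<not> regular t}"
        by (intro image_eqI[of _ _ "- \<mu>"]) auto
    qed
  qed (intro finite_imageI finite_irregular)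
  note fin = this
  have least: "(LEAST \<mu>. P \<mu>) \<le> b" if P: "\<And>\<mu>. P \<mu> \<Longrightarrow> N \<mu>" and b: "P b" "b \<le> 25 * decroot" for P b
  proof -
    let ?E = "{\<mu>. P \<mu> \<and> \<mu> \<le> 25 * decroot}"
    have f: "finite ?E" by (rule finite_subset[OF _ fin]) (use P in blast)
    have m: "Min ?E \<in> ?E" using b f by (intro Min_in) auto
    have "(LEAST \<mu>. P \<mu>) = Min ?E"
    proof (rule Least_equality)
      show "P (Min ?E)" using m by blast
      fix \<mu> assume "P \<mu>"
      show "Min ?E \<le> \<mu>"
      proof (cases "\<mu> \<le> 25 * decroot")
        case True
        then show ?thesis using f \<open>P \<mu>\<close> by (intro Min_le) auto
      next
        case False
        then show ?thesis using m by auto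
      qed
    qed
    also have "\<dots> \<le> b" using f b by (intro Min_le) auto
    finally show ?thesis .
  qed
  have "lambda1 q \<le> 5 * decroot"
    unfolding lambda1_def N_def[symmetric] by (rule least) (use N12 decroot(1) in auto)
  then have "lambda1 q < 25 * decroot" using decroot(1) by linarith
  then have "neumann_eigenvalue q (25 * decroot) \<and> 25 * decroot \<noteq> 0 \<and> 25 * decroot > lambda1 q"
    using N12(2) unfolding N_def by simp
  then show ?thesis unfolding lambda2_def
    by (intro least[of "\<lambda>\<mu>. neumann_eigenvalue q \<mu> \<and> \<mu> \<noteq> 0 \<and> \<mu> > lambda1 q"]) (auto simp: N_def)
qed

end

section \<open>Power series\<close>

context gasket begin

lemma has_normal_derivative_add:
  "has_normal_derivative q u l d \<Longrightarrow> has_normal_derivative q v l e \<Longrightarrow> has_normal_derivative q (\<lambda>x. u x + v x) l (d + e)"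
  unfolding has_normal_derivative_def by (drule tendsto_add, assumption) (simp add: algebra_simps)

lemma has_tangential_derivative_add:
  "has_tangential_derivative q u l d \<Longrightarrow> has_tangential_derivative q v l e \<Longrightarrow> has_tangential_derivative q (\<lambda>x. u x + v x) l (d + e)"
  unfolding has_tangential_derivative_def by (drule tendsto_add, assumption) (simp add: algebra_simps)

lemma monomial_SG: "k \<in> {1..3} \<Longrightarrow> x \<in> SG q \<Longrightarrow> monomial q l j k x = fps_nth (mon l k x) j"
  by (simp add: monomial_eq monf_def)

lemma monomial_series_admissible:
  fixes c :: "nat \<Rightarrow> nat \<Rightarrow> 'a::real_normed_vector"
  assumes "r < ln 5 / ln 2"
    and "(\<lambda>j. norm (c j 1)) \<in> O(\<lambda>j. fact j powr r)"
    and "(\<lambda>j. norm (c j 3)) \<in> O(\<lambda>j. fact j powr r)"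
    and "0 \<le> R" "R < lambda2 q"
    and "(\<lambda>j. norm (c j 2)) \<in> O(\<lambda>j. R ^ j)"
    and "k \<in> {1..3}"
  shows "\<exists>B. (\<forall>n. \<forall>x\<in>SG q. \<bar>fps_nth (mon l k x) n\<bar> \<le> B n) \<and> admissible B (\<lambda>j. c j k)"
proof -
  obtain K where K: "K \<ge> 1" "\<forall>i n. \<forall>x\<in>SG q. \<bar>fps_nth (cosine i x) n\<bar> \<le> K * 2 ^ n * recfact n"
    using cosine_bound by blast
  consider "k = 1" | "k = 2" | "k = 3" using assms(7) by fastforce
  then show ?thesis
  proof cases
    case 1
    have "admissible (\<lambda>n. K * 2 ^ n * recfact n) (\<lambda>j. c j k)"
      unfolding 1 by (rule admissible_factorial[OF assms(2,1)]) (use K(1) in simp)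
    then show ?thesis using K(2) unfolding mon_def 1
      by (intro exI[of _ "\<lambda>n. K * 2 ^ n * recfact n"]) simp
  next
    case 2
    obtain B where B: "\<forall>l n. \<forall>x\<in>SG q. \<bar>fps_nth (sine l x) n\<bar> \<le> B n" "ereal (25 * decroot) \<le> fps_conv_radius (Abs_fps B)"
      using sine_bound by blast
    have "ereal R < ereal (25 * decroot)" using assms(5) lambda2_le by simp
    also note B(2)
    finally have "admissible B (\<lambda>j. c j k)" unfolding 2 by (rule admissible_geometric[OF assms(6,4)])
    then show ?thesis using B(1) unfolding mon_def 2 by auto
  next
    case 3
    have "\<bar>fps_nth (tang l x) n\<bar> \<le> 12 * K * 2 ^ n * recfact n" if "x \<in> SG q" for n x
      by (rule tang_bound[OF _ K(1) that]) (use K(2) in blast)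
    moreover have "admissible (\<lambda>n. 12 * K * 2 ^ n * recfact n) (\<lambda>j. c j k)"
      unfolding 3 by (rule admissible_factorial[OF assms(3,1)]) (use K(1) in simp)
    ultimately show ?thesis unfolding mon_def 3
      by (intro exI[of _ "\<lambda>n. 12 * K * 2 ^ n * recfact n"]) simp
  qed
qed

lemma sum_1_3: "(\<Sum>k=1..3. f k) = f 1 + f 2 + f (3::nat)"
  by (simp add: eval_nat_numeral add.assoc)

theorem monomial_series:
  fixes c :: "nat \<Rightarrow> nat \<Rightarrow> 'a::{real_normed_field, banach}"
  assumes adm: "\<And>k. k \<in> {1..3} \<Longrightarrow>
    \<exists>B. (\<forall>n. \<forall>x\<in>SG q. \<bar>fps_nth (mon l k x) n\<bar> \<le> B n) \<and> admissible B (\<lambda>j. c j k)"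
  shows "\<exists>u :: real^2 \<Rightarrow> 'a.
    (\<forall>k\<in>{1..3}. uniformly_convergent_on (SG q)
        (\<lambda>N x. \<Sum>j<N. c j k * of_real (monomial q l j k x))) \<and>
    (\<forall>k\<in>{1..3}. \<forall>x\<in>SG q. summable (\<lambda>j. norm (c j k * of_real (monomial q l j k x)))) \<and>
    (\<forall>x\<in>SG q. u x = (\<Sum>k=1..3. \<Sum>j. c j k * of_real (monomial q l j k x))) \<and>
    u \<in> dom_laplacian_infinity q \<and>
    (\<forall>n. \<forall>x\<in>SG q.
      (\<forall>k\<in>{1..3}. summable (\<lambda>i. c (n + i) k * of_real (monomial q l i k x))) \<and>
      (laplacian q ^^ n) u x = (\<Sum>k=1..3. \<Sum>i. c (n + i) k * of_real (monomial q l i k x))) \<and>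
    (\<forall>j. c j 1 = (laplacian q ^^ j) u (q l) \<and>
         has_normal_derivative q ((laplacian q ^^ j) u) l (c j 2) \<and>
         has_tangential_derivative q ((laplacian q ^^ j) u) l (c j 3))"
proof -
  have "\<forall>k. \<exists>B. k \<in> {1..3} \<longrightarrow> (\<forall>n. \<forall>x\<in>SG q. \<bar>fps_nth (mon l k x) n\<bar> \<le> B n) \<and> admissible B (\<lambda>j. c j k)"
    using adm by blast
  from choice[OF this] obtain B where
    B: "\<forall>k. k \<in> {1..3} \<longrightarrow> (\<forall>n. \<forall>x\<in>SG q. \<bar>fps_nth (mon l k x) n\<bar> \<le> B k n) \<and> admissible (B k) (\<lambda>j. c j k)"
    by (rule exE)
  have Bd: "\<bar>fps_nth (mon l k x) n\<bar> \<le> B k n" if "k \<in> {1..3}" "x \<in> SG q" for k x n using B that by blast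
  have Bm: "\<bar>monomial q l n k x\<bar> \<le> B k n" if "k \<in> {1..3}" "x \<in> SG q" for k x n
    using Bd[OF that] monomial_SG[OF that] by simp
  have s0: "summable (\<lambda>n. norm (c (N + n) k) * B k n)" and s1: "summable (\<lambda>n. norm (c (N + n) k) * wconv (B k) n)"
    if "k \<in> {1..3}" for N k
  proof -
    have "admissible (B k) (\<lambda>j. c j k)" using B that by blast
    then show "summable (\<lambda>n. norm (c (N + n) k) * B k n)" "summable (\<lambda>n. norm (c (N + n) k) * wconv (B k) n)"
      unfolding admissible_def by (simp_all only: add.commute[of N])
  qed
  define w where "w k N x = (\<Sum>j. c (N + j) k * of_real (fps_nth (mon l k x) j))" for k N x
  define U where "U N x = (if x \<in> SG q then w 1 N x + w 2 N x + w 3 N x else 0)" for N x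
  have lw: "has_laplacian q (w k N) (w k (Suc N))" if k: "k \<in> {1..3}" for k N
    using chain_has_laplacian[OF chain_mon Bd[OF k] s0[OF k] s1[OF k], of N] unfolding w_def[abs_def] by simp
  have lU: "has_laplacian q (U N) (U (Suc N))" for N
    by (rule has_laplacian_cong[OF has_laplacian_add[OF has_laplacian_add[OF lw[of 1] lw[of 2]] lw[of 3]]])
       (simp_all add: U_def)
  have "laplacian q (U N) = U (Suc N)" for N
    unfolding laplacian_eq[OF lU] by (rule ext) (simp add: U_def)
  note lapU = this
  have pow: "(laplacian q ^^ n) (U 0) = U n" for n
    by (induction n) (simp_all add: lapU)
  have dom: "U N \<in> dom_laplacian_power q n" for n N
  proof (induction n arbitrary: N)
    case 0
    then show ?case using has_laplacian_continuous(1)[OF lU] by simp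
  next
    case (Suc n)
    then show ?case using lU[of N] by (auto simp: lapU)
  qed
  have Usum: "U N x = (\<Sum>k=1..3. \<Sum>j. c (N + j) k * of_real (monomial q l j k x))" if x: "x \<in> SG q" for N x
    using x unfolding sum_1_3 U_def w_def by (simp add: monomial_SG)
  have ul: "uniform_limit (SG q) (\<lambda>N x. \<Sum>j<N. c j k * of_real (monomial q l j k x)) (\<lambda>x. \<Sum>j. c j k * of_real (monomial q l j k x)) sequentially"
    if k: "k \<in> {1..3}" for k
    by (rule series_uniform_limit(1)[OF Bm[OF k]]) (use s0[OF k, of 0] in simp_all)
  have sn: "summable (\<lambda>j. norm (c (N + j) k * of_real (monomial q l j k x)))" if k: "k \<in> {1..3}" and x: "x \<in> SG q" for N k x
    by (rule series_uniform_limit(2)[OF Bm[OF k] s0[OF k] x])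
  have jets: "w k N (q l) = (if k = 1 then c N k else 0)"
    "has_normal_derivative q (w k N) l (if k = 2 then c N k else 0)"
    "has_tangential_derivative q (w k N) l (if k = 3 then c N k else 0)" if k: "k \<in> {1..3}" for k N
  proof -
    note J = mon_jets[OF k Bd[OF k] s0[OF k, of N], of "w k N"]
    have e: "w k N x = (\<Sum>n. c (N + n) k * of_real (fps_nth (mon l k x) n))" if "x \<in> SG q" for x by (rule w_def)
    show "w k N (q l) = (if k = 1 then c N k else 0)" by (rule J(1)[OF _ e, unfolded add_0_right])
    show "has_normal_derivative q (w k N) l (if k = 2 then c N k else 0)" by (rule J(2)[OF _ e, unfolded add_0_right])
    show "has_tangential_derivative q (w k N) l (if k = 3 then c N k else 0)" by (rule J(3)[OF _ e, unfolded add_0_right])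
  qed
  have UX: "w 1 N x + w 2 N x + w 3 N x = U N x" if "x \<in> SG q" for N x using that unfolding U_def by simp
  have j1: "c N 1 = U N (q l)" for N
    using jets(1)[of 1 N] jets(1)[of 2 N] jets(1)[of 3 N] unfolding UX[OF vertex_SG, symmetric] by simp
  have jn: "has_normal_derivative q (U N) l (c N 2)" for N
  proof (rule has_normal_derivative_cong[OF _ UX])
    have "has_normal_derivative q (\<lambda>x. w 1 N x + w 2 N x + w 3 N x) l
        ((if (1::nat) = 2 then c N 1 else 0) + (if (2::nat) = 2 then c N 2 else 0) + (if (3::nat) = 2 then c N 3 else 0))"
      by (intro has_normal_derivative_add jets(2)) auto
    then show "has_normal_derivative q (\<lambda>x. w 1 N x + w 2 N x + w 3 N x) l (c N 2)" by simp
  qed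
  have jt: "has_tangential_derivative q (U N) l (c N 3)" for N
  proof (rule has_tangential_derivative_cong[OF _ UX])
    have "has_tangential_derivative q (\<lambda>x. w 1 N x + w 2 N x + w 3 N x) l
        ((if (1::nat) = 3 then c N 1 else 0) + (if (2::nat) = 3 then c N 2 else 0) + (if (3::nat) = 3 then c N 3 else 0))"
      by (intro has_tangential_derivative_add jets(3)) auto
    then show "has_tangential_derivative q (\<lambda>x. w 1 N x + w 2 N x + w 3 N x) l (c N 3)" by simp
  qed
  show ?thesis
  proof (intro exI[of _ "U 0"] conjI ballI allI)
    show "uniformly_convergent_on (SG q) (\<lambda>N x. \<Sum>j<N. c j k * of_real (monomial q l j k x))" if "k \<in> {1..3}" for k
      using ul[OF that] unfolding uniformly_convergent_on_def by blast
    show "summable (\<lambda>j. norm (c j k * of_real (monomial q l j k x)))" if "k \<in> {1..3}" "x \<in> SG q" for k x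
      using sn[OF that, of 0] by simp
    show "U 0 x = (\<Sum>k=1..3. \<Sum>j. c j k * of_real (monomial q l j k x))" if "x \<in> SG q" for x
      using Usum[OF that, of 0] by simp
    show "U 0 \<in> dom_laplacian_infinity q" unfolding dom_laplacian_infinity_def using dom by blast
    show "summable (\<lambda>i. c (n + i) k * of_real (monomial q l i k x))" if "x \<in> SG q" "k \<in> {1..3}" for n k x
      by (rule summable_norm_cancel[OF sn[OF that(2,1)]])
    show "(laplacian q ^^ n) (U 0) x = (\<Sum>k=1..3. \<Sum>i. c (n + i) k * of_real (monomial q l i k x))" if "x \<in> SG q" for n x
      unfolding pow by (rule Usum[OF that])
    show "c j 1 = (laplacian q ^^ j) (U 0) (q l)" for j unfolding pow by (rule j1)
    show "has_normal_derivative q ((laplacian q ^^ j) (U 0)) l (c j 2)" for j unfolding pow by (rule jn)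
    show "has_tangential_derivative q ((laplacian q ^^ j) (U 0)) l (c j 3)" for j unfolding pow by (rule jt)
  qed
qed

end

theorem theorem3p1:
  fixes q :: "3 \<Rightarrow> real^2" and l :: 3
    and c :: "nat \<Rightarrow> nat \<Rightarrow> 'a::{real_normed_field, euclidean_space}"
    and r R :: real
  assumes "equilateral q"
    and "r < ln 5 / ln 2"
    and "(\<lambda>j. norm (c j 1)) \<in> O(\<lambda>j. fact j powr r)"
    and "(\<lambda>j. norm (c j 3)) \<in> O(\<lambda>j. fact j powr r)"
    and "0 \<le> R" and "R < lambda2 q"
    and "(\<lambda>j. norm (c j 2)) \<in> O(\<lambda>j. R ^ j)"
  shows "\<exists>u :: real^2 \<Rightarrow> 'a.
    (\<forall>k\<in>{1..3}. uniformly_convergent_on (SG q)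
        (\<lambda>N x. \<Sum>j<N. c j k * of_real (monomial q l j k x))) \<and>
    (\<forall>k\<in>{1..3}. \<forall>x\<in>SG q. summable (\<lambda>j. norm (c j k * of_real (monomial q l j k x)))) \<and>
    (\<forall>x\<in>SG q. u x = (\<Sum>k=1..3. \<Sum>j. c j k * of_real (monomial q l j k x))) \<and>
    u \<in> dom_laplacian_infinity q \<and>
    (\<forall>n. \<forall>x\<in>SG q.
      (\<forall>k\<in>{1..3}. summable (\<lambda>i. c (n + i) k * of_real (monomial q l i k x))) \<and>
      (laplacian q ^^ n) u x = (\<Sum>k=1..3. \<Sum>i. c (n + i) k * of_real (monomial q l i k x))) \<and>
    (\<forall>j. c j 1 = (laplacian q ^^ j) u (q l) \<and>
         has_normal_derivative q ((laplacian q ^^ j) u) l (c j 2) \<and>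
         has_tangential_derivative q ((laplacian q ^^ j) u) l (c j 3))"
proof -
  interpret gasket q by unfold_locales (rule assms(1))
  show ?thesis
    by (rule monomial_series, rule monomial_series_admissible[OF assms(2-7)])
qed

end
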